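(* Let $(\Sigma,g)$ be an oriented, connected closed Riemannian surface with Gaussian curvature $K<0$, and let $\mu\in\mathbb{R}$ be such that $K_\mu:=K+\mu^2\le 0$ everywhere on $\Sigma$ and $K_\mu(p)<0$ for some $p\in\Sigma$. Then the nonwandering set of the $\mu$-magnetic flow is everything: $NW(f^\mu)=T^1\Sigma$.
   Context: A $\mu$-magnetic geodesic is a unit-speed curve $\gamma$ with $\frac{D\dot\gamma}{dt}=\mu\, i\dot\gamma$, where $i$ is rotation by $+\pi/2$ in the oriented tangent planes; $\gamma_v$ is the one with $\dot\gamma_v(0)=v$, and the $\mu$-magnetic flow on $T^1\Sigma$ is $f^\mu_t(v)=\dot\gamma_v(t)$. A point $x\in X$ is nonwandering for a flow $F=\{f_t\}_{t\in\mathbb{R}}$ on $X$ if for every neighborhood $U$ of $x$ and every $T_0>0$ there is $t>T_0$ with $f_t(U)\cap U\ne\varnothing$; $NW(F)$ is the set of nonwandering points. *)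

theory Defs
  imports "HOL-Analysis.Analysis"
begin

section \<open>Smooth functions on open sets\<close>

text \<open>On an open subset \<open>S\<close> of a finite-dimensional space this is being of class
  \<open>C\<^sup>\<infinity>\<close>: all iterated directional derivatives, in arbitrary directions, exist and are
  themselves Frechet differentiable (hence continuous) on \<open>S\<close>.\<close>

definition smooth_on :: "'a::euclidean_space set \<Rightarrow> ('a \<Rightarrow> 'b::real_normed_vector) \<Rightarrow> bool"
  where "smooth_on S f \<longleftrightarrow>
    (\<forall>vs. \<forall>x\<in>S. foldr (\<lambda>v h y. frechet_derivative h (at y) v) vs f differentiable (at x))"


section \<open>Oriented Riemannian surfaces\<close>

text \<open>A chart is a pair of its domain and its coordinate map; the values of the coordinate map
  outside the domain are irrelevant.\<close>

type_synonym 'a chart = "'a set \<times> ('a \<Rightarrow> real^2)"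

definition is_chart :: "'a topology \<Rightarrow> 'a chart \<Rightarrow> bool"
  where "is_chart M c \<longleftrightarrow> openin M (fst c) \<and> open (snd c ` fst c) \<and>
    homeomorphic_map (subtopology M (fst c)) (top_of_set (snd c ` fst c)) (snd c)"

definition transition :: "'a chart \<Rightarrow> 'a chart \<Rightarrow> real^2 \<Rightarrow> real^2"
  where "transition c d = snd d \<circ> inv_into (fst c) (snd c)"

definition oriented_smooth_atlas :: "'a topology \<Rightarrow> 'a chart set \<Rightarrow> bool"
  where "oriented_smooth_atlas M A \<longleftrightarrow>
    (\<forall>c\<in>A. is_chart M c) \<and> (\<Union>c\<in>A. fst c) = topspace M \<and>
    (\<forall>c\<in>A. \<forall>d\<in>A. smooth_on (snd c ` (fst c \<inter> fst d)) (transition c d) \<and>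
       (\<forall>x \<in> snd c ` (fst c \<inter> fst d). det (jacobian (transition c d) (at x)) > 0))"

text \<open>A Riemannian metric is given by its coefficient matrices in the charts of the atlas,
  as functions of the chart coordinates, transforming as a covariant 2-tensor.\<close>

definition riemannian_metric :: "'a chart set \<Rightarrow> ('a chart \<Rightarrow> real^2 \<Rightarrow> real^2^2) \<Rightarrow> bool"
  where "riemannian_metric A g \<longleftrightarrow>
    (\<forall>c\<in>A. smooth_on (snd c ` fst c) (g c) \<and>
       (\<forall>x \<in> snd c ` fst c. transpose (g c x) = g c x \<and> (\<forall>v. v \<noteq> 0 \<longrightarrow> v \<bullet> (g c x *v v) > 0))) \<and>
    (\<forall>c\<in>A. \<forall>d\<in>A. \<forall>x \<in> snd c ` (fst c \<inter> fst d).
       g c x = transpose (jacobian (transition c d) (at x)) ** g d (transition c d x)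
                 ** jacobian (transition c d) (at x))"

definition oriented_riemannian_surface ::
    "'a topology \<Rightarrow> 'a chart set \<Rightarrow> ('a chart \<Rightarrow> real^2 \<Rightarrow> real^2^2) \<Rightarrow> bool"
  where "oriented_riemannian_surface M A g \<longleftrightarrow>
    Hausdorff_space M \<and> second_countable M \<and> oriented_smooth_atlas M A \<and> riemannian_metric A g"


section \<open>Levi-Civita connection and Gaussian curvature in coordinates\<close>

definition pd :: "2 \<Rightarrow> (real^2 \<Rightarrow> real) \<Rightarrow> real^2 \<Rightarrow> real"
  where "pd i f x = frechet_derivative f (at x) (axis i 1)"

text \<open>\<open>christoffel G k i j\<close> is \<open>\<Gamma>\<^sup>k\<^bsub>ij\<^esub>\<close>.\<close>

definition christoffel :: "(real^2 \<Rightarrow> real^2^2) \<Rightarrow> 2 \<Rightarrow> 2 \<Rightarrow> 2 \<Rightarrow> real^2 \<Rightarrow> real"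
  where "christoffel G k i j x = 1/2 * (\<Sum>l\<in>UNIV. matrix_inv (G x) $ k $ l *
    (pd i (\<lambda>y. G y $ j $ l) x + pd j (\<lambda>y. G y $ i $ l) x - pd l (\<lambda>y. G y $ i $ j) x))"

text \<open>The components \<open>R\<^sup>l\<close> of
  \<open>R(\<partial>\<^sub>i,\<partial>\<^sub>j)\<partial>\<^sub>k = \<nabla>\<^sub>i\<nabla>\<^sub>j\<partial>\<^sub>k - \<nabla>\<^sub>j\<nabla>\<^sub>i\<partial>\<^sub>k\<close>.\<close>

definition riemann :: "(real^2 \<Rightarrow> real^2^2) \<Rightarrow> 2 \<Rightarrow> 2 \<Rightarrow> 2 \<Rightarrow> real^2 \<Rightarrow> real^2"
  where "riemann G i j k x = (\<chi> l. pd i (christoffel G l j k) x - pd j (christoffel G l i k) x +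
    (\<Sum>m\<in>UNIV. christoffel G l i m x * christoffel G m j k x
              - christoffel G l j m x * christoffel G m i k x))"

text \<open>\<open>\<langle>R(\<partial>\<^sub>1,\<partial>\<^sub>2)\<partial>\<^sub>2, \<partial>\<^sub>1\<rangle> / |\<partial>\<^sub>1 \<and> \<partial>\<^sub>2|\<^sup>2\<close>\<close>

definition chart_curvature :: "(real^2 \<Rightarrow> real^2^2) \<Rightarrow> real^2 \<Rightarrow> real"
  where "chart_curvature G x = (riemann G 1 2 2 x \<bullet> (G x *v axis 1 1)) / det (G x)"

text \<open>The value does not depend on the chart chosen around \<open>p\<close>.\<close>

definition gauss_curvature ::
    "'a chart set \<Rightarrow> ('a chart \<Rightarrow> real^2 \<Rightarrow> real^2^2) \<Rightarrow> 'a \<Rightarrow> real"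
  where "gauss_curvature A g p =
    (let c = (SOME c. c \<in> A \<and> p \<in> fst c) in chart_curvature (g c) (snd c p))"

text \<open>\<open>DV/dt\<close> for a vector field \<open>V\<close> along the coordinate curve \<open>x\<close>.\<close>

definition cov_deriv ::
    "(real^2 \<Rightarrow> real^2^2) \<Rightarrow> (real \<Rightarrow> real^2) \<Rightarrow> (real \<Rightarrow> real^2) \<Rightarrow> real \<Rightarrow> real^2"
  where "cov_deriv G x V t = (\<chi> k. vector_derivative V (at t) $ k +
    (\<Sum>i\<in>UNIV. \<Sum>j\<in>UNIV. christoffel G k i j (x t) * vector_derivative x (at t) $ i * V t $ j))"

text \<open>Rotation by \<open>+\<pi>/2\<close> in the plane with Gram matrix \<open>G\<close> and standard orientation: the vector
  orthogonal to \<open>v\<close>, of the same length, with \<open>(v, w)\<close> positively oriented (if \<open>v \<noteq> 0\<close>).\<close>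

definition rot90 :: "real^2^2 \<Rightarrow> real^2 \<Rightarrow> real^2"
  where "rot90 G v = (THE w. v \<bullet> (G *v w) = 0 \<and> w \<bullet> (G *v w) = v \<bullet> (G *v v) \<and>
    v$1 * w$2 - v$2 * w$1 \<ge> 0)"


section \<open>Tangent vectors and the unit tangent bundle\<close>

text \<open>A tangent vector at \<open>p\<close> is a family of coordinate vectors, one for each chart around \<open>p\<close>,
  related by the Jacobians of the transition maps; it is \<open>0\<close> on all irrelevant arguments.\<close>

type_synonym 'a tangent = "'a \<times> ('a chart \<Rightarrow> real^2)"

definition tangent_bundle :: "'a topology \<Rightarrow> 'a chart set \<Rightarrow> 'a tangent set"
  where "tangent_bundle M A = {(p, \<xi>). p \<in> topspace M \<and>
    (\<forall>c. \<not> (c \<in> A \<and> p \<in> fst c) \<longrightarrow> \<xi> c = 0) \<and>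
    (\<forall>c\<in>A. \<forall>d\<in>A. p \<in> fst c \<inter> fst d \<longrightarrow>
       \<xi> d = jacobian (transition c d) (at (snd c p)) *v \<xi> c)}"

text \<open>The manifold topology of the tangent bundle: the coarsest one making its natural
  charts \<open>(p, \<xi>) \<mapsto> (c(p), \<xi> c)\<close> continuous with open domain.\<close>

definition tangent_topology :: "'a topology \<Rightarrow> 'a chart set \<Rightarrow> 'a tangent topology"
  where "tangent_topology M A = topology_generated_by
    {{(p, \<xi>) \<in> tangent_bundle M A. p \<in> fst c \<and> (snd c p, \<xi> c) \<in> W} | c W. c \<in> A \<and> open W}"

definition unit_tangent_bundle ::
    "'a topology \<Rightarrow> 'a chart set \<Rightarrow> ('a chart \<Rightarrow> real^2 \<Rightarrow> real^2^2) \<Rightarrow> 'a tangent set"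
  where "unit_tangent_bundle M A g = {(p, \<xi>) \<in> tangent_bundle M A.
    \<forall>c\<in>A. p \<in> fst c \<longrightarrow> \<xi> c \<bullet> (g c (snd c p) *v \<xi> c) = 1}"

definition unit_tangent_topology ::
    "'a topology \<Rightarrow> 'a chart set \<Rightarrow> ('a chart \<Rightarrow> real^2 \<Rightarrow> real^2^2) \<Rightarrow> 'a tangent topology"
  where "unit_tangent_topology M A g = subtopology (tangent_topology M A) (unit_tangent_bundle M A g)"


section \<open>The magnetic flow\<close>

definition velocity :: "'a chart set \<Rightarrow> (real \<Rightarrow> 'a) \<Rightarrow> real \<Rightarrow> 'a tangent"
  where "velocity A \<gamma> t =
    (\<gamma> t, \<lambda>c. if c \<in> A \<and> \<gamma> t \<in> fst c then vector_derivative (snd c \<circ> \<gamma>) (at t) else 0)"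

text \<open>Twice differentiable curves suffice here: solutions of the equation are automatically smooth.\<close>

definition magnetic_geodesic ::
    "'a topology \<Rightarrow> 'a chart set \<Rightarrow> ('a chart \<Rightarrow> real^2 \<Rightarrow> real^2^2) \<Rightarrow> real \<Rightarrow> (real \<Rightarrow> 'a) \<Rightarrow> bool"
  where "magnetic_geodesic M A g \<mu> \<gamma> \<longleftrightarrow> continuous_map euclideanreal M \<gamma> \<and>
    (\<forall>c\<in>A. \<forall>t. \<gamma> t \<in> fst c \<longrightarrow>
       (let x = snd c \<circ> \<gamma>; x' = (\<lambda>s. vector_derivative x (at s)) in
          x differentiable (at t) \<and> x' differentiable (at t) \<and>
          x' t \<bullet> (g c (x t) *v x' t) = 1 \<and>
          cov_deriv (g c) x x' t = \<mu> *\<^sub>R rot90 (g c (x t)) (x' t)))"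

definition magnetic_geodesic_from ::
    "'a topology \<Rightarrow> 'a chart set \<Rightarrow> ('a chart \<Rightarrow> real^2 \<Rightarrow> real^2^2) \<Rightarrow> real \<Rightarrow> 'a tangent \<Rightarrow> real \<Rightarrow> 'a"
  where "magnetic_geodesic_from M A g \<mu> v =
    (THE \<gamma>. magnetic_geodesic M A g \<mu> \<gamma> \<and> velocity A \<gamma> 0 = v)"

definition magnetic_flow ::
    "'a topology \<Rightarrow> 'a chart set \<Rightarrow> ('a chart \<Rightarrow> real^2 \<Rightarrow> real^2^2) \<Rightarrow> real \<Rightarrow> real \<Rightarrow> 'a tangent \<Rightarrow> 'a tangent"
  where "magnetic_flow M A g \<mu> t v = velocity A (magnetic_geodesic_from M A g \<mu> v) t"


section \<open>Nonwandering points\<close>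

definition nonwandering_set :: "'x topology \<Rightarrow> (real \<Rightarrow> 'x \<Rightarrow> 'x) \<Rightarrow> 'x set"
  where "nonwandering_set X F = {x \<in> topspace X.
    \<forall>U. openin X U \<and> x \<in> U \<longrightarrow> (\<forall>T\<^sub>0>0. \<exists>t>T\<^sub>0. F t ` U \<inter> U \<noteq> {})}"

end

theory Submission
  imports Defs
begin

text \<open>
  The proof is Poincare recurrence. In the coordinates \<open>(x, p)\<close> with \<open>p = g v\<close> the magnetic
  equation is given by a divergence-free vector field, and the coordinate changes
  \<open>(x, p) \<mapsto> (\<psi> x, q)\<close>, where \<open>p = (D\<psi>)\<^sup>T q\<close>, have determinant 1. Hence the flow preserves the
  volume of the compact shell \<open>1 \<le> |v| \<le> 2\<close>. The field is made positively homogeneous, so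
  that the flow commutes with rescaling; an open set \<open>U\<close> of unit vectors is thickened to the open
  set \<open>{r u | u \<in> U, 1 < r < 2}\<close>, which has positive volume, and a return of the thickened set is a
  return of \<open>U\<close>.

  Differentiable dependence on initial conditions is not needed: a step of Euler's method for a
  divergence-free field has Jacobian determinant \<open>1 + O(h\<^sup>2)\<close>, so in the limit the flow does
  not decrease volume, and this one-sided bound suffices for recurrence.
\<close>

section \<open>Ordinary differential equations and volume\<close>

text \<open>In the coordinates (x, v) the invariant volume carries the density det g; for (x, p) it
  is plain Lebesgue measure, which is what lets all charts share one elementary estimate. Unit
  vectors have volume zero among all nonzero vectors, hence the thickening. Homogeneity is arranged
  because at speed r the equation Dv/dt = \<mu> i v bends curves with curvature \<mu>/r: the levels
  |v| = r would carry different dynamics, and a return in the shell would say nothing about unit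
  vectors. With the factors 1/n every level is a rescaled copy of the unit level. The volume bound
  is proved for a short time inside a convex ball of one chart. Finitely many such balls cover the
  shell, which gives a uniform short time; longer times follow by halving. If no return occurred,
  the images of U at the multiples of a time T would be pairwise disjoint in the shell, each at
  least as large as U, against the finite volume of the shell. The flow is built abstractly from
  glued integral curves; only uniqueness ties it to the definite description behind the magnetic
  flow.\<close>

lemma onorm_scaleR_left_le:
  fixes v :: "'a::real_normed_vector"
  assumes "norm v \<le> B"
  shows "onorm (\<lambda>h::real. h *\<^sub>R v) \<le> B"
proof (rule onorm_le)
  fix h :: real
  show "norm (h *\<^sub>R v) \<le> B * norm h"
    using mult_right_mono[OF assms norm_ge_zero[of h]] by (simp add: mult.commute)
qed

text \<open>Gronwall's inequality for short intervals, without an exponential. At the time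
  \<open>s\<close> of largest distance the mean value inequality bounds this distance by its value
  at \<open>t0\<close> plus half of itself. As \<open>t0\<close> may lie anywhere in the interval,
  the estimate serves forwards and backwards in time.\<close>

lemma ode_dist_le:
  fixes z w :: "real \<Rightarrow> 'a::real_normed_vector"
  assumes t0: "t0 \<in> {a..b}" and t: "t \<in> {a..b}" and L: "L * (b - a) \<le> 1/2" "0 \<le> L"
    and z: "\<And>t. t \<in> {a..b} \<Longrightarrow> (z has_vector_derivative F (z t)) (at t within {a..b})"
    and w: "\<And>t. t \<in> {a..b} \<Longrightarrow> (w has_vector_derivative F (w t)) (at t within {a..b})"
    and lip: "\<And>t. t \<in> {a..b} \<Longrightarrow> norm (F (z t) - F (w t)) \<le> L * norm (z t - w t)"
  shows "norm (z t - w t) \<le> 2 * norm (z t0 - w t0)"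
proof -
  let ?d = "\<lambda>t. z t - w t"
  have d: "(?d has_vector_derivative F (z t) - F (w t)) (at t within {a..b})" if "t \<in> {a..b}" for t
    using z[OF that] w[OF that] by (rule has_vector_derivative_diff)
  have "continuous_on {a..b} (\<lambda>t. norm (?d t))"
    by (intro continuous_on_norm continuous_on_vector_derivative[OF d])
  moreover have "{a..b} \<noteq> {}" using t0 by auto
  ultimately obtain s where s: "s \<in> {a..b}" "\<And>t. t \<in> {a..b} \<Longrightarrow> norm (?d t) \<le> norm (?d s)"
    using continuous_attains_sup[of "{a..b}" "\<lambda>t. norm (?d t)"] by auto
  have "norm (?d s - ?d t0) \<le> (L * norm (?d s)) * norm (s - t0)"
  proof (rule differentiable_bound[where S="{a..b}" and f'="\<lambda>t h. h *\<^sub>R (F (z t) - F (w t))"])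
    fix t assume t: "t \<in> {a..b}"
    show "(?d has_derivative (\<lambda>h. h *\<^sub>R (F (z t) - F (w t)))) (at t within {a..b})"
      using d[OF t] by (simp add: has_vector_derivative_def)
    have "norm (F (z t) - F (w t)) \<le> L * norm (?d s)"
      using lip[OF t] s(2)[OF t] L(2) by (meson mult_left_mono order_trans)
    then show "onorm (\<lambda>h. h *\<^sub>R (F (z t) - F (w t))) \<le> L * norm (?d s)"
      by (rule onorm_scaleR_left_le)
  qed (use s t0 in auto)
  also have "\<dots> \<le> (L * norm (?d s)) * (b - a)"
    using s(1) t0 L by (intro mult_left_mono) auto
  also have "\<dots> = (L * (b - a)) * norm (?d s)" by simp
  also have "\<dots> \<le> 1/2 * norm (?d s)" using L by (intro mult_right_mono) auto
  finally have "norm (?d s) \<le> 2 * norm (?d t0)"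
    using norm_triangle_sub[of "?d s" "?d t0"] by linarith
  with s(2)[OF t] show ?thesis by linarith
qed

text \<open>The Picard operator is a contraction with factor 1/2 on the complete space of bounded
  continuous functions, because the interval is short relative to the Lipschitz constant.\<close>

lemma picard_global:
  fixes G :: "'a::euclidean_space \<Rightarrow> 'a"
  assumes lip: "\<And>x y. norm (G x - G y) \<le> L * norm (x - y)" and "0 \<le> L" "0 < \<tau>" "L * \<tau> \<le> 1/2"
  obtains y where "y 0 = z"
    "\<And>t. t \<in> {-\<tau>..\<tau>} \<Longrightarrow> (y has_vector_derivative G (y t)) (at t within {-\<tau>..\<tau>})"
proof -
  have "L-lipschitz_on UNIV G" using lip \<open>0 \<le> L\<close>
    by (auto simp: lipschitz_on_def dist_norm)
  then have contG: "continuous_on UNIV G" by (rule lipschitz_on_continuous_on)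
  \<comment> \<open>Clamping time to the interval lets the fixed point be sought among bounded
    continuous functions on the whole line.\<close>
  define cl where "cl t = max (-\<tau>) (min \<tau> t)" for t :: real
  have cl: "cl t \<in> {-\<tau>..\<tau>}" "t \<in> {-\<tau>..\<tau>} \<Longrightarrow> cl t = t" for t
    using \<open>0 < \<tau>\<close> by (auto simp: cl_def)
  \<comment> \<open>The integral from 0 to \<open>t\<close> is written as a difference of integrals
    from \<open>-\<tau>\<close>, since \<open>integral {0..t}\<close> would be 0 for negative
    \<open>t\<close>.\<close>
  define Q where "Q f t = z + (integral {-\<tau>..t} (\<lambda>s. G (f s)) - integral {-\<tau>..0} (\<lambda>s. G (f s)))"
    for f :: "real \<Rightarrow> 'a" and t
  have contGf: "continuous_on {-\<tau>..\<tau>} (\<lambda>s. G (f s))" if "continuous_on UNIV f" for f :: "real \<Rightarrow> 'a"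
    using continuous_on_compose2[OF contG that] by (meson continuous_on_subset subset_UNIV)
  have derQ: "(Q f has_vector_derivative G (f t)) (at t within {-\<tau>..\<tau>})"
    if "continuous_on UNIV f" "t \<in> {-\<tau>..\<tau>}" for f t
    unfolding Q_def
    by (rule derivative_eq_intros integral_has_vector_derivative contGf that refl)+ auto
  have contQ: "continuous_on {-\<tau>..\<tau>} (Q f)" if "continuous_on UNIV f" for f
    using derQ[OF that] by (rule continuous_on_vector_derivative)
  have bQ: "(\<lambda>t. Q f (cl t)) \<in> bcontfun" if "continuous_on UNIV f" for f
  proof -
    have "bounded (Q f ` {-\<tau>..\<tau>})"
      by (intro compact_imp_bounded compact_continuous_image contQ that) auto
    then have "bounded (range (\<lambda>t. Q f (cl t)))" by (rule bounded_subset) (use cl in auto)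
    moreover have "continuous_on UNIV (\<lambda>t. Q f (cl t))"
      by (rule continuous_on_compose2[OF contQ[OF that]]) (use cl in \<open>auto simp: cl_def intro!: continuous_intros\<close>)
    ultimately show ?thesis by (simp add: bcontfun_def)
  qed
  define P where "P f = Bcontfun (\<lambda>t. Q (apply_bcontfun f) (cl t))" for f :: "real \<Rightarrow>\<^sub>C 'a"
  have P: "apply_bcontfun (P f) t = Q (apply_bcontfun f) (cl t)" for f t
    unfolding P_def by (subst Bcontfun_inverse) (use bQ[of "apply_bcontfun f"] in auto)
  have "dist (P f) (P g) \<le> 1/2 * dist f g" for f g
  proof (rule dist_bound)
    fix t
    \<comment> \<open>Both \<open>Q f 0\<close> and \<open>Q g 0\<close> equal \<open>z\<close>, so
      subtracting them is free and gives the increment of \<open>Q f - Q g\<close> from 0, to which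
      the mean value inequality applies.\<close>
    have "dist (Q f (cl t)) (Q g (cl t)) = norm ((Q f (cl t) - Q g (cl t)) - (Q f 0 - Q g 0))"
      by (simp add: dist_norm Q_def)
    also have "\<dots> \<le> L * dist f g * norm (cl t - 0)"
    proof (rule differentiable_bound[where S="{-\<tau>..\<tau>}" and f'="\<lambda>t h. h *\<^sub>R (G (f t) - G (g t))"])
      fix s assume s: "s \<in> {-\<tau>..\<tau>}"
      have "((\<lambda>t. Q f t - Q g t) has_vector_derivative (G (f s) - G (g s))) (at s within {-\<tau>..\<tau>})"
        by (intro has_vector_derivative_diff derQ s) auto
      then show "((\<lambda>t. Q f t - Q g t) has_derivative (\<lambda>h. h *\<^sub>R (G (f s) - G (g s)))) (at s within {-\<tau>..\<tau>})"
        by (simp add: has_vector_derivative_def)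
      have "norm (G (f s) - G (g s)) \<le> L * norm (f s - g s)" by (rule lip)
      also have "\<dots> \<le> L * dist f g" 
        using dist_bounded[of f s g] \<open>0 \<le> L\<close> by (auto simp: dist_norm intro!: mult_left_mono)
      finally show "onorm (\<lambda>h. h *\<^sub>R (G (f s) - G (g s))) \<le> L * dist f g"
        by (rule onorm_scaleR_left_le)
    qed (use cl \<open>0 < \<tau>\<close> in auto)
    also have "\<dots> \<le> L * dist f g * \<tau>"
      using cl(1)[of t] \<open>0 \<le> L\<close> by (intro mult_left_mono) auto
    also have "\<dots> = (L * \<tau>) * dist f g" by simp
    also have "\<dots> \<le> 1/2 * dist f g" using assms by (intro mult_right_mono) auto
    finally show "dist (P f t) (P g t) \<le> 1/2 * dist f g" by (simp add: P)
  qed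
  then have "\<exists>!f. P f = f" by (intro banach_fix_type[where c="1/2"]) auto
  then obtain f where f: "P f = f" by auto
  have ff: "f t = Q f (cl t)" for t using P[of f t] f by simp
  show ?thesis
  proof
    show "apply_bcontfun f 0 = z" using ff[of 0] cl(2)[of 0] \<open>0 < \<tau>\<close> by (simp add: Q_def)
    fix t assume t: "t \<in> {-\<tau>..\<tau>}"
    have "(Q f has_vector_derivative G (f t)) (at t within {-\<tau>..\<tau>})" by (intro derQ t) auto
    then show "(f has_vector_derivative G (f t)) (at t within {-\<tau>..\<tau>})"
      by (rule has_vector_derivative_transform[OF t, rotated]) (metis ff cl(2))
  qed
qed

lemma vector_derivative_bound:
  fixes y :: "real \<Rightarrow> 'a::real_normed_vector"
  assumes "convex S" "\<And>t. t \<in> S \<Longrightarrow> (y has_vector_derivative y' t) (at t within S)"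
    "\<And>t. t \<in> S \<Longrightarrow> norm (y' t) \<le> B" "a \<in> S" "b \<in> S"
  shows "norm (y a - y b) \<le> B * \<bar>a - b\<bar>"
proof -
  have "norm (y a - y b) \<le> B * norm (a - b)"
  proof (rule differentiable_bound[where S=S and f'="\<lambda>t h. h *\<^sub>R y' t"])
    fix t assume t: "t \<in> S"
    show "(y has_derivative (\<lambda>h. h *\<^sub>R y' t)) (at t within S)"
      using assms(2)[OF t] by (simp add: has_vector_derivative_def)
    show "onorm (\<lambda>h. h *\<^sub>R y' t) \<le> B"
      using assms(3)[OF t] by (rule onorm_scaleR_left_le)
  qed (use assms in auto)
  then show ?thesis by simp
qed

text \<open>Off the compact convex set the field is replaced by its composition with the
  nearest-point projection, which keeps it globally Lipschitz.\<close>

lemma picard_local: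
  fixes F :: "'a::euclidean_space \<Rightarrow> 'a"
  assumes D: "compact D" "convex D" and lip: "\<And>x y. x \<in> D \<Longrightarrow> y \<in> D \<Longrightarrow> norm (F x - F y) \<le> L * norm (x - y)"
    and B: "\<And>x. x \<in> D \<Longrightarrow> norm (F x) \<le> B" and "0 \<le> L" "0 < \<tau>" "L * \<tau> \<le> 1/2"
    and z: "cball z (B * \<tau>) \<subseteq> D" "z \<in> D"
  obtains y where "y 0 = z" "\<And>t. t \<in> {-\<tau>..\<tau>} \<Longrightarrow> y t \<in> cball z (B * \<tau>)"
    "\<And>t. t \<in> {-\<tau>..\<tau>} \<Longrightarrow> (y has_vector_derivative F (y t)) (at t within {-\<tau>..\<tau>})"
proof -
  let ?G = "\<lambda>x. F (closest_point D x)"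
  have ne: "D \<noteq> {}" and cl: "closed D" using z D by (auto simp: compact_imp_closed)
  have inD: "closest_point D x \<in> D" for x using ne cl by (simp add: closest_point_in_set)
  have "norm (?G x - ?G y) \<le> L * norm (x - y)" for x y
    using lip[OF inD inD, of x y] closest_point_lipschitz[OF D(2) cl ne, of x y] \<open>0 \<le> L\<close>
    by (auto simp: dist_norm intro: order_trans mult_left_mono)
  then obtain y where y: "y 0 = z"
    "\<And>t. t \<in> {-\<tau>..\<tau>} \<Longrightarrow> (y has_vector_derivative ?G (y t)) (at t within {-\<tau>..\<tau>})"
    using picard_global[of ?G L \<tau> z] assms by auto
  have "norm (F z) \<le> B" using B z by auto
  then have "0 \<le> B" using norm_ge_zero order_trans by blast
  have yin: "y t \<in> cball z (B * \<tau>)" if "t \<in> {-\<tau>..\<tau>}" for t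
  proof -
    have "norm (y t - y 0) \<le> B * \<bar>t - 0\<bar>"
      by (rule vector_derivative_bound[OF _ y(2)]) (use that \<open>0 < \<tau>\<close> B inD in auto)
    also have "\<dots> \<le> B * \<tau>" using that \<open>0 \<le> B\<close> by (intro mult_left_mono) auto
    finally show ?thesis using y(1) by (simp add: dist_norm norm_minus_commute)
  qed
  show ?thesis
  proof
    fix t assume t: "t \<in> {-\<tau>..\<tau>}"
    have "closest_point D (y t) = y t" using yin[OF t] z by (intro closest_point_self) auto
    then show "(y has_vector_derivative F (y t)) (at t within {-\<tau>..\<tau>})" using y(2)[OF t] by simp
  qed (use y yin in auto)
qed

section \<open>First-order expansion of determinants near the identity\<close>

text \<open>Multiplying by one more factor multiplies the old error by at most 1 + |L| and adds the
  cross term of order h^2. What matters is that \<open>M\<close> depends on \<open>S\<close> and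
  \<open>L\<close> only, so one constant serves at all points and for all small steps
  \<open>h\<close>.\<close>

lemma prod_1_plus_approx:
  fixes L :: real
  assumes "finite S"
  shows "\<exists>M\<ge>0. \<forall>(a::'i \<Rightarrow> real) h. (\<forall>i\<in>S. \<bar>a i\<bar> \<le> L) \<longrightarrow> \<bar>h\<bar> \<le> 1 \<longrightarrow>
    \<bar>(\<Prod>i\<in>S. 1 + h * a i) - (1 + h * sum a S)\<bar> \<le> M * h\<^sup>2"
  using assms
proof induction
  case empty
  then show ?case by auto
next
  case (insert k S)
  then obtain M where M: "M \<ge> 0" "\<And>(a::'i \<Rightarrow> real) h. (\<forall>i\<in>S. \<bar>a i\<bar> \<le> L) \<Longrightarrow> \<bar>h\<bar> \<le> 1 \<Longrightarrow>
    \<bar>(\<Prod>i\<in>S. 1 + h * a i) - (1 + h * sum a S)\<bar> \<le> M * h\<^sup>2" by blast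
  let ?M = "(1 + \<bar>L\<bar>) * M + \<bar>L\<bar> * (of_nat (card S) * \<bar>L\<bar>)"
  have "\<bar>(\<Prod>i\<in>insert k S. 1 + h * a i) - (1 + h * sum a (insert k S))\<bar> \<le> ?M * h\<^sup>2"
    if a: "\<forall>i\<in>insert k S. \<bar>a i\<bar> \<le> L" and h: "\<bar>h\<bar> \<le> 1" for a :: "'i \<Rightarrow> real" and h
  proof -
    let ?e = "(\<Prod>i\<in>S. 1 + h * a i) - (1 + h * sum a S)"
    have e: "\<bar>?e\<bar> \<le> M * h\<^sup>2" using M(2)[of a h] a h by auto
    have ak: "\<bar>a k\<bar> \<le> \<bar>L\<bar>" using a by auto
    have "\<bar>h * a k\<bar> \<le> 1 * \<bar>L\<bar>" unfolding abs_mult using ak h by (intro mult_mono) auto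
    then have k1: "\<bar>1 + h * a k\<bar> \<le> 1 + \<bar>L\<bar>" by linarith
    have sa: "\<bar>sum a S\<bar> \<le> of_nat (card S) * \<bar>L\<bar>"
      by (intro order_trans[OF sum_abs] sum_bounded_above) (use a in force)
    have "(\<Prod>i\<in>insert k S. 1 + h * a i) - (1 + h * sum a (insert k S))
        = (1 + h * a k) * ?e + h\<^sup>2 * (a k * sum a S)"
      using insert by (simp add: algebra_simps power2_eq_square)
    also have "\<bar>\<dots>\<bar> \<le> \<bar>1 + h * a k\<bar> * \<bar>?e\<bar> + h\<^sup>2 * (\<bar>a k\<bar> * \<bar>sum a S\<bar>)"
      by (rule order_trans[OF abs_triangle_ineq]) (simp add: abs_mult)
    also have "\<dots> \<le> (1 + \<bar>L\<bar>) * (M * h\<^sup>2) + h\<^sup>2 * (\<bar>L\<bar> * (of_nat (card S) * \<bar>L\<bar>))"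
      using k1 e ak sa by (intro add_mono mult_mono) auto
    also have "\<dots> = ?M * h\<^sup>2" by (simp add: algebra_simps)
    finally show ?thesis .
  qed
  moreover have "?M \<ge> 0" using M by auto
  ultimately show ?case by blast
qed

text \<open>In the Leibniz formula the identity permutation gives the product of the diagonal
  entries, which produces the trace. Any other permutation moves at least two indices, so its term
  has at least two factors of size O(h).\<close>

lemma det_mat_1_plus:
  fixes L :: real
  obtains M where "0 \<le> M" "\<And>(A::real^'n^'n) h. (\<And>i j. \<bar>A$i$j\<bar> \<le> L) \<Longrightarrow> \<bar>h\<bar> \<le> 1 \<Longrightarrow>
     \<bar>det (mat 1 + h *\<^sub>R A) - (1 + h * trace A)\<bar> \<le> M * h\<^sup>2"
proof -
  obtain M0 where M0: "M0 \<ge> 0" "\<And>(a::'n \<Rightarrow> real) h. (\<forall>i\<in>UNIV. \<bar>a i\<bar> \<le> L) \<Longrightarrow> \<bar>h\<bar> \<le> 1 \<Longrightarrow>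
    \<bar>(\<Prod>i\<in>UNIV. 1 + h * a i) - (1 + h * sum a UNIV)\<bar> \<le> M0 * h\<^sup>2"
    using prod_1_plus_approx[of "UNIV::'n set" L] by auto
  let ?Pm = "{p::'n\<Rightarrow>'n. p permutes UNIV}"
  define c where "c = 1 + \<bar>L\<bar>"
  let ?M = "M0 + (\<Sum>p\<in>?Pm - {id}. c ^ CARD('n))"
  have fin: "finite ?Pm" by simp
  have idP: "id \<in> ?Pm" by (simp add: permutes_id)
  have c: "c \<ge> 1" by (auto simp: c_def)
  have "\<bar>det (mat 1 + h *\<^sub>R A) - (1 + h * trace A)\<bar> \<le> ?M * h\<^sup>2"
    if A: "\<And>i j. \<bar>A$i$j\<bar> \<le> L" and h: "\<bar>h\<bar> \<le> 1" for A :: "real^'n^'n" and h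
  proof -
    let ?B = "mat 1 + h *\<^sub>R A"
    let ?t = "\<lambda>p. of_int (sign p) * (\<Prod>i\<in>UNIV. ?B$i$p i)"
    have off: "\<bar>?t p\<bar> \<le> c ^ CARD('n) * h\<^sup>2" if p: "p \<in> ?Pm - {id}" for p
    proof -
      obtain i where i: "p i \<noteq> i" using p by (auto simp: fun_eq_iff)
      have inj: "inj p" using p permutes_inj by auto
      then have j: "p (p i) \<noteq> p i" using i by (meson injD)
      let ?D = "{i. p i \<noteq> i}"
      have "card {i, p i} \<le> card ?D" using i j by (intro card_mono) auto
      then have cD: "2 \<le> card ?D" using i by (simp add: eq_commute)
      have Aij: "\<bar>A$i$j\<bar> \<le> c" for i j using A[of i j] by (simp add: c_def)
      have hA: "\<bar>h * A$i$j\<bar> \<le> \<bar>h\<bar> * c" for i j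
        unfolding abs_mult using Aij by (intro mult_left_mono) auto
      have hA1: "\<bar>h * A$i$j\<bar> \<le> \<bar>L\<bar>" for i j
      proof -
        have "\<bar>h\<bar> * \<bar>A$i$j\<bar> \<le> 1 * \<bar>L\<bar>" using h A[of i j] by (intro mult_mono) auto
        then show ?thesis by (simp add: abs_mult)
      qed
      have "\<bar>?t p\<bar> = (\<Prod>i\<in>UNIV. \<bar>?B$i$p i\<bar>)"
        by (simp add: abs_mult abs_prod sign_def)
      also have "\<dots> \<le> (\<Prod>i\<in>UNIV. c * (if p i \<noteq> i then \<bar>h\<bar> else 1))"
      proof (intro prod_mono conjI)
        fix i show "\<bar>?B$i$p i\<bar> \<le> c * (if p i \<noteq> i then \<bar>h\<bar> else 1)"
          using hA[of i "p i"] hA1[of i "p i"] abs_triangle_ineq[of 1 "h * A$i$p i"]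
          by (auto simp: mat_def c_def mult.commute)
      qed auto
      also have "\<dots> = c ^ CARD('n) * \<bar>h\<bar> ^ card ?D"
      proof -
        have "(\<Prod>i\<in>UNIV. if p i \<noteq> i then \<bar>h\<bar> else 1) = (\<Prod>i\<in>?D. \<bar>h\<bar>)"
          by (subst prod.inter_filter[symmetric]) auto
        then show ?thesis by (simp add: prod.distrib)
      qed
      also have "\<dots> \<le> c ^ CARD('n) * \<bar>h\<bar> ^ 2"
        using c h cD by (intro mult_left_mono power_decreasing) auto
      finally show ?thesis by simp
    qed
    have "det ?B = ?t id + (\<Sum>p\<in>?Pm - {id}. ?t p)"
      unfolding det_def by (rule sum.remove[OF fin idP])
    also have "?t id = (\<Prod>i\<in>UNIV. 1 + h * A$i$i)"
      by (simp add: sign_id mat_def)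
    finally have eq: "det ?B = (\<Prod>i\<in>UNIV. 1 + h * A$i$i) + (\<Sum>p\<in>?Pm - {id}. ?t p)" .
    have "\<bar>det ?B - (1 + h * trace A)\<bar>
       \<le> \<bar>(\<Prod>i\<in>UNIV. 1 + h * A$i$i) - (1 + h * (\<Sum>i\<in>UNIV. A$i$i))\<bar> + \<bar>\<Sum>p\<in>?Pm - {id}. ?t p\<bar>"
      unfolding eq trace_def by linarith
    also have "\<dots> \<le> M0 * h\<^sup>2 + (\<Sum>p\<in>?Pm - {id}. c ^ CARD('n) * h\<^sup>2)"
      using M0(2)[of "\<lambda>i. A$i$i" h] A h off
      by (intro add_mono order_trans[OF sum_abs] sum_mono) auto
    also have "\<dots> = ?M * h\<^sup>2" by (simp add: algebra_simps sum_distrib_right)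
    finally show ?thesis .
  qed
  moreover have "?M \<ge> 0" using M0(1) c by (intro add_nonneg_nonneg sum_nonneg) auto
  ultimately show ?thesis by (rule that[rotated])
qed

section \<open>Volume growth along a divergence-free field by Euler's method\<close>

text \<open>The local truncation error. The difference between the solution and its tangent line has
  derivative \<open>F (y t) - F (y a)\<close>, of norm at most L B h because the solution moves with
  speed at most B.\<close>

lemma euler_step_error:
  fixes y :: "real \<Rightarrow> 'a::real_normed_vector"
  assumes h: "0 \<le> h" and "0 \<le> L" "0 \<le> B"
    and y: "\<And>t. t \<in> {a..a+h} \<Longrightarrow> (y has_vector_derivative F (y t)) (at t within {a..a+h})"
    and lip: "\<And>t. t \<in> {a..a+h} \<Longrightarrow> norm (F (y t) - F (y a)) \<le> L * norm (y t - y a)"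
    and B: "\<And>t. t \<in> {a..a+h} \<Longrightarrow> norm (F (y t)) \<le> B"
  shows "norm (y (a + h) - (y a + h *\<^sub>R F (y a))) \<le> L * B * h\<^sup>2"
proof -
  let ?w = "\<lambda>t. y t - (t - a) *\<^sub>R F (y a)"
  have "norm (?w (a + h) - ?w a) \<le> (L * (B * h)) * \<bar>a + h - a\<bar>"
  proof (rule vector_derivative_bound[where S="{a..a+h}"])
    fix t assume t: "t \<in> {a..a+h}"
    show "(?w has_vector_derivative F (y t) - F (y a)) (at t within {a..a+h})"
      by (rule derivative_eq_intros y[OF t] refl | simp)+
    have "norm (y t - y a) \<le> B * \<bar>t - a\<bar>"
      by (rule vector_derivative_bound[OF _ y B]) (use t h in auto)
    also have "\<dots> \<le> B * h" using t \<open>0 \<le> B\<close> by (intro mult_left_mono) auto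
    finally show "norm (F (y t) - F (y a)) \<le> L * (B * h)"
      using lip[OF t] \<open>0 \<le> L\<close> by (meson mult_left_mono order_trans)
  qed (use h in auto)
  then show ?thesis using h by (simp add: algebra_simps power2_eq_square)
qed

lemma derivative_bound_lipschitz:
  fixes F :: "'a::euclidean_space \<Rightarrow> 'b::real_normed_vector"
  assumes "convex C" "\<And>x. x \<in> C \<Longrightarrow> (F has_derivative F' x) (at x)"
    "\<And>x v. x \<in> C \<Longrightarrow> norm (F' x v) \<le> L * norm v" "x \<in> C" "y \<in> C"
  shows "norm (F x - F y) \<le> L * norm (x - y)"
proof (rule differentiable_bound[OF assms(1) _ _ assms(4,5)])
  fix z assume z: "z \<in> C"
  show "(F has_derivative F' z) (at z within C)" by (rule has_derivative_at_withinI[OF assms(2)[OF z]])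
  show "onorm (F' z) \<le> L" by (rule onorm_le) (rule assms(3)[OF z])
qed

text \<open>Since h L < 1 the step map is injective on \<open>K\<close>, and its Jacobian
  determinant is 1 + h div F + O(h^2) with div F = 0, so the change of variables formula applies.
  The constant \<open>M\<close> is passed in as an assumption so that the same one can be used for
  every step.\<close>

lemma euler_map_volume:
  fixes F :: "real^'n::{finite,wellorder} \<Rightarrow> real^'n::_"
  assumes C: "convex C" "open C"
    and F': "\<And>x. x \<in> C \<Longrightarrow> (F has_derivative F' x) (at x)"
    and L: "\<And>x v. x \<in> C \<Longrightarrow> norm (F' x v) \<le> L * norm v" "0 \<le> L"
    and tr: "\<And>x. x \<in> C \<Longrightarrow> trace (matrix (F' x)) = 0"
    and M: "\<And>(A::(real^'n::_)^'n::_) h. (\<And>i j. \<bar>A$i$j\<bar> \<le> L) \<Longrightarrow> \<bar>h\<bar> \<le> 1 \<Longrightarrow>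
     \<bar>det (mat 1 + h *\<^sub>R A) - (1 + h * trace A)\<bar> \<le> M * h\<^sup>2"
    and h: "0 \<le> h" "h \<le> 1" "h * L < 1" and K: "compact K" "K \<subseteq> C"
  shows "(1 - M * h\<^sup>2) * measure lebesgue K \<le> measure lebesgue ((\<lambda>z. z + h *\<^sub>R F z) ` K)"
    "compact ((\<lambda>z. z + h *\<^sub>R F z) ` K)"
proof -
  let ?E = "\<lambda>z. z + h *\<^sub>R F z"
  let ?E' = "\<lambda>x v. v + h *\<^sub>R F' x v"
  have lip: "norm (F x - F y) \<le> L * norm (x - y)" if "x \<in> C" "y \<in> C" for x y
    by (rule derivative_bound_lipschitz[OF C(1) F' L(1) that])
  have dE: "(?E has_derivative ?E' x) (at x within K)" if "x \<in> K" for x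
    by (rule derivative_eq_intros has_derivative_at_withinI[OF F'] refl | use that K in auto)+
  have inj: "inj_on ?E K"
  proof (rule inj_onI)
    fix x y assume xy: "x \<in> K" "y \<in> K" "?E x = ?E y"
    then have "x - y = h *\<^sub>R (F y - F x)" by (simp add: algebra_simps)
    then have "norm (x - y) = h * norm (F x - F y)" using h by (simp add: norm_minus_commute)
    also have "\<dots> \<le> (h * L) * norm (x - y)" 
      using mult_left_mono[OF lip[of x y] h(1)] xy K by (auto simp: mult.assoc)
    finally have "(1 - h * L) * norm (x - y) \<le> 0" by (simp add: algebra_simps)
    then show "x = y" using h(3) by (simp add: mult_le_0_iff)
  qed
  have "continuous_on K ?E" by (rule has_derivative_continuous_on[OF dE])
  then show cE: "compact (?E ` K)" using K by (intro compact_continuous_image)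
  have KS: "K \<in> lmeasurable" "K \<in> sets lebesgue" using K lmeasurable_compact by (auto intro: fmeasurableD)
  have mat: "matrix (?E' x) = mat 1 + h *\<^sub>R matrix (F' x)" for x
    by (simp add: matrix_def mat_def vec_eq_iff axis_def)
  have det: "1 - M * h\<^sup>2 \<le> \<bar>det (matrix (?E' x))\<bar>" if "x \<in> K" for x
  proof -
    have "\<bar>matrix (F' x) $ i $ j\<bar> \<le> L" for i j
    proof -
      have "\<bar>matrix (F' x) $ i $ j\<bar> \<le> norm (F' x (axis j 1))"
        by (simp add: matrix_def component_le_norm_cart)
      also have "\<dots> \<le> L * norm (axis j (1::real)::real^'n::_)" using L(1)[of x "axis j 1"] K(2) that by blast
      finally show ?thesis by simp
    qed
    from M[OF this, of h] show ?thesis using h tr[of x] that K by (auto simp: mat)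
  qed
  have int: "(\<lambda>x. \<bar>det (matrix (?E' x))\<bar>) integrable_on K"
    using measurable_differentiable_image_eq[OF KS(2) dE inj] lmeasurable_compact[OF cE] by auto
  have "(1 - M * h\<^sup>2) * measure lebesgue K = integral K (\<lambda>x. 1 - M * h\<^sup>2)"
    using lmeasure_integral[OF KS(1)] integral_mult_right[of K "1 - M * h\<^sup>2" "\<lambda>x. 1"] by simp
  also have "\<dots> \<le> integral K (\<lambda>x. \<bar>det (matrix (?E' x))\<bar>)"
    using KS(1) by (intro integral_le int det integrable_on_const) 
  also have "\<dots> = measure lebesgue (?E ` K)"
    using measure_differentiable_image_eq[OF KS(2) dE inj int] by simp
  finally show "(1 - M * h\<^sup>2) * measure lebesgue K \<le> measure lebesgue (?E ` K)" .
qed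

text \<open>With n Euler steps of length \<tau>/n the volume shrinks at most by the factor (1 - M
  h^2)^n, which tends to 1, while the endpoints of the polygons converge uniformly to those of the
  solutions. Hence the image under the polygons eventually lies in any open neighbourhood of the
  image under the flow. Outer regularity then gives the bound, in one direction only.\<close>

lemma flow_volume_compact_le:
  fixes F :: "real^'n::{finite,wellorder} \<Rightarrow> real^'n::_"
  assumes C: "convex C" "open C"
    and F': "\<And>x. x \<in> C \<Longrightarrow> (F has_derivative F' x) (at x)"
    and L: "\<And>x v. x \<in> C \<Longrightarrow> norm (F' x v) \<le> L * norm v" "0 \<le> L"
    and tr: "\<And>x. x \<in> C \<Longrightarrow> trace (matrix (F' x)) = 0"
    and B: "\<And>x. x \<in> C \<Longrightarrow> norm (F x) \<le> B" "0 \<le> B"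
    and K: "compact K" and KC: "\<And>z. z \<in> K \<Longrightarrow> cball z (B * \<tau>) \<subseteq> C"
    and \<tau>: "0 \<le> \<tau>" "L * \<tau> \<le> 1/2"
    and y0: "\<And>z. z \<in> K \<Longrightarrow> y z 0 = z"
    and y: "\<And>z t. z \<in> K \<Longrightarrow> t \<in> {0..\<tau>} \<Longrightarrow> (y z has_vector_derivative F (y z t)) (at t within {0..\<tau>})"
    and yC: "\<And>z t. z \<in> K \<Longrightarrow> t \<in> {0..\<tau>} \<Longrightarrow> y z t \<in> C"
  shows "measure lebesgue K \<le> measure lebesgue ((\<lambda>z. y z \<tau>) ` K)"
proof (rule field_le_epsilon)
  fix \<epsilon> :: real assume "\<epsilon> > 0"
  let ?\<phi> = "\<lambda>z. y z \<tau>"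
  have lip: "norm (F x - F y) \<le> L * norm (x - y)" if "x \<in> C" "y \<in> C" for x y
    by (rule derivative_bound_lipschitz[OF C(1) F' L(1) that])
  have K0: "z \<in> C" if "z \<in> K" for z using KC[OF that] B \<tau> by (auto simp: subset_iff)
  have lip\<phi>: "norm (?\<phi> z - ?\<phi> w) \<le> 2 * norm (z - w)" if "z \<in> K" "w \<in> K" for z w
    using ode_dist_le[where z="y z" and w="y w" and F=F and L=L and a=0 and b=\<tau> and t=\<tau> and ?t0.0=0]
      that \<tau> L y y0 lip yC by auto
  have "2-lipschitz_on K ?\<phi>" using lip\<phi> by (auto simp: lipschitz_on_def dist_norm)
  then have c\<phi>: "compact (?\<phi> ` K)"
    by (intro compact_continuous_image lipschitz_on_continuous_on K)
  then have "?\<phi> ` K \<in> sets lebesgue" by (auto intro: fmeasurableD lmeasurable_compact)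
  \<comment> \<open>The Euler images need not lie in the image of \<open>K\<close> itself; the open
    set \<open>O'\<close> leaves room for them at a cost of at most \<epsilon> in volume.\<close>
  then obtain O' where O': "open O'" "?\<phi> ` K \<subseteq> O'" "O' - ?\<phi> ` K \<in> lmeasurable"
     "measure lebesgue (O' - ?\<phi> ` K) < \<epsilon>"
    using sets_lebesgue_outer_open[OF _ \<open>\<epsilon> > 0\<close>] by (metis emeasure_eq_measure2 ennreal_less_iff measure_nonneg)
  have OL: "O' \<in> lmeasurable"
    using fmeasurable.Un[OF O'(3) lmeasurable_compact[OF c\<phi>]] O'(2) by (simp add: Un_absorb2)
  have mO: "measure lebesgue O' \<le> measure lebesgue (?\<phi> ` K) + \<epsilon>"
    using measurable_measure_Diff[OF OL _ O'(2)] O'(4) c\<phi> by (auto simp: fmeasurableD lmeasurable_compact)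
  obtain \<delta> where \<delta>: "\<delta> > 0" "(\<Union>x\<in>?\<phi> ` K. ball x \<delta>) \<subseteq> O'"
    using compact_subset_open_imp_ball_epsilon_subset[OF c\<phi> O'(1,2)] by blast
  obtain M where M: "0 \<le> M" "\<And>(A::(real^'n::_)^'n::_) h. (\<And>i j. \<bar>A$i$j\<bar> \<le> L) \<Longrightarrow> \<bar>h\<bar> \<le> 1 \<Longrightarrow>
     \<bar>det (mat 1 + h *\<^sub>R A) - (1 + h * trace A)\<bar> \<le> M * h\<^sup>2"
    using det_mat_1_plus by blast
  \<comment> \<open>For h = \<tau>/n the second condition gives h \<le> 1, the third M h^2 \<le> 1,
    and the fourth puts the accumulated Euler error below the distance \<delta> that keeps the image
    inside \<open>O'\<close>.\<close>
  have step: "(1 - M * \<tau>\<^sup>2 / n) * measure lebesgue K \<le> measure lebesgue (?\<phi> ` K) + \<epsilon>"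
    if n: "n > 0" "\<tau> \<le> real n" "M * \<tau>\<^sup>2 \<le> (real n)\<^sup>2" "\<tau>\<^sup>2 * L * B * exp (L * \<tau>) < \<delta> * real n" for n :: nat
  proof -
    define h where "h = \<tau> / real n"
    have h: "0 \<le> h" "h \<le> 1" using n \<tau> by (auto simp: h_def field_simps)
    have hn: "real n * h = \<tau>" using n by (simp add: h_def)
    have "h \<le> \<tau>" using n \<tau> mult_left_mono[of 1 "real n" \<tau>] by (simp add: h_def field_simps)
    then have "h * L \<le> L * \<tau>" using mult_right_mono[of h \<tau> L] L(2) by (simp add: mult.commute)
    then have hL: "h * L < 1" using \<tau> by linarith
    have Mh: "M * h\<^sup>2 \<le> 1" using n by (simp add: h_def power_divide field_simps)
    let ?E = "\<lambda>z. z + h *\<^sub>R F z"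
    have jh: "real j * h \<le> \<tau>" if "j \<le> n" for j using mult_right_mono[of "real j" "real n" h] that h hn by auto
    \<comment> \<open>A polygon moves with speed at most B, so after j steps it is within B j h
      \<le> B \<tau> of its start and has not left \<open>C\<close>.\<close>
    have inC: "(?E ^^ j) z \<in> cball z (B * (real j * h)) \<and> (?E ^^ j) z \<in> C" if "z \<in> K" "j \<le> n" for z j
      using that(2)
    proof (induction j)
      case 0
      then show ?case using K0[OF that(1)] by simp
    next
      case (Suc j)
      let ?w = "(?E ^^ j) z"
      have w: "?w \<in> cball z (B * (real j * h))" "?w \<in> C" using Suc by auto
      have "norm (h *\<^sub>R F ?w) \<le> h * B" using B(1)[OF w(2)] h by (simp add: mult_left_mono)
      then have "dist z ((?E ^^ Suc j) z) \<le> B * (real (Suc j) * h)"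
        using w(1) norm_triangle_ineq[of "?w - z" "h *\<^sub>R F ?w"]
        by (simp add: dist_norm norm_minus_commute algebra_simps)
      moreover have "B * (real (Suc j) * h) \<le> B * \<tau>" using jh[OF Suc.prems] B by (intro mult_left_mono)
      ultimately show ?case using KC[OF that(1)] by auto
    qed
    have vol: "compact ((?E ^^ j) ` K) \<and> (1 - M * h\<^sup>2) ^ j * measure lebesgue K \<le> measure lebesgue ((?E ^^ j) ` K)"
      if "j \<le> n" for j using that
    proof (induction j)
      case 0 then show ?case using K by simp
    next
      case (Suc j)
      have im: "(?E ^^ Suc j) ` K = ?E ` ((?E ^^ j) ` K)" by auto
      have sub: "(?E ^^ j) ` K \<subseteq> C" using inC Suc by auto
      have c: "compact ((?E ^^ j) ` K)" using Suc by auto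
      have "(1 - M * h\<^sup>2) ^ Suc j * measure lebesgue K = (1 - M * h\<^sup>2) * ((1 - M * h\<^sup>2) ^ j * measure lebesgue K)" by simp
      also have "\<dots> \<le> (1 - M * h\<^sup>2) * measure lebesgue ((?E ^^ j) ` K)"
        using Suc Mh by (intro mult_left_mono) auto
      also have "\<dots> \<le> measure lebesgue ((?E ^^ Suc j) ` K)"
        unfolding im by (rule euler_map_volume(1)[OF C F' L tr M(2) h hL c sub])
      finally show ?case 
        unfolding im using euler_map_volume(2)[OF C F' L tr M(2) h hL c sub] by auto
    qed
    \<comment> \<open>The discrete Gronwall inequality: each step multiplies the old error by at
      most 1 + h L and adds the truncation error. The geometric sum is replaced by the cruder factor
      j (1 + h L)^j, which still gives O(1/n) after n steps.\<close>
    have err: "norm ((?E ^^ j) z - y z (real j * h)) \<le> (1 + h * L) ^ j * (real j * (L * B * h\<^sup>2))"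
      if "z \<in> K" "j \<le> n" for z j using that(2)
    proof (induction j)
      case 0 then show ?case using y0[OF that(1)] by simp
    next
      case (Suc j)
      let ?w = "(?E ^^ j) z" and ?a = "real j * h"
      let ?e = "L * B * h\<^sup>2"
      have wC: "?w \<in> C" using inC[OF that(1)] Suc by auto
      have sj: "real (Suc j) * h = ?a + h" by (simp add: algebra_simps)
      have sub: "{?a..?a + h} \<subseteq> {0..\<tau>}" using jh[OF Suc.prems] h unfolding sj by auto
      have yC': "y z t \<in> C" if "t \<in> {?a..?a+h}" for t using yC[OF \<open>z \<in> K\<close> subsetD[OF sub that]] .
      have one: "norm (y z (?a + h) - (y z ?a + h *\<^sub>R F (y z ?a))) \<le> ?e"
      proof (rule euler_step_error[OF h(1) L(2) B(2)])
        fix t assume t: "t \<in> {?a..?a + h}"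
        show "(y z has_vector_derivative F (y z t)) (at t within {?a..?a + h})"
          using y[OF that(1), of t] t sub by (meson has_vector_derivative_within_subset subsetD)
      qed (use yC' B lip h in auto)
      have "norm (F ?w - F (y z ?a)) \<le> L * norm (?w - y z ?a)"
        by (intro lip wC yC') (use h in auto)
      then have "norm (h *\<^sub>R (F ?w - F (y z ?a))) \<le> (h * L) * norm (?w - y z ?a)"
        using mult_left_mono[OF _ h(1)] h(1) by (auto simp: mult.assoc)
      moreover have "(?E ^^ Suc j) z - y z (?a + h) = (?w - y z ?a) + h *\<^sub>R (F ?w - F (y z ?a))
           - (y z (?a + h) - (y z ?a + h *\<^sub>R F (y z ?a)))"
        by (simp add: algebra_simps)
      moreover have "norm (p + q - r) \<le> norm p + norm q + norm r" for p q r :: "real^'n::_"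
        using norm_triangle_ineq4[of "p + q" r] norm_triangle_ineq[of p q] by linarith
      ultimately have "norm ((?E ^^ Suc j) z - y z (?a + h)) \<le>
          norm (?w - y z ?a) + (h * L) * norm (?w - y z ?a) + ?e"
        using one by (smt (verit, best))
      then have "norm ((?E ^^ Suc j) z - y z (?a + h)) \<le> (1 + h * L) * norm (?w - y z ?a) + ?e"
        by (simp add: distrib_right)
      also have "\<dots> \<le> (1 + h * L) * ((1 + h * L) ^ j * (real j * ?e)) + ?e"
        using Suc h L by (intro add_right_mono mult_left_mono) auto
      also have "\<dots> \<le> (1 + h * L) * ((1 + h * L) ^ j * (real j * ?e)) + (1 + h * L) ^ Suc j * ?e"
        using mult_right_mono[OF one_le_power[of "1 + h * L" "Suc j"], of ?e] h L B
        by (intro add_left_mono) auto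
      also have "\<dots> = (1 + h * L) ^ Suc j * (real (Suc j) * ?e)" by (simp add: algebra_simps)
      finally show ?case unfolding sj .
    qed
    have sub: "(?E ^^ n) ` K \<subseteq> O'"
    proof (rule image_subsetI)
      fix z assume z: "z \<in> K"
      have "norm ((?E ^^ n) z - y z \<tau>) \<le> (1 + h * L) ^ n * (real n * (L * B * h\<^sup>2))"
        using err[OF z, of n] hn by simp
      also have "(1 + h * L) ^ n \<le> exp (h * L) ^ n" 
        using h L by (intro power_mono exp_ge_add_one_self) (auto simp: add_nonneg_nonneg)
      also have "exp (h * L) ^ n = exp (L * \<tau>)" 
        using hn by (simp flip: exp_of_nat_mult)
      also have "exp (L * \<tau>) * (real n * (L * B * h\<^sup>2)) = \<tau>\<^sup>2 * L * B * exp (L * \<tau>) / real n"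
        using n by (simp add: h_def power2_eq_square field_simps)
      also have "\<dots> < \<delta>" using n by (simp add: field_simps)
      finally have "(?E ^^ n) z \<in> ball (?\<phi> z) \<delta>" using L B h
        by (simp add: dist_norm norm_minus_commute mult_right_mono)
      then show "(?E ^^ n) z \<in> O'" using \<delta>(2) z by blast
    qed
    have "1 - M * \<tau>\<^sup>2 / n = 1 + real n * (- (M * h\<^sup>2))"
      using n by (simp add: h_def power2_eq_square)
    also have "\<dots> \<le> (1 + (- (M * h\<^sup>2))) ^ n" using Mh by (intro Bernoulli_inequality) auto
    finally have "(1 - M * \<tau>\<^sup>2 / n) * measure lebesgue K \<le> (1 - M * h\<^sup>2) ^ n * measure lebesgue K"
      by (intro mult_right_mono) auto
    also have "\<dots> \<le> measure lebesgue ((?E ^^ n) ` K)" using vol[of n] by simp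
    also have "\<dots> \<le> measure lebesgue O'"
      using vol[of n] by (intro measure_mono_fmeasurable sub OL) (auto intro: fmeasurableD lmeasurable_compact)
    finally show ?thesis using mO by linarith
  qed
  have "\<forall>\<^sub>F n in sequentially. (1 - M * \<tau>\<^sup>2 / real n) * measure lebesgue K \<le> measure lebesgue (?\<phi> ` K) + \<epsilon>"
  proof -
    obtain k :: nat where k: "max \<tau> (max (M * \<tau>\<^sup>2) (\<tau>\<^sup>2 * L * B * exp (L * \<tau>) / \<delta>)) < k"
      using reals_Archimedean2 by blast
    show ?thesis
    proof (rule eventually_sequentiallyI[of "max 1 k"])
      fix n assume n: "max 1 k \<le> n"
      then have kn: "real k \<le> real n" "1 \<le> real n" by auto
      have "real n \<le> (real n)\<^sup>2" using kn(2) by (simp add: power2_eq_square)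
      moreover have "\<tau>\<^sup>2 * L * B * exp (L * \<tau>) < \<delta> * real k" using k \<delta>(1) by (simp add: field_simps)
      moreover have "\<delta> * real k \<le> \<delta> * real n" using kn \<delta>(1) by (intro mult_left_mono) auto
      ultimately show "(1 - M * \<tau>\<^sup>2 / real n) * measure lebesgue K \<le> measure lebesgue (?\<phi> ` K) + \<epsilon>"
        using k kn by (intro step) linarith+
    qed
  qed
  moreover have "(\<lambda>n. (1 - M * \<tau>\<^sup>2 / real n) * measure lebesgue K) \<longlonglongrightarrow> (1 - 0) * measure lebesgue K"
    by (intro tendsto_intros lim_const_over_n)
  ultimately have "(1 - 0) * measure lebesgue K \<le> measure lebesgue (?\<phi> ` K) + \<epsilon>"
    by (intro tendsto_upperbound[OF _ _ trivial_limit_sequentially])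
  then show "measure lebesgue K \<le> measure lebesgue (?\<phi> ` K) + \<epsilon>" by simp
qed

text \<open>By inner regularity \<open>S\<close> contains a compact set of almost the same measure,
  to which the compact case applies. Its image is part of the image of \<open>S\<close>.\<close>

lemma flow_volume_le:
  fixes F :: "real^'n::{finite,wellorder} \<Rightarrow> real^'n::_"
  assumes C: "convex C" "open C"
    and F': "\<And>x. x \<in> C \<Longrightarrow> (F has_derivative F' x) (at x)"
    and L: "\<And>x v. x \<in> C \<Longrightarrow> norm (F' x v) \<le> L * norm v" "0 \<le> L"
    and tr: "\<And>x. x \<in> C \<Longrightarrow> trace (matrix (F' x)) = 0"
    and B: "\<And>x. x \<in> C \<Longrightarrow> norm (F x) \<le> B" "0 \<le> B"
    and S: "S \<in> lmeasurable" "bounded S" and SC: "\<And>z. z \<in> S \<Longrightarrow> cball z (B * \<tau>) \<subseteq> C"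
    and \<tau>: "0 \<le> \<tau>" "L * \<tau> \<le> 1/2"
    and y0: "\<And>z. z \<in> S \<Longrightarrow> y z 0 = z"
    and y: "\<And>z t. z \<in> S \<Longrightarrow> t \<in> {0..\<tau>} \<Longrightarrow> (y z has_vector_derivative F (y z t)) (at t within {0..\<tau>})"
    and yC: "\<And>z t. z \<in> S \<Longrightarrow> t \<in> {0..\<tau>} \<Longrightarrow> y z t \<in> C"
    and im: "(\<lambda>z. y z \<tau>) ` S \<in> lmeasurable"
  shows "measure lebesgue S \<le> measure lebesgue ((\<lambda>z. y z \<tau>) ` S)"
proof (rule field_le_epsilon)
  fix \<epsilon> :: real assume "\<epsilon> > 0"
  then obtain T where T: "closed T" "T \<subseteq> S" "S - T \<in> lmeasurable" "measure lebesgue (S - T) < \<epsilon>"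
    using sets_lebesgue_inner_closed[OF fmeasurableD[OF S(1)]]
    by (metis emeasure_eq_measure2 ennreal_less_iff measure_nonneg)
  have cT: "compact T" using T S(2) bounded_subset by (auto simp: compact_eq_bounded_closed)
  have "measure lebesgue T \<le> measure lebesgue ((\<lambda>z. y z \<tau>) ` T)"
    by (rule flow_volume_compact_le[OF C F' L tr B cT SC \<tau> y0 y yC]) (use T in auto)
  also have "\<dots> \<le> measure lebesgue ((\<lambda>z. y z \<tau>) ` S)"
  proof (rule measure_mono_fmeasurable[OF _ _ im])
    have lip: "norm (F x - F y) \<le> L * norm (x - y)" if "x \<in> C" "y \<in> C" for x y
      by (rule derivative_bound_lipschitz[OF C(1) F' L(1) that])
    have "norm (y z \<tau> - y w \<tau>) \<le> 2 * norm (z - w)" if "z \<in> S" "w \<in> S" for z w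
      using ode_dist_le[where z="y z" and w="y w" and F=F and L=L and a=0 and b=\<tau> and t=\<tau> and ?t0.0=0]
        that \<tau> L y y0 lip yC by auto
    then have "2-lipschitz_on T (\<lambda>z. y z \<tau>)" using T by (auto simp: lipschitz_on_def dist_norm)
    then have "compact ((\<lambda>z. y z \<tau>) ` T)"
      by (intro compact_continuous_image lipschitz_on_continuous_on cT)
    then show "(\<lambda>z. y z \<tau>) ` T \<in> sets lebesgue" by (auto intro: fmeasurableD lmeasurable_compact)
  qed (use T in auto)
  finally show "measure lebesgue S \<le> measure lebesgue ((\<lambda>z. y z \<tau>) ` S) + \<epsilon>"
    using measurable_measure_Diff[OF S(1) _ T(2)] T cT by (auto simp: fmeasurableD lmeasurable_compact)
qed

section \<open>Symmetry of second derivatives\<close>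

text \<open>The mean value theorem is applied twice to the second difference: in the direction
  \<open>u\<close> to the increment of \<open>f\<close> along \<open>w\<close>, then in the
  direction \<open>w\<close> to the derivative of \<open>f\<close> along \<open>u\<close>.\<close>

lemma second_difference_mvt:
  fixes f :: "'a::real_normed_vector \<Rightarrow> real"
  assumes f: "\<And>y. y \<in> ball x r \<Longrightarrow> (f has_derivative f' y) (at y)"
    and u: "\<And>y. y \<in> ball x r \<Longrightarrow> ((\<lambda>y. f' y u) has_derivative fu y) (at y)"
    and h: "0 < h" "h * (norm u + norm w) < r"
  obtains y where "y \<in> ball x r" "norm (y - x) \<le> h * (norm u + norm w)"
    "f (x + h *\<^sub>R u + h *\<^sub>R w) - f (x + h *\<^sub>R u) - f (x + h *\<^sub>R w) + f x = h\<^sup>2 * fu y w"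
proof -
  have nb: "norm (x + s *\<^sub>R u + t *\<^sub>R w - x) \<le> h * (norm u + norm w)"
    if "0 \<le> s" "s \<le> h" "0 \<le> t" "t \<le> h" for s t
  proof -
    have "norm (s *\<^sub>R u + t *\<^sub>R w) \<le> s * norm u + t * norm w"
      using that norm_triangle_ineq[of "s *\<^sub>R u" "t *\<^sub>R w"] by simp
    also have "\<dots> \<le> h * norm u + h * norm w" using that by (intro add_mono mult_right_mono) auto
    finally show ?thesis by (simp add: algebra_simps)
  qed
  then have inb: "x + s *\<^sub>R u + t *\<^sub>R w \<in> ball x r" if "0 \<le> s" "s \<le> h" "0 \<le> t" "t \<le> h" for s t
    using h(2) that by (smt (verit) mem_ball dist_norm norm_minus_commute)
  let ?a = "\<lambda>s. f (x + s *\<^sub>R u + h *\<^sub>R w) - f (x + s *\<^sub>R u)"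
  have da: "(?a has_derivative (\<lambda>k. f' (x + s *\<^sub>R u + h *\<^sub>R w) (k *\<^sub>R u) - f' (x + s *\<^sub>R u) (k *\<^sub>R u))) (at s)"
    if "0 \<le> s" "s \<le> h" for s
  proof -
    have "((\<lambda>s. x + s *\<^sub>R u + h *\<^sub>R w) has_derivative (\<lambda>k. k *\<^sub>R u)) (at s)"
      "((\<lambda>s. x + s *\<^sub>R u) has_derivative (\<lambda>k. k *\<^sub>R u)) (at s)"
      by (auto intro!: derivative_eq_intros)
    from has_derivative_compose[OF this(1) f] has_derivative_compose[OF this(2) f]
    show ?thesis using that h inb[of s h] inb[of s 0]
      by (intro has_derivative_diff) auto
  qed
  obtain s where s: "0 < s" "s < h"
    "?a h - ?a 0 = f' (x + s *\<^sub>R u + h *\<^sub>R w) ((h - 0) *\<^sub>R u) - f' (x + s *\<^sub>R u) ((h - 0) *\<^sub>R u)"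
    using mvt_simple[OF h(1), of ?a "\<lambda>s k. f' (x + s *\<^sub>R u + h *\<^sub>R w) (k *\<^sub>R u) - f' (x + s *\<^sub>R u) (k *\<^sub>R u)"]
      has_derivative_at_withinI[OF da] by auto
  let ?b = "\<lambda>t. f' (x + s *\<^sub>R u + t *\<^sub>R w) u"
  have db: "(?b has_derivative (\<lambda>k. fu (x + s *\<^sub>R u + t *\<^sub>R w) (k *\<^sub>R w))) (at t)"
    if "0 \<le> t" "t \<le> h" for t
  proof -
    have "((\<lambda>t. x + s *\<^sub>R u + t *\<^sub>R w) has_derivative (\<lambda>k. k *\<^sub>R w)) (at t)"
      by (auto intro!: derivative_eq_intros)
    from has_derivative_compose[OF this u[OF inb]] s that show ?thesis by auto
  qed
  obtain t where t: "0 < t" "t < h" "?b h - ?b 0 = fu (x + s *\<^sub>R u + t *\<^sub>R w) ((h - 0) *\<^sub>R w)"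
    using mvt_simple[OF h(1), of ?b "\<lambda>t k. fu (x + s *\<^sub>R u + t *\<^sub>R w) (k *\<^sub>R w)"]
      has_derivative_at_withinI[OF db] by auto
  let ?y = "x + s *\<^sub>R u + t *\<^sub>R w"
  have y: "?y \<in> ball x r" using inb s t by auto
  have lin: "linear (f' y)" if "y \<in> ball x r" for y using f[OF that] has_derivative_linear by blast
  have linu: "linear (fu y)" if "y \<in> ball x r" for y using u[OF that] has_derivative_linear by blast
  have "?a h - ?a 0 = h * (?b h - ?b 0)"
    using s lin[OF inb[of s h]] lin[OF inb[of s 0]] h by (simp add: linear_cmul algebra_simps)
  also have "\<dots> = h\<^sup>2 * fu ?y w"
    unfolding t(3) using linu[OF y] by (simp add: linear_cmul power2_eq_square)
  finally show ?thesis using nb[of s t] s t y by (intro that[of ?y]) auto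
qed

text \<open>Schwarz's theorem. The second difference is symmetric in \<open>u\<close> and
  \<open>w\<close>, so both mixed derivatives take a common value at points arbitrarily near
  \<open>x\<close>, and continuity carries this over to \<open>x\<close>.\<close>

lemma second_derivative_symmetric:
  fixes f :: "'a::real_normed_vector \<Rightarrow> real"
  assumes S: "open S" "x \<in> S"
    and f: "\<And>y. y \<in> S \<Longrightarrow> (f has_derivative f' y) (at y)"
    and u: "\<And>y. y \<in> S \<Longrightarrow> ((\<lambda>y. f' y u) has_derivative fu y) (at y)"
    and w: "\<And>y. y \<in> S \<Longrightarrow> ((\<lambda>y. f' y w) has_derivative fw y) (at y)"
    and cu: "continuous_on S (\<lambda>y. fu y w)" and cw: "continuous_on S (\<lambda>y. fw y u)"
  shows "fu x w = fw x u"
proof -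
  obtain r0 where r0: "r0 > 0" "ball x r0 \<subseteq> S" using S open_contains_ball by blast
  have "\<bar>fu x w - fw x u\<bar> \<le> e" if e: "e > 0" for e
  proof -
    obtain d1 where d1: "d1 > 0" "\<And>y. y \<in> S \<Longrightarrow> dist y x < d1 \<Longrightarrow> dist (fu y w) (fu x w) < e/2"
      using cu S e unfolding continuous_on_iff by (metis half_gt_zero)
    obtain d2 where d2: "d2 > 0" "\<And>y. y \<in> S \<Longrightarrow> dist y x < d2 \<Longrightarrow> dist (fw y u) (fw x u) < e/2"
      using cw S e unfolding continuous_on_iff by (metis half_gt_zero)
    define r where "r = Min {r0, d1, d2}"
    have r: "r > 0" "r \<le> r0" "r \<le> d1" "r \<le> d2" using r0 d1 d2 by (auto simp: r_def)
    then have sub: "y \<in> S" if "y \<in> ball x r" for y using r0 that by auto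
    define h where "h = r / (norm u + norm w + 1)"
    have p: "norm u + norm w + 1 > 0" by (smt (verit) norm_ge_zero)
    have h: "0 < h" "h * (norm u + norm w) < r" "h * (norm w + norm u) < r" using r p by (auto simp: h_def field_simps)
    obtain y where y: "y \<in> ball x r"
      "f (x + h *\<^sub>R u + h *\<^sub>R w) - f (x + h *\<^sub>R u) - f (x + h *\<^sub>R w) + f x = h\<^sup>2 * fu y w"
      using second_difference_mvt[of x r f f' u fu h w] f u sub h by metis
    obtain z where z: "z \<in> ball x r"
      "f (x + h *\<^sub>R w + h *\<^sub>R u) - f (x + h *\<^sub>R w) - f (x + h *\<^sub>R u) + f x = h\<^sup>2 * fw z u"
      using second_difference_mvt[of x r f f' w fw h u] f w sub h by metis
    have "h\<^sup>2 * fu y w = h\<^sup>2 * fw z u" using y(2) z(2) by (simp add: algebra_simps)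
    then have "fu y w = fw z u" using h by simp
    moreover have "dist (fu y w) (fu x w) < e/2" "dist (fw z u) (fw x u) < e/2"
      using d1(2)[of y] d2(2)[of z] y(1) z(1) r sub[of y] sub[of z] by (simp_all add: dist_commute)
    ultimately show ?thesis unfolding dist_real_def by linarith
  qed
  then have "\<bar>fu x w - fw x u\<bar> \<le> 0" by (metis dense_ge)
  then show ?thesis by simp
qed

section \<open>Recurrence of volume-preserving flows on manifolds\<close>

text \<open>Continuity of the derivative is known for each fixed direction only. Compactness bounds
  it along the finitely many basis vectors, and the sum of these bounds controls the operator
  norm.\<close>

lemma derivative_locally_bounded:
  fixes F :: "'a::euclidean_space \<Rightarrow> 'a"
  assumes "open S" "z \<in> S"
    and F: "\<And>x. x \<in> S \<Longrightarrow> (F has_derivative F' x) (at x)"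
    and cont: "\<And>v. continuous_on S (\<lambda>x. F' x v)"
  obtains R L B where "0 < R" "cball z R \<subseteq> S" "0 \<le> L" "0 \<le> B"
    "\<And>x v. x \<in> cball z R \<Longrightarrow> norm (F' x v) \<le> L * norm v"
    "\<And>x. x \<in> cball z R \<Longrightarrow> norm (F x) \<le> B"
proof -
  obtain R where R: "R > 0" "cball z R \<subseteq> S" using assms(1,2) open_contains_cball by blast
  have bdd: "\<exists>M. \<forall>x\<in>cball z R. norm (f x) \<le> M" if "continuous_on S f" for f :: "'a \<Rightarrow> 'a"
    using compact_imp_bounded[OF compact_continuous_image[OF continuous_on_subset[OF that R(2)] compact_cball]]
    unfolding bounded_iff by auto
  have "continuous_on S F" using F by (meson continuous_at_imp_continuous_on has_derivative_continuous)
  from bdd[OF this] obtain B where B: "\<And>x. x \<in> cball z R \<Longrightarrow> norm (F x) \<le> B" by blast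
  have "\<forall>b. \<exists>M. \<forall>x\<in>cball z R. norm (F' x b) \<le> M" using bdd[OF cont] by blast
  then obtain M where M: "\<And>b x. x \<in> cball z R \<Longrightarrow> norm (F' x b) \<le> M b"
    unfolding choice_iff by blast
  show ?thesis
  proof
    fix x v assume x: "x \<in> cball z R"
    have lin: "linear (F' x)" using F R x has_derivative_linear by blast
    have "F' x v = F' x (\<Sum>b\<in>Basis. (v \<bullet> b) *\<^sub>R b)" by (simp only: euclidean_representation)
    also have "\<dots> = (\<Sum>b\<in>Basis. (v \<bullet> b) *\<^sub>R F' x b)"
      using lin by (simp add: linear_sum linear_scale)
    also have "norm \<dots> \<le> (\<Sum>b\<in>Basis. norm v * \<bar>M b\<bar>)"
    proof (rule sum_norm_le)
      fix b :: 'a assume b: "b \<in> Basis"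
      have "\<bar>v \<bullet> b\<bar> \<le> norm v" using b by (rule Basis_le_norm)
      moreover have "norm (F' x b) \<le> \<bar>M b\<bar>" using M[OF x, of b] by linarith
      ultimately show "norm ((v \<bullet> b) *\<^sub>R F' x b) \<le> norm v * \<bar>M b\<bar>"
        by (simp add: mult_mono)
    qed
    finally show "norm (F' x v) \<le> (\<Sum>b\<in>Basis. \<bar>M b\<bar>) * norm v"
      by (simp add: sum_distrib_left mult.commute)
  next
    have "norm (F z) \<le> B" using B R by auto
    then show "0 \<le> B" using norm_ge_zero order_trans by blast
  qed (use R B in \<open>auto intro: sum_nonneg\<close>)
qed

lemma has_vector_derivative_eventually_cong:
  assumes "(f has_vector_derivative d) (at t)" "\<forall>\<^sub>F s in nhds t. f s = g s"
  shows "(g has_vector_derivative d) (at t)"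
proof -
  have "\<forall>\<^sub>F s in at t. f s = g s" using assms(2) by (simp add: eventually_at_filter eventually_mono)
  moreover have "f t = g t" using assms(2) by (rule eventually_nhds_x_imp_x)
  ultimately show ?thesis
    using has_derivative_transform_eventually[of f _ t UNIV g] assms(1)
    unfolding has_vector_derivative_def by blast
qed

text \<open>The maps \<open>\<kappa> i\<close> are the charts of a manifold, the \<open>F i\<close> (with derivatives \<open>F' i\<close>) are the
  coordinate expressions of one divergence-free vector field, and \<open>N\<close> is a first integral; only
  the flow on the compact shell \<open>1 \<le> N \<le> 2\<close> is considered, where it is complete.\<close>

locale volume_flow =
  fixes X :: "'x topology" and I :: "'i set" and dom :: "'i \<Rightarrow> 'x set"
    and \<kappa> :: "'i \<Rightarrow> 'x \<Rightarrow> real^'n::{finite,wellorder}"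
    and F :: "'i \<Rightarrow> real^'n::_ \<Rightarrow> real^'n::_" and F' :: "'i \<Rightarrow> real^'n::_ \<Rightarrow> real^'n::_ \<Rightarrow> real^'n::_"
    and N :: "'x \<Rightarrow> real"
  assumes Haus: "Hausdorff_space X"
    and dom_open: "\<And>i. i \<in> I \<Longrightarrow> openin X (dom i)"
    and dom_cover: "topspace X \<subseteq> (\<Union>i\<in>I. dom i)"
    and \<kappa>_open: "\<And>i. i \<in> I \<Longrightarrow> open (\<kappa> i ` dom i)"
    and \<kappa>_homeo: "\<And>i. i \<in> I \<Longrightarrow> homeomorphic_map (subtopology X (dom i)) (top_of_set (\<kappa> i ` dom i)) (\<kappa> i)"
    and F_deriv: "\<And>i z. i \<in> I \<Longrightarrow> z \<in> \<kappa> i ` dom i \<Longrightarrow> (F i has_derivative F' i z) (at z)"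
    and F'_cont: "\<And>i v. i \<in> I \<Longrightarrow> continuous_on (\<kappa> i ` dom i) (\<lambda>z. F' i z v)"
    and F'_trace: "\<And>i z. i \<in> I \<Longrightarrow> z \<in> \<kappa> i ` dom i \<Longrightarrow> trace (matrix (F' i z)) = 0"
    and trans: "\<And>i j x. i \<in> I \<Longrightarrow> j \<in> I \<Longrightarrow> x \<in> dom i \<Longrightarrow> x \<in> dom j \<Longrightarrow>
      \<exists>D. ((\<kappa> j \<circ> inv_into (dom i) (\<kappa> i)) has_derivative D) (at (\<kappa> i x)) \<and>
          \<bar>det (matrix D)\<bar> = 1 \<and> D (F i (\<kappa> i x)) = F j (\<kappa> j x)"
    and N_deriv: "\<And>i x. i \<in> I \<Longrightarrow> x \<in> dom i \<Longrightarrow>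
      \<exists>D. ((N \<circ> inv_into (dom i) (\<kappa> i)) has_derivative D) (at (\<kappa> i x)) \<and> D (F i (\<kappa> i x)) = 0"
    and Y_compact: "compactin X {x \<in> topspace X. 1 \<le> N x \<and> N x \<le> 2}"
begin

definition Y :: "'x set" where "Y = {x \<in> topspace X. 1 \<le> N x \<and> N x \<le> 2}"

text \<open>One chart around \<open>u t\<close> is enough for the definition;
  \<open>integral_curve_chart\<close> extends it to all charts. Staying in the chart near
  \<open>t\<close> is part of it and takes the place of a continuity requirement on
  \<open>u\<close>.\<close>

definition integral_curve :: "(real \<Rightarrow> 'x) \<Rightarrow> real \<Rightarrow> bool" where
  "integral_curve u t \<longleftrightarrow> (\<exists>i\<in>I. (\<forall>\<^sub>F s in nhds t. u s \<in> dom i) \<and>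
     ((\<lambda>s. \<kappa> i (u s)) has_vector_derivative F i (\<kappa> i (u t))) (at t))"

section \<open>Integral curves and charts\<close>

lemma dom_sub: "i \<in> I \<Longrightarrow> dom i \<subseteq> topspace X"
  using dom_open openin_subset by blast

lemma \<kappa>_inj: "i \<in> I \<Longrightarrow> inj_on (\<kappa> i) (dom i)"
  using \<kappa>_homeo[of i] dom_sub[of i] by (simp add: homeomorphic_map_def Int_absorb1)

lemma inv_\<kappa> [simp]: "i \<in> I \<Longrightarrow> x \<in> dom i \<Longrightarrow> inv_into (dom i) (\<kappa> i) (\<kappa> i x) = x"
  by (simp add: \<kappa>_inj inv_into_f_f)

lemma \<kappa>_image_open:
  assumes i: "i \<in> I" and U: "openin X U" shows "open (\<kappa> i ` (U \<inter> dom i))"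
proof -
  have "openin (subtopology X (dom i)) (U \<inter> dom i)"
    using U by (auto simp: openin_subtopology)
  then have "openin (top_of_set (\<kappa> i ` dom i)) (\<kappa> i ` (U \<inter> dom i))"
    using homeomorphic_imp_open_map[OF \<kappa>_homeo[OF i]] by (simp add: open_map_def)
  then show ?thesis using \<kappa>_open[OF i] openin_open_eq by blast
qed

lemma \<kappa>_vimage_open:
  assumes i: "i \<in> I" and O': "open O'" shows "openin X {x \<in> dom i. \<kappa> i x \<in> O'}"
proof -
  have "continuous_map (subtopology X (dom i)) euclidean (\<kappa> i)"
    using homeomorphic_imp_continuous_map[OF \<kappa>_homeo[OF i]] continuous_map_in_subtopology by blast
  from openin_continuous_map_preimage[OF this, of O']
  have "openin (subtopology X (dom i)) {x \<in> topspace (subtopology X (dom i)). \<kappa> i x \<in> O'}"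
    using O' by (simp only: open_openin)
  moreover have "topspace (subtopology X (dom i)) = dom i" using dom_sub[OF i] by (simp add: Int_absorb1)
  ultimately have "openin (subtopology X (dom i)) {x \<in> dom i. \<kappa> i x \<in> O'}" by (simp only:)
  then show ?thesis using dom_open[OF i] openin_open_subtopology by blast
qed

text \<open>Continuity of \<open>u\<close> at \<open>t\<close> in the topology of \<open>X\<close>,
  recovered from its coordinate expression because the charts are open maps.\<close>

lemma eventually_in_image:
  assumes i: "i \<in> I" and ev: "\<forall>\<^sub>F s in nhds t. u s \<in> dom i"
    and cont: "isCont (\<lambda>s. \<kappa> i (u s)) t" and U: "openin X U" "u t \<in> U"
  shows "\<forall>\<^sub>F s in nhds t. u s \<in> U"
proof -
  have "u t \<in> dom i" using ev eventually_nhds_x_imp_x by blast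
  then have "\<forall>\<^sub>F s in nhds t. \<kappa> i (u s) \<in> \<kappa> i ` (U \<inter> dom i)"
    using cont U(2) \<kappa>_image_open[OF i U(1)]
    unfolding isCont_def eventually_nhds_conv_at by (auto elim!: topological_tendstoD)
  with ev show ?thesis
    by eventually_elim (use \<kappa>_inj[OF i] in \<open>auto simp: inj_on_def\<close>)
qed

lemma integral_curve_eventually:
  assumes "integral_curve u t" "openin X U" "u t \<in> U"
  shows "\<forall>\<^sub>F s in nhds t. u s \<in> U"
  using assms unfolding integral_curve_def 
  by (metis eventually_in_image has_vector_derivative_continuous)

text \<open>The chain rule along the coordinate change, whose derivative carries \<open>F i\<close>
  to \<open>F j\<close> by \<open>trans\<close>.\<close>

lemma integral_curve_chart:
  assumes integral_curve: "integral_curve u t" and j: "j \<in> I" "u t \<in> dom j"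
  shows "\<forall>\<^sub>F s in nhds t. u s \<in> dom j"
    and "((\<lambda>s. \<kappa> j (u s)) has_vector_derivative F j (\<kappa> j (u t))) (at t)"
proof -
  show ev: "\<forall>\<^sub>F s in nhds t. u s \<in> dom j" using integral_curve_eventually[OF integral_curve dom_open] j by auto
  obtain i where i: "i \<in> I" and evi: "\<forall>\<^sub>F s in nhds t. u s \<in> dom i"
    and d: "((\<lambda>s. \<kappa> i (u s)) has_vector_derivative F i (\<kappa> i (u t))) (at t)"
    using integral_curve unfolding integral_curve_def by auto
  have ui: "u t \<in> dom i" using evi eventually_nhds_x_imp_x by blast
  obtain D where D: "((\<kappa> j \<circ> inv_into (dom i) (\<kappa> i)) has_derivative D) (at (\<kappa> i (u t)))"
    "D (F i (\<kappa> i (u t))) = F j (\<kappa> j (u t))" using trans[OF i j(1) ui j(2)] by auto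
  have "(((\<kappa> j \<circ> inv_into (dom i) (\<kappa> i)) \<circ> (\<lambda>s. \<kappa> i (u s))) has_vector_derivative F j (\<kappa> j (u t))) (at t)"
    using vector_derivative_diff_chain_within[of "\<lambda>s. \<kappa> i (u s)" _ t UNIV, OF d has_derivative_at_withinI[OF D(1)]] D(2) by simp
  moreover have "\<forall>\<^sub>F s in nhds t. ((\<kappa> j \<circ> inv_into (dom i) (\<kappa> i)) \<circ> (\<lambda>s. \<kappa> i (u s))) s = \<kappa> j (u s)"
    using evi by eventually_elim (use i in auto)
  ultimately show "((\<lambda>s. \<kappa> j (u s)) has_vector_derivative F j (\<kappa> j (u t))) (at t)"
    by (rule has_vector_derivative_eventually_cong)
qed

lemma integral_curve_cong:
  assumes "\<forall>\<^sub>F s in nhds t. u s = w s" "integral_curve u t" shows "integral_curve w t"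
proof -
  obtain i where i: "i \<in> I" and evi: "\<forall>\<^sub>F s in nhds t. u s \<in> dom i"
    and d: "((\<lambda>s. \<kappa> i (u s)) has_vector_derivative F i (\<kappa> i (u t))) (at t)"
    using assms unfolding integral_curve_def by auto
  have [simp]: "u t = w t" using assms(1) eventually_nhds_x_imp_x by blast
  have "\<forall>\<^sub>F s in nhds t. w s \<in> dom i" using evi assms(1) by eventually_elim auto
  moreover have "((\<lambda>s. \<kappa> i (w s)) has_vector_derivative F i (\<kappa> i (w t))) (at t)"
  proof -
    have "\<forall>\<^sub>F s in nhds t. \<kappa> i (u s) = \<kappa> i (w s)" using assms(1) by eventually_elim auto
    from has_vector_derivative_eventually_cong[OF d this] show ?thesis by simp
  qed
  ultimately show ?thesis using i unfolding integral_curve_def by blast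
qed

lemma integral_curve_shift:
  assumes "integral_curve u (t + a)" shows "integral_curve (\<lambda>s. u (s + a)) t"
proof -
  obtain i where i: "i \<in> I" and evi: "\<forall>\<^sub>F s in nhds (t + a). u s \<in> dom i"
    and d: "((\<lambda>s. \<kappa> i (u s)) has_vector_derivative F i (\<kappa> i (u (t + a)))) (at (t + a))"
    using assms unfolding integral_curve_def by auto
  have "filterlim (\<lambda>s. s + a) (nhds (t + a)) (nhds t)" by (intro tendsto_intros filterlim_ident)
  then have "\<forall>\<^sub>F s in nhds t. u (s + a) \<in> dom i" using evi
    by (auto simp: filterlim_def le_filter_def eventually_filtermap)
  moreover have "((\<lambda>s. \<kappa> i (u (s + a))) has_vector_derivative F i (\<kappa> i (u (t + a)))) (at t)"
    using vector_diff_chain_at[of "\<lambda>s. s + a" 1 t "\<lambda>s. \<kappa> i (u s)", OF _ d]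
    by (simp add: o_def has_vector_derivative_add_const)
  ultimately show ?thesis using i unfolding integral_curve_def by blast
qed

lemma integral_curve_topspace: "integral_curve u t \<Longrightarrow> u t \<in> topspace X"
  unfolding integral_curve_def using dom_sub eventually_nhds_x_imp_x by blast

lemma integral_curve_N:
  assumes "integral_curve u t" shows "((\<lambda>s. N (u s)) has_real_derivative 0) (at t)"
proof -
  obtain i where i: "i \<in> I" and evi: "\<forall>\<^sub>F s in nhds t. u s \<in> dom i"
    and d: "((\<lambda>s. \<kappa> i (u s)) has_vector_derivative F i (\<kappa> i (u t))) (at t)"
    using assms unfolding integral_curve_def by auto
  have ui: "u t \<in> dom i" using evi eventually_nhds_x_imp_x by blast
  obtain D where D: "((N \<circ> inv_into (dom i) (\<kappa> i)) has_derivative D) (at (\<kappa> i (u t)))"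
    "D (F i (\<kappa> i (u t))) = 0" using N_deriv[OF i ui] by auto
  have "(((N \<circ> inv_into (dom i) (\<kappa> i)) \<circ> (\<lambda>s. \<kappa> i (u s))) has_vector_derivative 0) (at t)"
    using vector_derivative_diff_chain_within[of "\<lambda>s. \<kappa> i (u s)" _ t UNIV, OF d has_derivative_at_withinI[OF D(1)]] D(2) by simp
  moreover have "\<forall>\<^sub>F s in nhds t. ((N \<circ> inv_into (dom i) (\<kappa> i)) \<circ> (\<lambda>s. \<kappa> i (u s))) s = N (u s)"
    using evi by eventually_elim (use i in auto)
  ultimately have "((\<lambda>s. N (u s)) has_vector_derivative 0) (at t)"
    by (rule has_vector_derivative_eventually_cong)
  then show ?thesis by (simp add: has_real_derivative_iff_has_vector_derivative)
qed

lemma integral_curve_N_const: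
  assumes "convex T" "\<And>t. t \<in> T \<Longrightarrow> integral_curve u t" "s \<in> T" "t \<in> T"
  shows "N (u s) = N (u t)"
proof -
  have "\<exists>c. \<forall>x\<in>T. N (u x) = c"
    by (rule has_field_derivative_zero_constant[OF assms(1)])
      (use integral_curve_N assms(2) has_field_derivative_at_within in blast)
  then show ?thesis using assms by auto
qed

section \<open>Local existence and uniqueness of integral curves\<close>

definition field_bounds :: "'i \<Rightarrow> real^'n::_ \<Rightarrow> real \<Rightarrow> real \<Rightarrow> real \<Rightarrow> bool" where
  "field_bounds i z R L B \<longleftrightarrow> i \<in> I \<and> 0 < R \<and> cball z R \<subseteq> \<kappa> i ` dom i \<and> 0 \<le> L \<and> 0 \<le> B \<and>
     (\<forall>x\<in>cball z R. norm (F i x) \<le> B \<and> (\<forall>v. norm (F' i x v) \<le> L * norm v))"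

lemma field_boundsD:
  assumes "field_bounds i z R L B"
  shows "i \<in> I" "0 < R" "cball z R \<subseteq> \<kappa> i ` dom i" "0 \<le> L" "0 \<le> B"
    "\<And>x. x \<in> cball z R \<Longrightarrow> norm (F i x) \<le> B"
    "\<And>x v. x \<in> cball z R \<Longrightarrow> norm (F' i x v) \<le> L * norm v"
  using assms by (auto simp: field_bounds_def)

lemma F_locally_bounded:
  assumes "i \<in> I" "z \<in> \<kappa> i ` dom i"
  shows "\<exists>R L B. field_bounds i z R L B"
proof (rule derivative_locally_bounded[OF \<kappa>_open[OF assms(1)] assms(2) F_deriv[OF assms(1)] F'_cont[OF assms(1)]])
  fix R L B
  assume "0 < R" "cball z R \<subseteq> \<kappa> i ` dom i" "0 \<le> L" "0 \<le> B"
    "\<And>x v. x \<in> cball z R \<Longrightarrow> norm (F' i x v) \<le> L * norm v" "\<And>x. x \<in> cball z R \<Longrightarrow> norm (F i x) \<le> B"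
  then show "\<exists>R L B. field_bounds i z R L B" using assms(1) unfolding field_bounds_def by blast
qed

lemma F_lipschitz:
  assumes b: "field_bounds i z R L B" and xy: "x \<in> cball z R" "y \<in> cball z R"
  shows "norm (F i x - F i y) \<le> L * norm (x - y)"
proof (rule derivative_bound_lipschitz[OF convex_cball _ _ xy])
  fix x assume x: "x \<in> cball z R"
  then show "(F i has_derivative F' i x) (at x)" using field_boundsD(1,3)[OF b] F_deriv by blast
  show "norm (F' i x v) \<le> L * norm v" for v by (rule field_boundsD(7)[OF b x])
qed

text \<open>In a chart ball where the field is Lipschitz, \<open>ode_dist_le\<close> bounds the
  distance of the two curves by twice their distance at \<open>t\<close>, which is 0.\<close>

lemma integral_curve_unique_local:
  assumes u: "integral_curve u t" "\<forall>\<^sub>F s in nhds t. integral_curve u s" and w: "integral_curve w t" "\<forall>\<^sub>F s in nhds t. integral_curve w s" and eq: "u t = w t"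
  shows "\<forall>\<^sub>F s in nhds t. u s = w s"
proof -
  obtain i where i: "i \<in> I" "u t \<in> dom i" using integral_curve_topspace[OF u(1)] dom_cover by auto
  obtain R L B where field_bounds: "field_bounds i (\<kappa> i (u t)) R L B"
    using F_locally_bounded[OF i(1) imageI[OF i(2)]] by blast
  note R = field_boundsD(2-4)[OF field_bounds]
  let ?V = "{x \<in> dom i. \<kappa> i x \<in> ball (\<kappa> i (u t)) R}"
  have V: "openin X ?V" "u t \<in> ?V" "w t \<in> ?V" using \<kappa>_vimage_open[OF i(1) open_ball] i R eq by auto
  have "\<forall>\<^sub>F s in nhds t. integral_curve u s \<and> integral_curve w s \<and> u s \<in> ?V \<and> w s \<in> ?V"
    using u(2) w(2) integral_curve_eventually[OF u(1) V(1,2)] integral_curve_eventually[OF w(1) V(1,3)]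
    by eventually_elim auto
  then obtain e where e: "e > 0" "\<And>s. dist s t < e \<Longrightarrow> integral_curve u s \<and> integral_curve w s \<and> u s \<in> ?V \<and> w s \<in> ?V"
    unfolding eventually_nhds_metric by auto
  \<comment> \<open>The second term makes L times the interval length 2\<delta> at most 1/2; the
    summand 1 in the denominator covers the case L = 0.\<close>
  define \<delta> where "\<delta> = min (e / 2) (1 / (4 * (L + 1)))"
  have \<delta>: "\<delta> > 0" "\<delta> < e" using e(1) R(3) by (auto simp: \<delta>_def)
  have "L * \<delta> \<le> L * (1 / (4 * (L + 1)))" using R(3) by (intro mult_left_mono) (auto simp: \<delta>_def)
  also have "\<dots> \<le> 1/4" using R(3) by (simp add: field_simps)
  finally have L\<delta>: "L * ((t + \<delta>) - (t - \<delta>)) \<le> 1/2" by simp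
  have "u s = w s" if s: "s \<in> {t-\<delta>..t+\<delta>}" for s
  proof -
    have st: "dist r t < e" if "r \<in> {t-\<delta>..t+\<delta>}" for r using that \<delta> by (auto simp: dist_real_def)
    have "norm (\<kappa> i (u s) - \<kappa> i (w s)) \<le> 2 * norm (\<kappa> i (u t) - \<kappa> i (w t))"
    proof (rule ode_dist_le[OF _ s L\<delta> R(3), where F="F i"])
      fix r assume r: "r \<in> {t-\<delta>..t+\<delta>}"
      have *: "integral_curve u r" "integral_curve w r" "u r \<in> ?V" "w r \<in> ?V" using e(2)[OF st[OF r]] by auto
      show "((\<lambda>s. \<kappa> i (u s)) has_vector_derivative F i (\<kappa> i (u r))) (at r within {t-\<delta>..t+\<delta>})"
        "((\<lambda>s. \<kappa> i (w s)) has_vector_derivative F i (\<kappa> i (w r))) (at r within {t-\<delta>..t+\<delta>})"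
        using integral_curve_chart(2)[OF *(1) i(1)] integral_curve_chart(2)[OF *(2) i(1)] *(3,4) has_vector_derivative_at_within by blast+
      show "norm (F i (\<kappa> i (u r)) - F i (\<kappa> i (w r))) \<le> L * norm (\<kappa> i (u r) - \<kappa> i (w r))"
        by (rule F_lipschitz[OF field_bounds]) (use *(3,4) in auto)
    qed (use \<delta> in auto)
    then show "u s = w s" using eq e(2)[OF st[OF s]] \<kappa>_inj[OF i(1)] by (auto simp: inj_on_def)
  qed
  moreover have "s \<in> {t-\<delta>..t+\<delta>}" if "dist s t < \<delta>" for s using that by (simp add: dist_real_def) linarith
  ultimately show ?thesis unfolding eventually_nhds_metric using \<delta>(1) by blast
qed

text \<open>The set of agreement is open by local uniqueness, its complement in \<open>T\<close> is
  open because \<open>X\<close> is Hausdorff, and \<open>T\<close> is connected.\<close>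

lemma integral_curve_unique:
  assumes T: "open T" "connected T" "t0 \<in> T" and u: "\<And>t. t \<in> T \<Longrightarrow> integral_curve u t" and w: "\<And>t. t \<in> T \<Longrightarrow> integral_curve w t"
    and eq: "u t0 = w t0" and t: "t \<in> T"
  shows "u t = w t"
proof -
  let ?E = "{t \<in> T. u t = w t}"
  have evT: "\<forall>\<^sub>F s in nhds t. s \<in> T" if "t \<in> T" for t using T(1) that eventually_nhds_in_open by blast
  have "open ?E"
  proof (subst open_subopen, intro ballI)
    fix t assume t: "t \<in> ?E"
    then have "\<forall>\<^sub>F s in nhds t. u s = w s"
      using evT[of t] u w by (intro integral_curve_unique_local) (auto elim: eventually_mono)
    with evT[of t] t have "\<forall>\<^sub>F s in nhds t. s \<in> ?E" by (auto elim: eventually_elim2)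
    then show "\<exists>S. open S \<and> t \<in> S \<and> S \<subseteq> ?E" unfolding eventually_nhds by auto
  qed
  moreover have "open (T - ?E)"
  proof (subst open_subopen, intro ballI)
    fix t assume t: "t \<in> T - ?E"
    then obtain U V where UV: "openin X U" "openin X V" "u t \<in> U" "w t \<in> V" "disjnt U V"
      using Haus integral_curve_topspace[OF u] integral_curve_topspace[OF w] unfolding Hausdorff_space_def by (metis (mono_tags, lifting) DiffE mem_Collect_eq)
    have tT: "t \<in> T" using t by auto
    have "\<forall>\<^sub>F s in nhds t. s \<in> T - ?E"
      using evT[OF tT] integral_curve_eventually[OF u[OF tT] UV(1,3)] integral_curve_eventually[OF w[OF tT] UV(2,4)]
      by eventually_elim (use UV(5) in \<open>auto simp: disjnt_iff\<close>)
    then show "\<exists>S. open S \<and> t \<in> S \<and> S \<subseteq> T - ?E" unfolding eventually_nhds by auto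
  qed
  ultimately have "?E \<inter> T = {} \<or> (T - ?E) \<inter> T = {}"
    using connectedD[OF T(2), of ?E "T - ?E"] by auto
  then show ?thesis using T(3) eq t by auto
qed

text \<open>The condition \<open>B * \<tau> < R / 2\<close> guarantees that a solution starting in
  the half ball is still in the full ball up to time \<tau>; the one on \<open>L\<close> makes
  Picard iteration and \<open>ode_dist_le\<close> applicable.\<close>

definition flow_box :: "'i \<Rightarrow> real^'n::_ \<Rightarrow> real \<Rightarrow> real \<Rightarrow> real \<Rightarrow> real \<Rightarrow> bool" where
  "flow_box i p R L B \<tau> \<longleftrightarrow> field_bounds i p R L B \<and> 0 < \<tau> \<and> B * \<tau> < R / 2 \<and> L * \<tau> \<le> 1/4"

definition chart_ball :: "'i \<Rightarrow> real^'n::_ \<Rightarrow> real \<Rightarrow> 'x set" where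
  "chart_ball i p R = {x \<in> dom i. \<kappa> i x \<in> ball p R}"

lemma flow_box_exists:
  assumes "y \<in> topspace X"
  shows "\<exists>i R L B \<tau>. flow_box i (\<kappa> i y) R L B \<tau> \<and> y \<in> chart_ball i (\<kappa> i y) (R/2)"
proof -
  obtain i where i: "i \<in> I" "y \<in> dom i" using dom_cover assms by auto
  obtain R L B where b: "field_bounds i (\<kappa> i y) R L B" using F_locally_bounded[OF i(1) imageI[OF i(2)]] by blast
  note b' = field_boundsD(2,4,5)[OF b]
  define \<tau> where "\<tau> = min (R / (4 * (B + 1))) (1 / (4 * (L + 1)))"
  have "\<tau> > 0" using b' by (simp add: \<tau>_def)
  moreover have "B * \<tau> \<le> B * (R / (4 * (B + 1)))" using b' by (intro mult_left_mono) (auto simp: \<tau>_def)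
  moreover have "B * (R / (4 * (B + 1))) \<le> R / 4" using b' by (simp add: field_simps)
  moreover have "L * \<tau> \<le> L * (1 / (4 * (L + 1)))" using b' by (intro mult_left_mono) (auto simp: \<tau>_def)
  moreover have "L * (1 / (4 * (L + 1))) \<le> 1/4" using b' by (simp add: field_simps)
  ultimately have "flow_box i (\<kappa> i y) R L B \<tau>" using b b' unfolding flow_box_def by linarith
  then show ?thesis using i b' by (intro exI[of _ i] exI[of _ R] exI[of _ L] exI[of _ B] exI[of _ \<tau>])
    (auto simp: chart_ball_def)
qed

lemma chart_ball_open: "i \<in> I \<Longrightarrow> openin X (chart_ball i p R)"
  unfolding chart_ball_def by (intro \<kappa>_vimage_open open_ball)

lemma flow_box_integral_curve_exists:
  assumes fb: "flow_box i p R L B \<tau>" and x: "x \<in> chart_ball i p (R/2)"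
  shows "\<exists>u. u 0 = x \<and> (\<forall>t\<in>{-\<tau><..<\<tau>}. integral_curve u t \<and> u t \<in> chart_ball i p R)"
proof -
  have b: "field_bounds i p R L B" and \<tau>: "0 < \<tau>" "B * \<tau> < R/2" "L * \<tau> \<le> 1/4" using fb by (auto simp: flow_box_def)
  note b' = field_boundsD[OF b]
  have px: "dist p (\<kappa> i x) < R/2" and xi: "x \<in> dom i" using x by (auto simp: chart_ball_def)
  have sub: "cball (\<kappa> i x) (B * \<tau>) \<subseteq> ball p R"
  proof
    fix w assume "w \<in> cball (\<kappa> i x) (B * \<tau>)"
    then show "w \<in> ball p R" using dist_triangle[of p w "\<kappa> i x"] px \<tau>(2) by auto
  qed
  have sub': "cball (\<kappa> i x) (B * \<tau>) \<subseteq> cball p R" using sub by auto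
  have inb: "\<kappa> i x \<in> cball p R" using px b'(2) by auto
  have lt: "L * \<tau> \<le> 1/2" using \<tau> by linarith
  obtain y where y: "y 0 = \<kappa> i x" "\<And>t. t \<in> {-\<tau>..\<tau>} \<Longrightarrow> y t \<in> cball (\<kappa> i x) (B * \<tau>)"
    "\<And>t. t \<in> {-\<tau>..\<tau>} \<Longrightarrow> (y has_vector_derivative F i (y t)) (at t within {-\<tau>..\<tau>})"
    using picard_local[OF compact_cball convex_cball F_lipschitz[OF b] b'(6) b'(4) \<tau>(1) lt sub' inb] by blast
  define u where "u t = inv_into (dom i) (\<kappa> i) (y t)" for t
  have yb: "y t \<in> ball p R" "y t \<in> \<kappa> i ` dom i" if "t \<in> {-\<tau><..<\<tau>}" for t
    using y(2)[of t] that sub b'(3) ball_subset_cball by (auto simp: subset_iff less_imp_le)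
  have ku: "\<kappa> i (u t) = y t" "u t \<in> dom i" if "t \<in> {-\<tau><..<\<tau>}" for t
    using yb(2)[OF that] by (simp_all add: u_def f_inv_into_f inv_into_into)
  have "u 0 = x" using y(1) xi b'(1) by (simp add: u_def)
  moreover have "integral_curve u t \<and> u t \<in> chart_ball i p R" if t: "t \<in> {-\<tau><..<\<tau>}" for t
  proof
    have ev: "\<forall>\<^sub>F s in nhds t. s \<in> {-\<tau><..<\<tau>}" using t by (intro eventually_nhds_in_open) auto
    have "(y has_vector_derivative F i (y t)) (at t)"
      using y(3)[of t] t at_within_interior[of t "{-\<tau>..\<tau>}"] by (auto simp: less_imp_le)
    moreover have "\<forall>\<^sub>F s in nhds t. y s = \<kappa> i (u s)" using ev by eventually_elim (use ku in auto)
    ultimately have "((\<lambda>s. \<kappa> i (u s)) has_vector_derivative F i (y t)) (at t)"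
      by (rule has_vector_derivative_eventually_cong)
    moreover have "\<forall>\<^sub>F s in nhds t. u s \<in> dom i" using ev by eventually_elim (use ku in auto)
    ultimately show "integral_curve u t" unfolding integral_curve_def using b'(1) ku[OF t] by auto
    show "u t \<in> chart_ball i p R" using ku[OF t] yb[OF t] by (simp add: chart_ball_def)
  qed
  ultimately show ?thesis by blast
qed

lemma integral_curve_unique_ivl:
  assumes "\<And>t. t \<in> {-a<..<a} \<Longrightarrow> integral_curve u t" "\<And>t. t \<in> {-a<..<a} \<Longrightarrow> integral_curve w t" "u 0 = w 0" "t \<in> {-a<..<a}"
  shows "u t = w t"
proof (rule integral_curve_unique[of "{-a<..<a}" 0])
  show "0 \<in> {-a<..<a}" using assms(4) by auto
qed (use assms in auto)

text \<open>An arbitrary integral curve might leave the chart; uniqueness identifies it with the one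
  constructed by Picard iteration, which stays in the ball.\<close>

lemma flow_box_integral_curve:
  assumes fb: "flow_box i p R L B \<tau>" and x: "u 0 \<in> chart_ball i p (R/2)"
    and u: "\<And>t. t \<in> {-\<tau><..<\<tau>} \<Longrightarrow> integral_curve u t" and t: "t \<in> {-\<tau><..<\<tau>}"
  shows "u t \<in> chart_ball i p R"
proof -
  obtain w where w: "w 0 = u 0" "\<forall>t\<in>{-\<tau><..<\<tau>}. integral_curve w t \<and> w t \<in> chart_ball i p R"
    using flow_box_integral_curve_exists[OF fb x] by auto
  have "u t = w t" by (rule integral_curve_unique_ivl[OF u _ _ t]) (use w in auto)
  then show ?thesis using w t by auto
qed

section \<open>Completeness on the compact shell\<close>

definition complete_upto :: "real \<Rightarrow> bool" where
  "complete_upto a \<longleftrightarrow> (\<forall>x\<in>Y. \<exists>u. u 0 = x \<and> (\<forall>t\<in>{-a<..<a}. integral_curve u t))"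

definition flow_boxes :: "nat \<Rightarrow> (nat \<Rightarrow> 'i) \<Rightarrow> (nat \<Rightarrow> real^'n::_) \<Rightarrow> (nat \<Rightarrow> real) \<Rightarrow> (nat \<Rightarrow> real) \<Rightarrow> (nat \<Rightarrow> real) \<Rightarrow> (nat \<Rightarrow> real) \<Rightarrow> bool" where
  "flow_boxes m i p R L B \<tau> \<longleftrightarrow> (\<forall>k<m. flow_box (i k) (p k) (R k) (L k) (B k) (\<tau> k)) \<and> Y \<subseteq> (\<Union>k<m. chart_ball (i k) (p k) (R k / 2))"

lemma flow_boxes_exist: "\<exists>m i p R L B \<tau>. flow_boxes m i p R L B \<tau>"
proof -
  obtain i R L B \<tau> where f: "\<And>y. y \<in> topspace X \<Longrightarrow> flow_box (i y) (\<kappa> (i y) y) (R y) (L y) (B y) (\<tau> y) \<and> y \<in> chart_ball (i y) (\<kappa> (i y) y) (R y / 2)"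
    using flow_box_exists by metis
  let ?W = "\<lambda>y. chart_ball (i y) (\<kappa> (i y) y) (R y / 2)"
  have "compactin X Y" using Y_compact by (simp add: Y_def)
  moreover have "openin X (?W y)" if "y \<in> Y" for y
    using f[of y] that by (auto simp: Y_def flow_box_def field_bounds_def intro!: chart_ball_open)
  moreover have "Y \<subseteq> (\<Union>y\<in>Y. ?W y)" using f by (auto simp: Y_def)
  ultimately obtain \<F> where \<F>: "finite \<F>" "\<F> \<subseteq> ?W ` Y" "Y \<subseteq> \<Union>\<F>"
    unfolding compactin_def by (metis (no_types, lifting) imageE)
  then obtain Q where Q: "finite Q" "Q \<subseteq> Y" "\<F> = ?W ` Q" by (meson finite_subset_image)
  obtain e m where e: "Q = e ` {i::nat. i < m}" using finite_imp_nat_seg_image_inj_on[OF Q(1)] by metis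
  have eY: "e k \<in> topspace X" if "k < m" for k using e that Q(2) by (auto simp: Y_def)
  have "flow_boxes m (i \<circ> e) (\<lambda>k. \<kappa> (i (e k)) (e k)) (R \<circ> e) (L \<circ> e) (B \<circ> e) (\<tau> \<circ> e)"
    using f eY \<F>(3) e Q(3) by (fastforce simp: flow_boxes_def)
  then show ?thesis by blast
qed

lemma complete_upto_small: "\<exists>a>0. complete_upto a"
proof -
  obtain m i p R L B \<tau> where fb: "flow_boxes m i p R L B \<tau>" using flow_boxes_exist by metis
  define a where "a = Min (insert 1 (\<tau> ` {..<m}))"
  have \<tau>: "0 < \<tau> k" if "k < m" for k using fb that by (auto simp: flow_boxes_def flow_box_def)
  have "a > 0" using \<tau> by (auto simp: a_def)
  moreover have "complete_upto a"
    unfolding complete_upto_def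
  proof
    fix x assume "x \<in> Y"
    then obtain k where k: "k < m" "x \<in> chart_ball (i k) (p k) (R k / 2)" using fb by (auto simp: flow_boxes_def)
    then have "flow_box (i k) (p k) (R k) (L k) (B k) (\<tau> k)" using fb by (auto simp: flow_boxes_def)
    from flow_box_integral_curve_exists[OF this k(2)] obtain u where
      "u 0 = x" "\<forall>t\<in>{-\<tau> k<..<\<tau> k}. integral_curve u t" by blast
    moreover have "a \<le> \<tau> k" using k by (auto simp: a_def)
    ultimately show "\<exists>u. u 0 = x \<and> (\<forall>t\<in>{-a<..<a}. integral_curve u t)" by (intro exI[of _ u]) auto
  qed
  ultimately show ?thesis by blast
qed

lemma integral_curve_Y:
  assumes "convex T" "\<And>t. t \<in> T \<Longrightarrow> integral_curve u t" "s \<in> T" "t \<in> T" "u s \<in> Y"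
  shows "u t \<in> Y"
  using integral_curve_N_const[OF assms(1,2,3,4)] integral_curve_topspace[OF assms(2)[OF assms(4)]] assms(5) by (auto simp: Y_def)

text \<open>The points \<open>u (a/2)\<close> and \<open>u (-(a/2))\<close> lie in \<open>Y\<close>
  again, because \<open>N\<close> is constant along \<open>u\<close>. Solutions restarted there live
  for time \<open>a\<close>, which gains a/2 on either side.\<close>

lemma complete_upto_extend:
  assumes "complete_upto a" "0 < a" shows "complete_upto (3 * a / 2)"
  unfolding complete_upto_def
proof
  fix x assume x: "x \<in> Y"
  obtain u where u: "u 0 = x" "\<And>t. t \<in> {-a<..<a} \<Longrightarrow> integral_curve u t"
    using assms(1) x unfolding complete_upto_def by blast
  have uY: "u t \<in> Y" if "t \<in> {-a<..<a}" for t
    by (rule integral_curve_Y[OF _ u(2), of "{-a<..<a}" 0]) (use that u(1) x assms(2) in auto)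
  have half: "a/2 \<in> {-a<..<a}" "-(a/2) \<in> {-a<..<a}" using assms(2) by auto
  obtain v where v: "v 0 = u (a/2)" "\<And>t. t \<in> {-a<..<a} \<Longrightarrow> integral_curve v t"
    using assms(1) uY[OF half(1)] unfolding complete_upto_def by blast
  obtain w where w: "w 0 = u (-(a/2))" "\<And>t. t \<in> {-a<..<a} \<Longrightarrow> integral_curve w t"
    using assms(1) uY[OF half(2)] unfolding complete_upto_def by blast
  have v': "integral_curve (\<lambda>s. v (s + (-(a/2)))) t" if "t \<in> {-a/2<..<3*a/2}" for t
    by (rule integral_curve_shift[OF v(2)]) (use that in auto)
  have w': "integral_curve (\<lambda>s. w (s + a/2)) t" if "t \<in> {-3*a/2<..<a/2}" for t
    by (rule integral_curve_shift[OF w(2)]) (use that in auto)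
  have eqv: "v (t + (-(a/2))) = u t" if "t \<in> {-a/2<..<a}" for t
    using integral_curve_unique[of "{-a/2<..<a}" "a/2" "\<lambda>s. v (s + (-(a/2)))" u t] v' u(2) v(1) that assms(2) by auto
  have eqw: "w (t + a/2) = u t" if "t \<in> {-a<..<a/2}" for t
    using integral_curve_unique[of "{-a<..<a/2}" "-(a/2)" "\<lambda>s. w (s + a/2)" u t] w' u(2) w(1) that assms(2) by auto
  \<comment> \<open>The switches at -a/4 and a/4 lie where the pieces agree. Thus \<open>r\<close>
    is the shifted \<open>w\<close> on all of t < a/4 and the shifted \<open>v\<close> on all of t >
    -a/4, and these two open sets cover the interval, so no time needs a one-sided argument.\<close>
  define r where "r t = (if t \<le> -(a/4) then w (t + a/2) else if t < a/4 then u t else v (t + (-(a/2))))" for t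
  have r1: "r t = w (t + a/2)" if "t < a/4" for t
  proof (cases "t \<le> -(a/4)")
    case False
    then have "w (t + a/2) = u t" using that assms(2) by (intro eqw) auto
    with False that show ?thesis by (simp add: r_def)
  qed (simp add: r_def)
  have r3: "r t = v (t + (-(a/2)))" if "-(a/4) < t" for t
  proof (cases "t < a/4")
    case True
    then have "v (t + (-(a/2))) = u t" using that assms(2) by (intro eqv) auto
    with True that show ?thesis by (simp add: r_def)
  qed (use that in \<open>simp add: r_def\<close>)
  have r0: "r 0 = u 0" using assms(2) by (simp add: r_def)
  have "integral_curve r t" if t: "t \<in> {-(3*a/2)<..<3*a/2}" for t
  proof -
    consider "t < a/4" | "t > -(a/4)" using assms(2) by linarith
    then show ?thesis
    proof cases
      case 1
      have "\<forall>\<^sub>F s in nhds t. s < a/4" using 1 eventually_nhds_in_open[of "{..<a/4}" t] by auto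
      then have "\<forall>\<^sub>F s in nhds t. w (s + a/2) = r s" by eventually_elim (simp add: r1)
      then show ?thesis by (rule integral_curve_cong) (rule w', use 1 t assms(2) in auto)
    next
      case 2
      have "\<forall>\<^sub>F s in nhds t. -(a/4) < s" using 2 eventually_nhds_in_open[of "{-(a/4)<..}" t] by auto
      then have "\<forall>\<^sub>F s in nhds t. v (s + (-(a/2))) = r s" by eventually_elim (simp add: r3)
      then show ?thesis by (rule integral_curve_cong) (rule v', use 2 t assms(2) in auto)
    qed
  qed
  moreover have "r 0 = x" using r0 u(1) by simp
  ultimately show "\<exists>u. u 0 = x \<and> (\<forall>t\<in>{-(3*a/2)<..<3*a/2}. integral_curve u t)" by blast
qed

lemma complete_upto_all: "complete_upto a"
proof -
  obtain b where b: "b > 0" "complete_upto b" using complete_upto_small by blast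
  have n: "complete_upto ((3/2)^n * b)" for n
  proof (induction n)
    case (Suc n)
    from complete_upto_extend[OF this] b(1) show ?case by (simp add: mult.assoc)
  qed (use b in simp)
  obtain n where "a / b < (3/2)^n" using real_arch_pow[of "3/2" "a/b"] by auto
  then have "a \<le> (3/2)^n * b" using b(1) by (simp add: field_simps)
  then have "{-a<..<a} \<subseteq> {-((3/2)^n * b)<..<(3/2)^n * b}" by auto
  then show ?thesis using n[of n] unfolding complete_upto_def by (meson subsetD)
qed

lemma integral_curve_global_exists:
  assumes "x \<in> Y"
  shows "\<exists>u. u 0 = x \<and> (\<forall>t. integral_curve u t)"
proof -
  have "\<forall>n. \<exists>u. u 0 = x \<and> (\<forall>t\<in>{-real n<..<real n}. integral_curve u t)"
    using complete_upto_all assms unfolding complete_upto_def by blast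
  from choice[OF this] obtain U where "\<forall>n. U n 0 = x \<and> (\<forall>t\<in>{-real n<..<real n}. integral_curve (U n) t)" ..
  note * = spec[OF this]
  have U: "U n 0 = x" "t \<in> {-real n<..<real n} \<Longrightarrow> integral_curve (U n) t" for n t
    using *[of n] by simp_all
  have eq: "U n t = U k t" if "n \<le> k" "t \<in> {-real n<..<real n}" for n k t
    by (rule integral_curve_unique_ivl[OF U(2) _ _ that(2)]) (use U that in auto)
  \<comment> \<open>The index is an integer strictly larger than |t|, so \<open>t\<close> lies in
    the open interval on which that curve is known.\<close>
  define u where "u t = U (Suc (nat \<lceil>\<bar>t\<bar>\<rceil>)) t" for t
  have u: "u t = U n t" if "t \<in> {-real n<..<real n}" for t n
  proof -
    let ?k = "Suc (nat \<lceil>\<bar>t\<bar>\<rceil>)"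
    have "\<bar>t\<bar> < real ?k" using real_nat_ceiling_ge[of "\<bar>t\<bar>"] unfolding of_nat_Suc by linarith
    then have "t \<in> {-real ?k<..<real ?k}" unfolding greaterThanLessThan_iff by linarith
    then have "U ?k t = U n t" using eq[of n ?k t] eq[of ?k n t] that by (metis nat_le_linear)
    then show ?thesis by (simp only: u_def)
  qed
  have "integral_curve u t" for t
  proof -
    obtain n :: nat where n: "\<bar>t\<bar> < real n" using reals_Archimedean2 by blast
    then have t: "t \<in> {-real n<..<real n}" by auto
    have "\<forall>\<^sub>F s in nhds t. s \<in> {-real n<..<real n}" using t by (intro eventually_nhds_in_open) auto
    then have "\<forall>\<^sub>F s in nhds t. U n s = u s" by eventually_elim (use u in auto)
    then show ?thesis by (rule integral_curve_cong) (rule U(2)[OF t])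
  qed
  moreover have "u 0 = x" using U(1) by (simp add: u_def)
  ultimately show ?thesis by blast
qed

section \<open>The flow on the shell and its continuity\<close>

definition flow :: "real \<Rightarrow> 'x \<Rightarrow> 'x" where
  "flow t x = (SOME u. u 0 = x \<and> (\<forall>t. integral_curve u t)) t"

lemma flow: assumes "x \<in> Y" shows "flow 0 x = x" "integral_curve (\<lambda>t. flow t x) t" "flow t x \<in> Y"
proof -
  have *: "flow 0 x = x \<and> (\<forall>t. integral_curve (\<lambda>t. flow t x) t)"
    unfolding flow_def using someI_ex[OF integral_curve_global_exists[OF assms]] by simp
  then show "flow 0 x = x" "integral_curve (\<lambda>t. flow t x) t" by auto
  show "flow t x \<in> Y" by (rule integral_curve_Y[of UNIV "\<lambda>t. flow t x" 0]) (use * assms in auto)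
qed

lemma flow_eqI:
  assumes "x \<in> Y" "u 0 = x" "\<And>t. integral_curve u t" shows "u t = flow t x"
  by (rule integral_curve_unique[of UNIV 0]) (use assms flow in auto)

lemma flow_add: assumes "x \<in> Y" shows "flow (s + t) x = flow s (flow t x)"
proof -
  have "integral_curve (\<lambda>s. flow (s + t) x) r" for r by (rule integral_curve_shift[of "\<lambda>s. flow s x"]) (rule flow[OF assms])
  then show ?thesis using flow_eqI[of "flow t x" "\<lambda>s. flow (s + t) x" s] flow[OF assms] by auto
qed

lemma flow_inj: "inj_on (flow t) Y"
proof (rule inj_on_inverseI)
  fix x assume "x \<in> Y" then show "flow (-t) (flow t x) = x" using flow_add[of x "-t" t] flow(1) by simp
qed

lemma topspace_Y: "topspace (subtopology X Y) = Y"
  by (auto simp: Y_def)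

text \<open>Inside one box and for times shorter than \<tau> the flow is 2-Lipschitz in the chart
  coordinates. The interval from \<open>min 0 t\<close> to \<open>max 0 t\<close> treats both signs
  of \<open>t\<close> at once.\<close>

lemma flow_box:
  assumes fb: "flow_box i p R L B \<tau>" and x: "x \<in> chart_ball i p (R/2)" "x \<in> Y" and y: "y \<in> chart_ball i p (R/2)" "y \<in> Y"
    and t: "\<bar>t\<bar> < \<tau>"
  shows "flow t x \<in> chart_ball i p R" and "norm (\<kappa> i (flow t x) - \<kappa> i (flow t y)) \<le> 2 * norm (\<kappa> i x - \<kappa> i y)"
proof -
  have b: "field_bounds i p R L B" and \<tau>: "0 < \<tau>" "B * \<tau> < R/2" "L * \<tau> \<le> 1/4" using fb by (auto simp: flow_box_def)
  have inW: "flow s z \<in> chart_ball i p R" if "\<bar>s\<bar> < \<tau>" "z \<in> chart_ball i p (R/2)" "z \<in> Y" for s z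
    by (rule flow_box_integral_curve[OF fb]) (use that flow in auto)
  show "flow t x \<in> chart_ball i p R" by (rule inW[OF t x])
  let ?a = "min 0 t" and ?b = "max 0 t"
  have small: "\<bar>s\<bar> < \<tau>" if "s \<in> {?a..?b}" for s using that t by auto
  have d: "((\<lambda>s. \<kappa> i (flow s z)) has_vector_derivative F i (\<kappa> i (flow s z))) (at s within {?a..?b})"
    if "s \<in> {?a..?b}" "z \<in> chart_ball i p (R/2)" "z \<in> Y" for s z
    using integral_curve_chart(2)[OF flow(2)[OF that(3)] field_boundsD(1)[OF b], of s] inW[OF small[OF that(1)] that(2,3)]
    by (auto simp: chart_ball_def intro: has_vector_derivative_at_within)
  have Lt: "L * (?b - ?a) \<le> 1/2"
  proof -
    have "L * (?b - ?a) \<le> L * \<tau>" using field_boundsD(4)[OF b] t by (intro mult_left_mono) auto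
    then show ?thesis using \<tau> by linarith
  qed
  have "norm (\<kappa> i (flow t x) - \<kappa> i (flow t y)) \<le> 2 * norm (\<kappa> i (flow 0 x) - \<kappa> i (flow 0 y))"
  proof (rule ode_dist_le[OF _ _ Lt field_boundsD(4)[OF b] d[OF _ x] d[OF _ y]])
    fix s assume s: "s \<in> {?a..?b}"
    have "\<kappa> i (flow s x) \<in> cball p R" "\<kappa> i (flow s y) \<in> cball p R"
      using inW[OF small[OF s] x] inW[OF small[OF s] y] by (auto simp: chart_ball_def)
    then show "norm (F i (\<kappa> i (flow s x)) - F i (\<kappa> i (flow s y))) \<le> L * norm (\<kappa> i (flow s x) - \<kappa> i (flow s y))"
      by (rule F_lipschitz[OF b])
  qed auto
  then show "norm (\<kappa> i (flow t x) - \<kappa> i (flow t y)) \<le> 2 * norm (\<kappa> i x - \<kappa> i y)"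
    using flow(1) x y by simp
qed

lemma flow_continuous_box:
  assumes fb: "flow_box i p R L B \<tau>" and t: "\<bar>t\<bar> < \<tau>" and O': "openin X O'"
    and x: "x \<in> chart_ball i p (R/2)" "x \<in> Y" "flow t x \<in> O'"
  shows "\<exists>T. openin X T \<and> x \<in> T \<and> (\<forall>y\<in>T \<inter> Y. flow t y \<in> O')"
proof -
  have i: "i \<in> I" using fb by (auto simp: flow_box_def field_bounds_def)
  have "flow t x \<in> dom i" using flow_box(1)[OF fb x(1,2) x(1,2) t] by (auto simp: chart_ball_def)
  then have "\<kappa> i (flow t x) \<in> \<kappa> i ` (O' \<inter> dom i)" using x(3) by auto
  then obtain e where e: "e > 0" "ball (\<kappa> i (flow t x)) e \<subseteq> \<kappa> i ` (O' \<inter> dom i)"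
    using \<kappa>_image_open[OF i O'] open_contains_ball by blast
  \<comment> \<open>The radius e/2 compensates the Lipschitz constant 2 of the flow in the
    box.\<close>
  let ?T = "{y \<in> dom i. \<kappa> i y \<in> ball p (R/2) \<inter> ball (\<kappa> i x) (e/2)}"
  have "openin X ?T" by (intro \<kappa>_vimage_open i open_Int open_ball)
  moreover have "x \<in> ?T" using x e by (auto simp: chart_ball_def)
  moreover have "flow t y \<in> O'" if y: "y \<in> ?T" "y \<in> Y" for y
  proof -
    have yW: "y \<in> chart_ball i p (R/2)" using y by (auto simp: chart_ball_def)
    have "norm (\<kappa> i (flow t x) - \<kappa> i (flow t y)) \<le> 2 * norm (\<kappa> i x - \<kappa> i y)"
      by (rule flow_box(2)[OF fb x(1,2) yW y(2) t])
    also have "\<dots> < e" using y by (auto simp: dist_norm)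
    finally have "\<kappa> i (flow t y) \<in> \<kappa> i ` (O' \<inter> dom i)" using e(2) by (auto simp: dist_norm subset_iff)
    then obtain q where q: "q \<in> O'" "q \<in> dom i" "\<kappa> i (flow t y) = \<kappa> i q" by auto
    have "flow t y \<in> dom i" using flow_box(1)[OF fb yW y(2) x(1,2) t] by (auto simp: chart_ball_def)
    then show ?thesis using q \<kappa>_inj[OF i] by (auto simp: inj_on_def)
  qed
  ultimately show ?thesis by (intro exI[of _ ?T]) blast
qed

lemma flow_continuous_small: "\<exists>a>0. \<forall>t. \<bar>t\<bar> < a \<longrightarrow> continuous_map (subtopology X Y) (subtopology X Y) (flow t)"
proof -
  obtain m i p R L B \<tau> where fb: "flow_boxes m i p R L B \<tau>" using flow_boxes_exist by metis
  define a where "a = Min (insert 1 (\<tau> ` {..<m}))"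
  have \<tau>: "0 < \<tau> k" if "k < m" for k using fb that by (auto simp: flow_boxes_def flow_box_def)
  have "a > 0" using \<tau> by (auto simp: a_def)
  moreover have "continuous_map (subtopology X Y) (subtopology X Y) (flow t)" if t: "\<bar>t\<bar> < a" for t
  proof (rule continuous_map_into_subtopology)
    show "flow t \<in> topspace (subtopology X Y) \<rightarrow> Y" using flow(3) by (auto simp: topspace_Y)
    show "continuous_map (subtopology X Y) X (flow t)"
      unfolding continuous_map_def topspace_Y
    proof (intro conjI allI impI)
      show "flow t \<in> Y \<rightarrow> topspace X" using flow(3) by (auto simp: Y_def)
      fix O' assume O': "openin X O'"
      show "openin (subtopology X Y) {x \<in> Y. flow t x \<in> O'}"
      proof (subst openin_subopen, intro ballI)
        fix x assume x: "x \<in> {x \<in> Y. flow t x \<in> O'}"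
        then obtain k where k: "k < m" "x \<in> chart_ball (i k) (p k) (R k / 2)" using fb by (auto simp: flow_boxes_def)
        then have f: "flow_box (i k) (p k) (R k) (L k) (B k) (\<tau> k)" using fb by (auto simp: flow_boxes_def)
        have "\<bar>t\<bar> < \<tau> k" using t k by (auto simp: a_def)
        from flow_continuous_box[OF f this O' k(2)] x
        obtain T where T: "openin X T" "x \<in> T" "\<forall>y\<in>T \<inter> Y. flow t y \<in> O'" by blast
        then show "\<exists>T. openin (subtopology X Y) T \<and> x \<in> T \<and> T \<subseteq> {x \<in> Y. flow t x \<in> O'}"
          using x by (intro exI[of _ "T \<inter> Y"]) (auto simp: openin_subtopology)
      qed
    qed
  qed
  ultimately show ?thesis by blast
qed

text \<open>Finitely many boxes give continuity for all |t| < a. Writing the flow at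
  \<open>t\<close> as a composition of two flows at t/2 doubles this bound, and finitely many
  doublings reach any \<open>t\<close>.\<close>

lemma flow_continuous: "continuous_map (subtopology X Y) (subtopology X Y) (flow t)"
proof -
  obtain a where a: "a > 0" "\<And>t. \<bar>t\<bar> < a \<Longrightarrow> continuous_map (subtopology X Y) (subtopology X Y) (flow t)"
    using flow_continuous_small by blast
  have *: "continuous_map (subtopology X Y) (subtopology X Y) (flow t)" if "\<bar>t\<bar> < 2 ^ n * a" for n t
    using that
  proof (induction n arbitrary: t)
    case (Suc n)
    then have "\<bar>t/2\<bar> < 2 ^ n * a" by simp
    then have c: "continuous_map (subtopology X Y) (subtopology X Y) (flow (t/2))" by (rule Suc.IH)
    have "flow t x = (flow (t/2) \<circ> flow (t/2)) x" if "x \<in> topspace (subtopology X Y)" for x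
      using flow_add[of x "t/2" "t/2"] that unfolding topspace_Y by simp
    then show ?case
      using continuous_map_eq[OF continuous_map_compose[OF c c]] by metis
  qed (use a in simp)
  obtain n where "\<bar>t\<bar> / a < 2 ^ n" using real_arch_pow[of 2 "\<bar>t\<bar>/a"] by auto
  then show ?thesis using a(1) by (intro *[of t n]) (simp add: field_simps)
qed

section \<open>Borel sets, charts and the flow\<close>

text \<open>It serves only through its \<sigma>-algebra, generated by the abstract topology
  \<open>X\<close>; volume is measured by the separate function \<open>vol\<close>.\<close>

definition Borel :: "'x measure" where "Borel = sigma (topspace X) {U. openin X U}"

lemma sets_Borel: "sets Borel = sigma_sets (topspace X) {U. openin X U}"
  unfolding Borel_def by (rule sets_measure_of) (auto dest: openin_subset)

lemma space_Borel: "space Borel = topspace X"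
  unfolding Borel_def by (rule space_measure_of) (auto dest: openin_subset)

lemma open_Borel: "openin X U \<Longrightarrow> U \<in> sets Borel"
  unfolding sets_Borel by auto

lemma \<kappa>_image_borel:
  assumes i: "i \<in> I" and E: "E \<in> sets Borel" shows "\<kappa> i ` (E \<inter> dom i) \<in> sets borel"
  using E unfolding sets_Borel
proof induction
  case (Basic U)
  then show ?case using \<kappa>_image_open[OF i] by auto
next
  case (Compl E)
  have "\<kappa> i ` ((topspace X - E) \<inter> dom i) = \<kappa> i ` dom i - \<kappa> i ` (E \<inter> dom i)"
    using \<kappa>_inj[OF i] dom_sub[OF i] by (auto simp: inj_on_def)
  then show ?case using \<kappa>_open[OF i] Compl by auto
next
  case (Union E)
  have "\<kappa> i ` ((\<Union>k. E k) \<inter> dom i) = (\<Union>k::nat. \<kappa> i ` (E k \<inter> dom i))" by auto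
  then show ?case using Union by auto
qed simp

lemma Y_Borel: "Y \<in> sets Borel"
proof -
  have "closedin X Y" using compactin_imp_closedin[OF Haus] Y_compact by (simp add: Y_def)
  then have "openin X (topspace X - Y)" "Y \<subseteq> topspace X" by (auto simp: closedin_def)
  then show ?thesis using open_Borel sets.compl_sets[of "topspace X - Y" Borel] space_Borel
    by (metis double_diff order_refl)
qed

lemma flow_vimage_Borel:
  assumes "E \<in> sets Borel" shows "{x \<in> Y. flow t x \<in> E} \<in> sets Borel"
  using assms unfolding sets_Borel
proof induction
  case (Basic U)
  then have "openin X U" by simp
  from openin_continuous_map_preimage[OF continuous_map_into_fulltopology[OF flow_continuous[of t]] this]
  have "openin (subtopology X Y) {x \<in> Y. flow t x \<in> U}" by (simp only: topspace_Y)
  then obtain O' where "openin X O'" "{x \<in> Y. flow t x \<in> U} = O' \<inter> Y" by (auto simp: openin_subtopology)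
  then show ?case using sets.Int[OF open_Borel Y_Borel] by (simp add: sets_Borel)
next
  case (Compl E)
  have "{x \<in> Y. flow t x \<in> topspace X - E} = Y - {x \<in> Y. flow t x \<in> E}" using flow(3) by (auto simp: Y_def)
  moreover have "{x \<in> Y. flow t x \<in> E} \<in> sets Borel" using Compl by (simp add: sets_Borel)
  ultimately show ?case using sets.Diff[OF Y_Borel] by (simp add: sets_Borel)
next
  case (Union E)
  have "{x \<in> Y. flow t x \<in> (\<Union>k. E k)} = (\<Union>k::nat. {x \<in> Y. flow t x \<in> E k})" by auto
  then show ?case using Union by (simp add: sigma_sets.Union)
qed (simp add: sigma_sets.Empty)

text \<open>The image at time \<open>t\<close> is the preimage at time \<open>-t\<close>, and
  preimages under a continuous map are Borel.\<close>

lemma flow_image_Borel: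
  assumes "E \<in> sets Borel" "E \<subseteq> Y" shows "flow t ` E \<in> sets Borel"
proof -
  have inv: "flow s (flow (-s) x) = x" if "x \<in> Y" for x s using flow_add[OF that, of s "-s"] flow(1)[OF that] by simp
  have "flow t ` E = {x \<in> Y. flow (-t) x \<in> E}"
  proof (intro set_eqI iffI)
    fix x assume "x \<in> flow t ` E"
    then show "x \<in> {x \<in> Y. flow (-t) x \<in> E}" using assms(2) flow(3) inv[of _ "-t"] by auto
  next
    fix x assume "x \<in> {x \<in> Y. flow (-t) x \<in> E}"
    then show "x \<in> flow t ` E" using inv[of x t] by force
  qed
  then show ?thesis using flow_vimage_Borel[OF assms(1)] by simp
qed

text \<open>Change of variables with Jacobian determinant of absolute value 1: Lebesgue measure of a
  set does not depend on the chart in which it is measured.\<close>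

lemma trans_volume:
  assumes ij: "i \<in> I" "j \<in> I" and E: "E \<in> sets Borel" "E \<subseteq> dom i" "E \<subseteq> dom j" and m: "\<kappa> i ` E \<in> lmeasurable"
  shows "measure lebesgue (\<kappa> j ` E) = measure lebesgue (\<kappa> i ` E)"
proof -
  let ?T = "\<kappa> j \<circ> inv_into (dom i) (\<kappa> i)"
  have "\<forall>z\<in>\<kappa> i ` E. \<exists>D. (?T has_derivative D) (at z within \<kappa> i ` E) \<and> \<bar>det (matrix D)\<bar> = 1"
    using trans[OF ij] E(2,3) has_derivative_at_withinI by blast
  then obtain D where D: "\<And>z. z \<in> \<kappa> i ` E \<Longrightarrow> (?T has_derivative D z) (at z within \<kappa> i ` E)"
    "\<And>z. z \<in> \<kappa> i ` E \<Longrightarrow> \<bar>det (matrix (D z))\<bar> = 1" by metis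
  have im: "?T ` (\<kappa> i ` E) = \<kappa> j ` E" using E ij by (force simp: image_image subset_iff)
  have inj: "inj_on ?T (\<kappa> i ` E)"
  proof (rule inj_onI; clarify)
    fix x y assume "x \<in> E" "y \<in> E" "?T (\<kappa> i x) = ?T (\<kappa> i y)"
    then have "\<kappa> j x = \<kappa> j y" using ij E by (auto simp: subset_iff)
    then have "x = y" using \<kappa>_inj[OF ij(2)] \<open>x \<in> E\<close> \<open>y \<in> E\<close> E by (auto simp: inj_on_def)
    then show "\<kappa> i x = \<kappa> i y" by simp
  qed
  have int1: "(\<lambda>z. 1::real) integrable_on \<kappa> i ` E" using m by (rule integrable_on_const)
  then have int: "(\<lambda>z. \<bar>det (matrix (D z))\<bar>) integrable_on \<kappa> i ` E"
    by (rule integrable_eq) (use D(2) in simp)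
  have "measure lebesgue (?T ` (\<kappa> i ` E)) = integral (\<kappa> i ` E) (\<lambda>z. \<bar>det (matrix (D z))\<bar>)"
    by (rule measure_differentiable_image_eq[OF fmeasurableD[OF m] D(1) inj int])
  also have "\<dots> = integral (\<kappa> i ` E) (\<lambda>z. 1)" by (rule integral_cong) (use D(2) in simp)
  also have "\<dots> = measure lebesgue (\<kappa> i ` E)" using lmeasure_integral[OF m] by simp
  finally show ?thesis unfolding im .
qed

end

section \<open>Volume on the shell and its behaviour under the flow\<close>

lemma UN_lessThan_diff_eq:
  fixes V :: "nat \<Rightarrow> 'a set"
  shows "(\<Union>k<m. V k - (\<Union>l<k. V l)) = (\<Union>k<m. V k)"
proof (intro set_eqI iffI)
  fix x assume "x \<in> (\<Union>k<m. V k)"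
  then obtain k where k: "k < m" "x \<in> V k" by auto
  let ?k = "LEAST k. x \<in> V k"
  have "x \<in> V ?k" using k(2) by (rule LeastI)
  moreover have "?k < m" using Least_le[of "\<lambda>k. x \<in> V k" k] k by linarith
  moreover have "x \<notin> V l" if "l < ?k" for l using not_less_Least[OF that] .
  ultimately show "x \<in> (\<Union>k<m. V k - (\<Union>l<k. V l))" by blast
qed auto

lemma disjnt_diff_lessThan:
  fixes V :: "nat \<Rightarrow> 'a set"
  assumes "k \<noteq> l" shows "disjnt (V k - (\<Union>j<k. V j)) (V l - (\<Union>j<l. V j))"
  using assms by (cases k l rule: linorder_cases) (auto simp: disjnt_iff)

context volume_flow begin

context
  fixes m :: nat and i p R L B \<tau>
  assumes fb: "flow_boxes m i p R L B \<tau>"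
begin

text \<open>Two disjoint partitions are needed. \<open>V'\<close> comes from the full balls and
  defines the volume; \<open>W'\<close> comes from the half balls and cuts a set into pieces each of
  which stays in one full ball under the flow for a short time.\<close>

definition V :: "nat \<Rightarrow> 'x set" where "V k = chart_ball (i k) (p k) (R k)"
definition V' :: "nat \<Rightarrow> 'x set" where "V' k = V k - (\<Union>l<k. V l)"
definition W' :: "nat \<Rightarrow> 'x set" where "W' k = chart_ball (i k) (p k) (R k / 2) - (\<Union>l<k. chart_ball (i l) (p l) (R l / 2))"
definition vol :: "'x set \<Rightarrow> real" where
  "vol E = (\<Sum>k<m. measure lebesgue (\<kappa> (i k) ` (E \<inter> V' k)))"

lemma fbk: "k < m \<Longrightarrow> flow_box (i k) (p k) (R k) (L k) (B k) (\<tau> k)"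
  using fb by (auto simp: flow_boxes_def)

lemma ik: "k < m \<Longrightarrow> i k \<in> I"
  using fbk by (auto simp: flow_box_def field_bounds_def)

lemma V_dom: "V k \<subseteq> dom (i k)"
  by (auto simp: V_def chart_ball_def)

lemma V_open: "k < m \<Longrightarrow> openin X (V k)"
  unfolding V_def by (intro chart_ball_open ik)

lemma V'_Borel: "k < m \<Longrightarrow> V' k \<in> sets Borel"
  unfolding V'_def by (intro sets.Diff sets.finite_UN open_Borel V_open) auto

lemma W'_Borel: "k < m \<Longrightarrow> W' k \<in> sets Borel"
  unfolding W'_def by (intro sets.Diff sets.finite_UN open_Borel chart_ball_open ik) auto

lemma Y_cover: "Y \<subseteq> (\<Union>k<m. V k)" "Y \<subseteq> (\<Union>k<m. W' k)"
proof -
  have Y: "Y \<subseteq> (\<Union>k<m. chart_ball (i k) (p k) (R k / 2))" using fb by (auto simp: flow_boxes_def)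
  then show "Y \<subseteq> (\<Union>k<m. W' k)" unfolding W'_def UN_lessThan_diff_eq .
  have "chart_ball (i k) (p k) (R k / 2) \<subseteq> V k" if "k < m" for k
    using fbk[OF that] by (auto simp: V_def chart_ball_def flow_box_def field_bounds_def)
  then show "Y \<subseteq> (\<Union>k<m. V k)" using Y by blast
qed

lemma V_lmeasurable:
  assumes "k < m" "E \<in> sets Borel" "E \<subseteq> V k"
  shows "\<kappa> (i k) ` E \<in> lmeasurable"
proof -
  have "E \<inter> dom (i k) = E" using assms(3) V_dom by blast
  with \<kappa>_image_borel[OF ik[OF assms(1)] assms(2)] have "\<kappa> (i k) ` E \<in> sets borel" by simp
  moreover have "bounded (\<kappa> (i k) ` E)"
    by (rule bounded_subset[of "ball (p k) (R k)"]) (use assms(3) in \<open>auto simp: V_def chart_ball_def\<close>)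
  ultimately show ?thesis by (intro bounded_set_imp_lmeasurable) auto
qed

text \<open>Each piece \<open>E \<inter> V' l\<close> may be measured in the chart of
  \<open>V k\<close> instead of its own by \<open>trans_volume\<close>, after which additivity in
  that single chart reassembles \<open>E\<close>.\<close>

lemma vol_in_chart:
  assumes k: "k < m" and E: "E \<in> sets Borel" "E \<subseteq> V k"
  shows "vol E = measure lebesgue (\<kappa> (i k) ` E)"
proof -
  have Ed: "E \<subseteq> dom (i k)" using E(2) V_dom by blast
  have El: "E \<inter> V' l \<in> sets Borel" if "l < m" for l using E(1) V'_Borel[OF that] by simp
  have lm: "\<kappa> (i k) ` (E \<inter> V' l) \<in> lmeasurable" if "l < m" for l
    using V_lmeasurable[OF k El[OF that]] E(2) by auto
  have "vol E = (\<Sum>l<m. measure lebesgue (\<kappa> (i k) ` (E \<inter> V' l)))"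
    unfolding vol_def
  proof (rule sum.cong)
    fix l assume "l \<in> {..<m}"
    then have l: "l < m" by simp
    show "measure lebesgue (\<kappa> (i l) ` (E \<inter> V' l)) = measure lebesgue (\<kappa> (i k) ` (E \<inter> V' l))"
    proof (rule trans_volume[OF ik[OF k] ik[OF l] El[OF l] _ _ lm[OF l]])
      show "E \<inter> V' l \<subseteq> dom (i k)" using Ed by blast
      show "E \<inter> V' l \<subseteq> dom (i l)" using V_dom by (auto simp: V'_def)
    qed
  qed simp
  also have "\<dots> = measure lebesgue (\<Union>l\<in>{..<m}. \<kappa> (i k) ` (E \<inter> V' l))"
  proof (rule measure_UNION'[symmetric])
    show "pairwise (\<lambda>l l'. disjnt (\<kappa> (i k) ` (E \<inter> V' l)) (\<kappa> (i k) ` (E \<inter> V' l'))) {..<m}"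
    proof (rule pairwiseI)
      fix l l' :: nat assume "l \<noteq> l'"
      then have "disjnt (V' l) (V' l')" unfolding V'_def by (rule disjnt_diff_lessThan)
      then show "disjnt (\<kappa> (i k) ` (E \<inter> V' l)) (\<kappa> (i k) ` (E \<inter> V' l'))"
        using \<kappa>_inj[OF ik[OF k]] Ed unfolding disjnt_iff inj_on_def by blast
    qed
  qed (use lm in auto)
  also have "(\<Union>l\<in>{..<m}. \<kappa> (i k) ` (E \<inter> V' l)) = \<kappa> (i k) ` (E \<inter> (\<Union>l<m. V' l))" by auto
  also have "E \<inter> (\<Union>l<m. V' l) = E" using E(2) k unfolding V'_def UN_lessThan_diff_eq by blast
  finally show ?thesis .
qed

lemma vol_UN:
  assumes fin: "finite J" and A: "\<And>j. j \<in> J \<Longrightarrow> A j \<in> sets Borel" "pairwise (\<lambda>j j'. disjnt (A j) (A j')) J"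
  shows "vol (\<Union>j\<in>J. A j) = (\<Sum>j\<in>J. vol (A j))"
proof -
  have "measure lebesgue (\<kappa> (i k) ` ((\<Union>j\<in>J. A j) \<inter> V' k)) = (\<Sum>j\<in>J. measure lebesgue (\<kappa> (i k) ` (A j \<inter> V' k)))"
    if k: "k < m" for k
  proof -
    have "\<kappa> (i k) ` ((\<Union>j\<in>J. A j) \<inter> V' k) = (\<Union>j\<in>J. \<kappa> (i k) ` (A j \<inter> V' k))" by auto
    moreover have "measure lebesgue (\<Union>j\<in>J. \<kappa> (i k) ` (A j \<inter> V' k)) = (\<Sum>j\<in>J. measure lebesgue (\<kappa> (i k) ` (A j \<inter> V' k)))"
    proof (rule measure_UNION'[OF fin])
      fix j assume "j \<in> J"
      then show "\<kappa> (i k) ` (A j \<inter> V' k) \<in> lmeasurable"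
        using A(1) V'_Borel[OF k] by (intro V_lmeasurable[OF k]) (auto simp: V'_def)
    next
      show "pairwise (\<lambda>j j'. disjnt (\<kappa> (i k) ` (A j \<inter> V' k)) (\<kappa> (i k) ` (A j' \<inter> V' k))) J"
      proof (rule pairwiseI)
        fix j j' assume "j \<in> J" "j' \<in> J" "j \<noteq> j'"
        then have "disjnt (A j) (A j')" using A(2) by (auto simp: pairwise_def)
        moreover have "V' k \<subseteq> dom (i k)" using V_dom by (auto simp: V'_def)
        ultimately show "disjnt (\<kappa> (i k) ` (A j \<inter> V' k)) (\<kappa> (i k) ` (A j' \<inter> V' k))"
          using \<kappa>_inj[OF ik[OF k]] unfolding disjnt_iff inj_on_def by blast
      qed
    qed
    ultimately show ?thesis by simp
  qed
  then have "vol (\<Union>j\<in>J. A j) = (\<Sum>k<m. \<Sum>j\<in>J. measure lebesgue (\<kappa> (i k) ` (A j \<inter> V' k)))"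
    unfolding vol_def by (intro sum.cong) auto
  also have "\<dots> = (\<Sum>j\<in>J. vol (A j))" unfolding vol_def by (rule sum.swap)
  finally show ?thesis .
qed

lemma vol_mono:
  assumes "E \<in> sets Borel" "E' \<in> sets Borel" "E \<subseteq> E'" shows "vol E \<le> vol E'"
  unfolding vol_def
proof (rule sum_mono)
  fix k assume "k \<in> {..<m}"
  then have k: "k < m" by simp
  show "measure lebesgue (\<kappa> (i k) ` (E \<inter> V' k)) \<le> measure lebesgue (\<kappa> (i k) ` (E' \<inter> V' k))"
    using assms V'_Borel[OF k] unfolding V'_def
    by (intro measure_mono_fmeasurable fmeasurableD[OF V_lmeasurable[OF k]] V_lmeasurable[OF k]) auto
qed

text \<open>The pieces cut out by \<open>W'\<close> and their images each lie in one chart ball,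
  where \<open>vol\<close> is Lebesgue measure and the Euler estimate applies. The flow is injective
  on \<open>Y\<close>, so the images of the pieces are disjoint and the volumes add up.\<close>

lemma vol_flow_small:
  assumes E: "E \<in> sets Borel" "E \<subseteq> Y" and t: "0 \<le> t" "\<And>k. k < m \<Longrightarrow> t < \<tau> k"
  shows "vol E \<le> vol (flow t ` E)"
proof -
  have EW: "E \<inter> W' k \<in> sets Borel" "E \<inter> W' k \<subseteq> Y" if "k < m" for k
    using E W'_Borel[OF that] by auto
  have step: "vol (E \<inter> W' k) \<le> vol (flow t ` (E \<inter> W' k))" if k: "k < m" for k
  proof -
    let ?S = "E \<inter> W' k"
    note f = fbk[OF k]
    have b: "field_bounds (i k) (p k) (R k) (L k) (B k)" and \<tau>: "0 < \<tau> k" "B k * \<tau> k < R k / 2" "L k * \<tau> k \<le> 1/4"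
      using f by (auto simp: flow_box_def)
    note b' = field_boundsD[OF b]
    have SW: "?S \<subseteq> chart_ball (i k) (p k) (R k / 2)" by (auto simp: W'_def)
    have SV: "?S \<subseteq> V k" using SW b'(2) by (auto simp: V_def chart_ball_def)
    have Sd: "?S \<subseteq> dom (i k)" using SV V_dom by blast
    have inV: "flow s x \<in> V k" if "x \<in> ?S" "0 \<le> s" "s \<le> t" for s x
      using flow_box(1)[OF f, of x x s] that SW EW(2)[OF k] t(2)[OF k] by (auto simp: V_def)
    have imMX: "flow t ` ?S \<in> sets Borel" by (rule flow_image_Borel[OF EW[OF k]])
    have imV: "flow t ` ?S \<subseteq> V k" using inV t(1) by auto
    \<comment> \<open>The flow read in the coordinates of the box, in the form that
      \<open>flow_volume_le\<close> expects.\<close>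
    define y where "y z s = \<kappa> (i k) (flow s (inv_into (dom (i k)) (\<kappa> (i k)) z))" for z s
    have y: "y (\<kappa> (i k) x) s = \<kappa> (i k) (flow s x)" if "x \<in> ?S" for x s
      using Sd that ik[OF k] by (auto simp: y_def)
    have imy: "(\<lambda>z. y z t) ` (\<kappa> (i k) ` ?S) = \<kappa> (i k) ` (flow t ` ?S)"
      unfolding image_image by (rule image_cong) (use y in auto)
    have Bt: "B k * t \<le> B k * \<tau> k" "L k * t \<le> L k * \<tau> k"
      using t(2)[OF k] b'(4,5) by (auto intro: mult_left_mono)
    have "measure lebesgue (\<kappa> (i k) ` ?S) \<le> measure lebesgue ((\<lambda>z. y z t) ` (\<kappa> (i k) ` ?S))"
    proof (rule flow_volume_le[where C="ball (p k) (R k)" and F="F (i k)" and F'="F' (i k)" and L="L k" and B="B k"])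
      fix x assume x: "x \<in> ball (p k) (R k)"
      then have x': "x \<in> cball (p k) (R k)" by auto
      then have x'': "x \<in> \<kappa> (i k) ` dom (i k)" using b'(3) by blast
      show "(F (i k) has_derivative F' (i k) x) (at x)" by (rule F_deriv[OF b'(1) x''])
      show "trace (matrix (F' (i k) x)) = 0" by (rule F'_trace[OF b'(1) x''])
      show "norm (F (i k) x) \<le> B k" by (rule b'(6)[OF x'])
      show "norm (F' (i k) x v) \<le> L k * norm v" for v by (rule b'(7)[OF x'])
    next
      show "\<kappa> (i k) ` ?S \<in> lmeasurable" by (rule V_lmeasurable[OF k EW(1)[OF k] SV])
      show "bounded (\<kappa> (i k) ` ?S)"
        by (rule bounded_subset[of "ball (p k) (R k)"]) (use SV in \<open>auto simp: V_def chart_ball_def\<close>)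
      show "(\<lambda>z. y z t) ` \<kappa> (i k) ` ?S \<in> lmeasurable" unfolding imy by (rule V_lmeasurable[OF k imMX imV])
    next
      fix z assume "z \<in> \<kappa> (i k) ` ?S"
      then obtain x where x: "x \<in> ?S" "z = \<kappa> (i k) x" by auto
      have "dist (p k) z < R k / 2" using x SW by (auto simp: chart_ball_def)
      then show "cball z (B k * t) \<subseteq> ball (p k) (R k)"
      proof (intro subsetI)
        fix w assume "dist (p k) z < R k / 2" "w \<in> cball z (B k * t)"
        then show "w \<in> ball (p k) (R k)" using dist_triangle[of "p k" w z] Bt(1) \<tau>(2) by simp
      qed
      show "y z 0 = z" using y[OF x(1)] flow(1)[of x] EW(2)[OF k] x by auto
      fix s assume s: "s \<in> {0..t}"
      have iv: "flow s x \<in> V k" using inV[OF x(1)] s by auto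
      then show "y z s \<in> ball (p k) (R k)" unfolding x(2) y[OF x(1)] by (auto simp: V_def chart_ball_def)
      have "x \<in> Y" using x(1) EW(2)[OF k] by auto
      from integral_curve_chart(2)[OF flow(2)[OF this] b'(1), of s] iv V_dom
      have "((\<lambda>s. \<kappa> (i k) (flow s x)) has_vector_derivative F (i k) (\<kappa> (i k) (flow s x))) (at s)" by blast
      then show "(y z has_vector_derivative F (i k) (y z s)) (at s within {0..t})"
        unfolding x(2) y[OF x(1)] using has_vector_derivative_at_within by fastforce
    qed (use t b' \<tau> Bt in auto)
    then show ?thesis unfolding imy using vol_in_chart[OF k EW(1)[OF k] SV] vol_in_chart[OF k imMX imV] by simp
  qed
  have dis: "disjnt (E \<inter> W' k) (E \<inter> W' l)" if "k \<noteq> l" for k l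
    using disjnt_diff_lessThan[OF that, of "\<lambda>l. chart_ball (i l) (p l) (R l / 2)"] by (auto simp: W'_def disjnt_iff)
  have EU: "E = (\<Union>k\<in>{..<m}. E \<inter> W' k)" using Y_cover(2) E(2) by blast
  have "vol E = (\<Sum>k\<in>{..<m}. vol (E \<inter> W' k))"
    by (subst EU, rule vol_UN) (use EW dis in \<open>auto simp: pairwise_def\<close>)
  also have "\<dots> \<le> (\<Sum>k\<in>{..<m}. vol (flow t ` (E \<inter> W' k)))" by (intro sum_mono step) auto
  also have "\<dots> = vol (\<Union>k\<in>{..<m}. flow t ` (E \<inter> W' k))"
  proof (rule vol_UN[symmetric])
    show "pairwise (\<lambda>k l. disjnt (flow t ` (E \<inter> W' k)) (flow t ` (E \<inter> W' l))) {..<m}"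
    proof (rule pairwiseI)
      fix k l assume kl: "k \<in> {..<m}" "l \<in> {..<m}" "k \<noteq> l"
      show "disjnt (flow t ` (E \<inter> W' k)) (flow t ` (E \<inter> W' l))"
        using dis[OF kl(3)] flow_inj[of t] E(2) unfolding disjnt_iff inj_on_def by blast
    qed
  qed (use flow_image_Borel EW in auto)
  also have "(\<Union>k\<in>{..<m}. flow t ` (E \<inter> W' k)) = flow t ` E" by (subst (2) EU) auto
  finally show ?thesis .
qed

text \<open>A time below 2^n a is halved n times, until the estimate within the boxes applies. The
  induction must range over all sets \<open>E\<close>, since the second half of the time starts from
  the image of the first.\<close>

lemma vol_flow:
  assumes E: "E \<in> sets Borel" "E \<subseteq> Y" and t: "0 \<le> t"
  shows "vol E \<le> vol (flow t ` E)"
proof -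
  define a where "a = Min (insert 1 (\<tau> ` {..<m}))"
  have \<tau>: "0 < \<tau> k" if "k < m" for k using fbk[OF that] by (auto simp: flow_box_def)
  have a: "a > 0" "\<And>k. k < m \<Longrightarrow> a \<le> \<tau> k" using \<tau> by (auto simp: a_def)
  have *: "vol E \<le> vol (flow t ` E)" if "0 \<le> t" "t < 2 ^ n * a" "E \<in> sets Borel" "E \<subseteq> Y" for n t E
    using that
  proof (induction n arbitrary: t E)
    case 0
    show ?case by (rule vol_flow_small) (use 0 a in force)+
  next
    case (Suc n)
    have E': "flow (t/2) ` E \<in> sets Borel" "flow (t/2) ` E \<subseteq> Y" using Suc.prems flow_image_Borel flow(3) by blast+
    have "vol E \<le> vol (flow (t/2) ` E)" using Suc.prems by (intro Suc.IH) auto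
    also have "\<dots> \<le> vol (flow (t/2) ` (flow (t/2) ` E))" using Suc.prems E' by (intro Suc.IH) auto
    also have "flow (t/2) ` (flow (t/2) ` E) = flow t ` E"
      unfolding image_image using flow_add[of _ "t/2" "t/2"] Suc.prems(4) by (intro image_cong) auto
    finally show ?case .
  qed
  obtain n where "t / a < 2 ^ n" using real_arch_pow[of 2 "t/a"] by auto
  then show ?thesis using * t E a(1) by (simp add: field_simps)
qed

lemma vol_open_pos:
  assumes U: "openin X U" "U \<subseteq> Y" "U \<noteq> {}" shows "0 < vol U"
proof -
  obtain x where x: "x \<in> U" using U by auto
  then obtain k where k: "k < m" "x \<in> V k" using Y_cover(1) U(2) by blast
  have UV: "openin X (U \<inter> V k)" using U(1) V_open[OF k(1)] by auto
  have UM: "U \<inter> V k \<in> sets Borel" using UV by (rule open_Borel)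
  have ne: "\<kappa> (i k) ` (U \<inter> V k) \<noteq> {}" using x k by auto
  have "U \<inter> V k \<inter> dom (i k) = U \<inter> V k" using V_dom by blast
  with \<kappa>_image_open[OF ik[OF k(1)] UV] have "open (\<kappa> (i k) ` (U \<inter> V k))" by simp
  then have "\<not> negligible (\<kappa> (i k) ` (U \<inter> V k))" using ne by (rule open_not_negligible)
  then have "measure lebesgue (\<kappa> (i k) ` (U \<inter> V k)) \<noteq> 0"
    using V_lmeasurable[OF k(1) UM] by (auto simp: negligible_iff_measure)
  then have "0 < measure lebesgue (\<kappa> (i k) ` (U \<inter> V k))"
    using measure_nonneg[of lebesgue "\<kappa> (i k) ` (U \<inter> V k)"] by linarith
  also have "\<dots> = vol (U \<inter> V k)" using vol_in_chart[OF k(1) UM] by simp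
  also have "\<dots> \<le> vol U" by (rule vol_mono) (use UM U open_Borel in auto)
  finally show ?thesis .
qed

section \<open>Poincare recurrence\<close>

lemma recurrence_aux:
  assumes U: "openin X U" "U \<subseteq> Y" "U \<noteq> {}" and T: "0 < T"
  shows "\<exists>n>0. \<exists>x\<in>U. flow (real n * T) x \<in> U"
proof (rule ccontr)
  assume no: "\<not> ?thesis"
  let ?A = "\<lambda>k. flow (real k * T) ` U"
  have UM: "U \<in> sets Borel" using U(1) by (rule open_Borel)
  have AM: "?A k \<in> sets Borel" for k by (rule flow_image_Borel[OF UM U(2)])
  have AY: "?A k \<subseteq> Y" for k using flow(3) U(2) by auto
  have lt: "disjnt (?A k) (?A l)" if "k < l" for k l :: nat
  proof (rule ccontr)
    assume "\<not> disjnt (?A k) (?A l)"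
    then obtain x y where xy: "x \<in> U" "y \<in> U" "flow (real k * T) x = flow (real l * T) y"
      by (auto simp: disjnt_iff)
    \<comment> \<open>Cancelling the common flow time by injectivity turns a meeting of two images
      into a return of a point of \<open>U\<close> to \<open>U\<close> at a positive multiple of
      \<open>T\<close>.\<close>
    have "real l * T = real k * T + real (l - k) * T" using that by (simp add: of_nat_diff algebra_simps)
    then have "flow (real k * T) x = flow (real k * T) (flow (real (l - k) * T) y)"
      using xy flow_add[of y "real k * T" "real (l - k) * T"] U(2) by auto
    moreover have "flow (real (l - k) * T) y \<in> Y" using flow(3) xy U(2) by blast
    ultimately have "x = flow (real (l - k) * T) y"
      using flow_inj[of "real k * T"] xy U(2) unfolding inj_on_def by blast
    then show False using no xy that by (metis zero_less_diff)
  qed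
  have dis: "pairwise (\<lambda>k l. disjnt (?A k) (?A l)) J" for J
    using lt unfolding pairwise_def by (metis disjnt_sym linorder_neqE_nat)
  have "real n * vol U \<le> vol Y" for n
  proof -
    have "real n * vol U = (\<Sum>k\<in>{..<n}. vol U)" by simp
    also have "\<dots> \<le> (\<Sum>k\<in>{..<n}. vol (?A k))" using T by (intro sum_mono vol_flow UM U(2)) auto
    also have "\<dots> = vol (\<Union>k\<in>{..<n}. ?A k)" by (rule vol_UN[symmetric]) (use AM dis in auto)
    also have "\<dots> \<le> vol Y" by (rule vol_mono) (use AM AY Y_Borel in auto)
    finally show ?thesis .
  qed
  moreover obtain n :: nat where "vol Y / vol U < real n" using reals_Archimedean2 by blast
  ultimately show False using vol_open_pos[OF U] by (simp add: field_simps) (metis not_le)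
qed

end

theorem recurrence:
  assumes "openin X U" "U \<subseteq> Y" "U \<noteq> {}" "0 < T"
  shows "\<exists>t>T. \<exists>x\<in>U. flow t x \<in> U"
proof -
  obtain m i p R L B \<tau> where "flow_boxes m i p R L B \<tau>" using flow_boxes_exist by metis
  \<comment> \<open>With \<open>T + 1\<close> as the unit of time every positive multiple exceeds
    \<open>T\<close> strictly.\<close>
  from recurrence_aux[OF this assms(1-3), of "T + 1"] assms(4)
  obtain n x where n: "n > 0" "x \<in> U" "flow (real n * (T + 1)) x \<in> U" by auto
  have "real n * (T + 1) \<ge> 1 * (T + 1)" using n assms(4) by (intro mult_right_mono) auto
  then show ?thesis using n by (intro exI[of _ "real n * (T + 1)"]) auto
qed

end

section \<open>The magnetic equation in the coordinates \<open>(x, g v)\<close>\<close>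

definition prX :: "real^4 \<Rightarrow> real^2" where "prX z = vector [z$1, z$2]"
definition prP :: "real^4 \<Rightarrow> real^2" where "prP z = vector [z$3, z$4]"
definition pack :: "real^2 \<Rightarrow> real^2 \<Rightarrow> real^4" where
  "pack x p = (\<chi> i. if i = 1 then x$1 else if i = 2 then x$2 else if i = 3 then p$1 else p$2)"

lemma prX_nth [simp]: "prX z $ 1 = z$1" "prX z $ 2 = z$2"
  by (simp_all add: prX_def)

lemma prP_nth [simp]: "prP z $ 1 = z$3" "prP z $ 2 = z$4"
  by (simp_all add: prP_def)

lemma pack_nth [simp]: "pack x p $ 1 = x$1" "pack x p $ 2 = x$2" "pack x p $ 3 = p$1" "pack x p $ 4 = p$2"
  by (simp_all add: pack_def)

lemma prX_pack [simp]: "prX (pack x p) = x" and prP_pack [simp]: "prP (pack x p) = p"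
  by (simp_all add: vec_eq_iff forall_2)

lemma pack_pr [simp]: "pack (prX z) (prP z) = z"
  by (simp add: vec_eq_iff forall_4)

lemma bounded_linear_prX: "bounded_linear prX" and bounded_linear_prP: "bounded_linear prP"
  by (auto intro!: linear_linear[THEN iffD2] linearI simp: vec_eq_iff forall_2 linear_conv_bounded_linear[symmetric])

text \<open>Coordinate changes on momenta have block triangular derivatives: the new position does
  not depend on the momentum, which makes the upper right block vanish.\<close>

lemma det_4_block:
  fixes A :: "real^4^4"
  assumes "A$1$3 = 0" "A$1$4 = 0" "A$2$3 = 0" "A$2$4 = 0"
  shows "det A = (A$1$1 * A$2$2 - A$1$2 * A$2$1) * (A$3$3 * A$4$4 - A$3$4 * A$4$3)"
proof -
  have f1234: "finite {2::4, 3, 4}" "1 \<notin> {2::4, 3, 4}" by auto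
  have f234: "finite {3::4, 4}" "2 \<notin> {3::4, 4}" by auto
  have f34: "finite {4::4}" "3 \<notin> {4::4}" by auto
  show ?thesis
    unfolding det_def UNIV_4
    unfolding sum_over_permutations_insert[OF f1234]
    unfolding sum_over_permutations_insert[OF f234]
    unfolding sum_over_permutations_insert[OF f34]
    unfolding permutes_sing
    using assms
    by (simp add: sign_swap_id sign_id swap_id_eq permutation_swap_id sign_compose field_simps)
qed

section \<open>Calculus of smooth functions\<close>

lemma frechet_derivative_cong_open:
  assumes "open S" "x \<in> S" "\<And>y. y \<in> S \<Longrightarrow> f y = g y"
  shows "frechet_derivative f (at x) = frechet_derivative g (at x)"
proof -
  have "(f has_derivative D) (at x) \<longleftrightarrow> (g has_derivative D) (at x)" for D
    using assms has_derivative_transform_within_open[of f D x UNIV S g]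
      has_derivative_transform_within_open[of g D x UNIV S f] by auto
  then show ?thesis unfolding frechet_derivative_def by simp
qed

lemma smooth_on_differentiable: "smooth_on S f \<Longrightarrow> x \<in> S \<Longrightarrow> f differentiable (at x)"
  unfolding smooth_on_def by (metis foldr.simps(1) id_apply)

lemma smooth_on_has_derivative:
  "smooth_on S f \<Longrightarrow> x \<in> S \<Longrightarrow> (f has_derivative frechet_derivative f (at x)) (at x)"
  using smooth_on_differentiable frechet_derivative_works by blast

lemma smooth_on_frechet: "smooth_on S f \<Longrightarrow> smooth_on S (\<lambda>x. frechet_derivative f (at x) v)"
  unfolding smooth_on_def
proof safe
  fix vs x assume *: "\<forall>vs. \<forall>x\<in>S. foldr (\<lambda>v h y. frechet_derivative h (at y) v) vs f differentiable (at x)" and "x \<in> S"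
  \<comment> \<open>In the fold the last direction of the list is differentiated first, so the extra
    \<open>v\<close> is appended at the end.\<close>
  from *[rule_format, OF this(2), of "vs @ [v]"]
  show "foldr (\<lambda>v h y. frechet_derivative h (at y) v) vs (\<lambda>x. frechet_derivative f (at x) v) differentiable (at x)"
    by simp
qed

lemma smooth_on_continuous: "smooth_on S f \<Longrightarrow> continuous_on S f"
  using smooth_on_differentiable differentiable_imp_continuous_within
  by (metis continuous_at_imp_continuous_on)

lemma frechet_derivative_bounded_linear_compose:
  assumes "bounded_linear L" "f differentiable (at x)"
  shows "frechet_derivative (\<lambda>y. L (f y)) (at x) v = L (frechet_derivative f (at x) v)"
proof -
  have "((\<lambda>y. L (f y)) has_derivative (\<lambda>v. L (frechet_derivative f (at x) v))) (at x)"
    using assms(2) bounded_linear.has_derivative[OF assms(1)] frechet_derivative_works by blast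
  from frechet_derivative_at[OF this] show ?thesis by (metis)
qed

text \<open>Iterated derivatives of the composition are \<open>L\<close> applied to iterated
  derivatives of \<open>f\<close>. The equality holds only on \<open>S\<close>, which must be open
  for it to pass through the next derivative.\<close>

lemma smooth_on_bounded_linear:
  fixes f :: "'a::euclidean_space \<Rightarrow> 'b::real_normed_vector" and L :: "'b \<Rightarrow> 'c::real_normed_vector"
  assumes S: "open S" and L: "bounded_linear L" and f: "smooth_on S f"
  shows "smooth_on S (\<lambda>x. L (f x))"
proof -
  have diff: "foldr (\<lambda>v h y. frechet_derivative h (at y) v) vs f differentiable (at x)" if "x \<in> S" for vs x
    using f that unfolding smooth_on_def by simp
  have eq: "\<forall>x\<in>S. foldr (\<lambda>v h y. frechet_derivative h (at y) v) vs (\<lambda>x. L (f x)) x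
      = L (foldr (\<lambda>v h y. frechet_derivative h (at y) v) vs f x)" for vs
  proof (induction vs)
    case (Cons v vs)
    show ?case
    proof
      fix x assume x: "x \<in> S"
      have "frechet_derivative (foldr (\<lambda>v h y. frechet_derivative h (at y) v) vs (\<lambda>x. L (f x))) (at x)
        = frechet_derivative (\<lambda>y. L (foldr (\<lambda>v h y. frechet_derivative h (at y) v) vs f y)) (at x)"
        by (rule frechet_derivative_cong_open[OF S x]) (use Cons in auto)
      then show "foldr (\<lambda>v h y. frechet_derivative h (at y) v) (v # vs) (\<lambda>x. L (f x)) x
        = L (foldr (\<lambda>v h y. frechet_derivative h (at y) v) (v # vs) f x)"
        using frechet_derivative_bounded_linear_compose[OF L diff[OF x]] by simp
    qed
  qed simp
  show ?thesis unfolding smooth_on_def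
  proof (intro allI ballI)
    fix vs x assume x: "x \<in> S"
    obtain D where "(foldr (\<lambda>v h y. frechet_derivative h (at y) v) vs f has_derivative D) (at x)"
      using diff[OF x, of vs] unfolding differentiable_def by blast
    from bounded_linear.has_derivative[OF L this]
    have "(foldr (\<lambda>v h y. frechet_derivative h (at y) v) vs (\<lambda>x. L (f x)) has_derivative (\<lambda>v. L (D v))) (at x)"
      by (rule has_derivative_transform_within_open[OF _ S x]) (use eq[of vs] in auto)
    then show "foldr (\<lambda>v h y. frechet_derivative h (at y) v) vs (\<lambda>x. L (f x)) differentiable (at x)"
      unfolding differentiable_def by blast
  qed
qed

lemma smooth_on_second_derivative_symmetric:
  fixes f :: "'a::euclidean_space \<Rightarrow> real"
  assumes S: "open S" "x \<in> S" and f: "smooth_on S f"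
  shows "frechet_derivative (\<lambda>y. frechet_derivative f (at y) u) (at x) w
       = frechet_derivative (\<lambda>y. frechet_derivative f (at y) w) (at x) u"
  by (rule second_derivative_symmetric[OF S])
    (use f in \<open>auto intro!: smooth_on_has_derivative smooth_on_frechet smooth_on_continuous\<close>)

lemma has_derivative_cart:
  fixes f :: "'a::real_normed_vector \<Rightarrow> real^'n"
  assumes "\<And>i. ((\<lambda>x. f x $ i) has_derivative (\<lambda>v. f' v $ i)) (at x within S)"
  shows "(f has_derivative f') (at x within S)"
proof (subst has_derivative_componentwise_within, intro ballI)
  fix b :: "real^'n" assume "b \<in> Basis"
  then obtain i where "b = axis i 1" by (auto simp: Basis_vec_def)
  then show "((\<lambda>x. f x \<bullet> b) has_derivative (\<lambda>x. f' x \<bullet> b)) (at x within S)"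
    using assms[of i] by (simp add: inner_axis)
qed

section \<open>Metric coefficients and the explicit vector field\<close>

definition dg :: "(real^2 \<Rightarrow> real) \<Rightarrow> real^2 \<Rightarrow> real^2 \<Rightarrow> real" where
  "dg f x v = frechet_derivative f (at x) v"

text \<open>The coefficients E, F, G of the first fundamental form, the third one called
  \<open>gH\<close> because \<open>G\<close> is the metric matrix, and their determinant
  \<open>gD\<close>.\<close>

definition gE :: "(real^2 \<Rightarrow> real^2^2) \<Rightarrow> real^2 \<Rightarrow> real" where "gE G x = G x $ 1 $ 1"
definition gF :: "(real^2 \<Rightarrow> real^2^2) \<Rightarrow> real^2 \<Rightarrow> real" where "gF G x = G x $ 1 $ 2"
definition gH :: "(real^2 \<Rightarrow> real^2^2) \<Rightarrow> real^2 \<Rightarrow> real" where "gH G x = G x $ 2 $ 2"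
definition gD :: "(real^2 \<Rightarrow> real^2^2) \<Rightarrow> real^2 \<Rightarrow> real" where "gD G x = gE G x * gH G x - (gF G x)\<^sup>2"

text \<open>With p = (z3, z4), \<open>V1\<close> and \<open>V2\<close> are the components of the
  velocity v = g^-1 p by Cramer's rule. Then p . v is the squared length of v, so
  \<open>speed\<close> is |v|.\<close>

definition V1 :: "(real^2 \<Rightarrow> real^2^2) \<Rightarrow> real^4 \<Rightarrow> real" where
  "V1 G z = (gH G (prX z) * z$3 - gF G (prX z) * z$4) / gD G (prX z)"
definition V2 :: "(real^2 \<Rightarrow> real^2^2) \<Rightarrow> real^4 \<Rightarrow> real" where
  "V2 G z = (gE G (prX z) * z$4 - gF G (prX z) * z$3) / gD G (prX z)"
definition speed :: "(real^2 \<Rightarrow> real^2^2) \<Rightarrow> real^4 \<Rightarrow> real" where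
  "speed G z = sqrt (z$3 * V1 G z + z$4 * V2 G z)"

definition quad :: "real \<Rightarrow> real \<Rightarrow> real \<Rightarrow> real \<Rightarrow> real \<Rightarrow> real" where
  "quad e f h a b = e * a\<^sup>2 + 2 * f * a * b + h * b\<^sup>2"

text \<open>For w = (a, b) this is the value at (w, w) of the derivative of the metric tensor in the
  direction \<open>v\<close>, the vector w being held constant; \<open>ddquad\<close> is the
  second-order analogue.\<close>

definition dquad :: "(real^2 \<Rightarrow> real^2^2) \<Rightarrow> real^2 \<Rightarrow> real^2 \<Rightarrow> real \<Rightarrow> real \<Rightarrow> real" where
  "dquad G x v = quad (dg (gE G) x v) (dg (gF G) x v) (dg (gH G) x v)"

definition ddquad :: "(real^2 \<Rightarrow> real^2^2) \<Rightarrow> real^2 \<Rightarrow> real^2 \<Rightarrow> real^2 \<Rightarrow> real \<Rightarrow> real \<Rightarrow> real" where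
  "ddquad G x u v = quad (dg (\<lambda>x. dg (gE G) x u) x v) (dg (\<lambda>x. dg (gF G) x u) x v) (dg (\<lambda>x. dg (gH G) x u) x v)"

text \<open>In the coordinates \<open>(x, p)\<close> with \<open>p = g v\<close> the magnetic equation \<open>Dv/dt = \<mu> i v\<close> reads
  \<open>x' = v\<close>, \<open>p\<^sub>k' = 1/2 (\<partial>\<^sub>k g)(v, v) + \<mu> sqrt (det g) (-v\<^sub>2, v\<^sub>1)\<^sub>k\<close>.
  The factors \<open>1/n\<close> with \<open>n = |v|\<close> extend the flow from unit vectors to all nonzero ones by
  positive homogeneity.\<close>

definition magnetic_field :: "(real^2 \<Rightarrow> real^2^2) \<Rightarrow> real \<Rightarrow> real^4 \<Rightarrow> real^4" where
  "magnetic_field G \<mu> z = pack (vector [V1 G z / speed G z, V2 G z / speed G z])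
    (vector [dquad G (prX z) (axis 1 1) (V1 G z) (V2 G z) / (2 * speed G z) - \<mu> * sqrt (gD G (prX z)) * V2 G z,
             dquad G (prX z) (axis 2 1) (V1 G z) (V2 G z) / (2 * speed G z) + \<mu> * sqrt (gD G (prX z)) * V1 G z])"

text \<open>The derivatives \<open>dV1\<close>, \<open>dV2\<close> of the velocity in a direction \<open>w\<close> solve the linear system
  obtained by differentiating \<open>g V = p\<close>.\<close>

definition dV1 :: "(real^2 \<Rightarrow> real^2^2) \<Rightarrow> real^4 \<Rightarrow> real^4 \<Rightarrow> real" where
  "dV1 G z w = (let x = prX z; u = prX w in
     (gH G x * (w$3 - (dg (gE G) x u * V1 G z + dg (gF G) x u * V2 G z))
    - gF G x * (w$4 - (dg (gF G) x u * V1 G z + dg (gH G) x u * V2 G z))) / gD G x)"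
definition dV2 :: "(real^2 \<Rightarrow> real^2^2) \<Rightarrow> real^4 \<Rightarrow> real^4 \<Rightarrow> real" where
  "dV2 G z w = (let x = prX z; u = prX w in
     (gE G x * (w$4 - (dg (gF G) x u * V1 G z + dg (gH G) x u * V2 G z))
    - gF G x * (w$3 - (dg (gE G) x u * V1 G z + dg (gF G) x u * V2 G z))) / gD G x)"
text \<open>Obtained by differentiating n^2 = p . g^-1 p, where the derivative of g^-1 is -g^-1 (dg)
  g^-1, which explains the minus sign before \<open>dquad\<close>.\<close>

definition dspeed :: "(real^2 \<Rightarrow> real^2^2) \<Rightarrow> real^4 \<Rightarrow> real^4 \<Rightarrow> real" where
  "dspeed G z w = (2 * (w$3 * V1 G z + w$4 * V2 G z) - dquad G (prX z) (prX w) (V1 G z) (V2 G z)) / (2 * speed G z)"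
definition dD :: "(real^2 \<Rightarrow> real^2^2) \<Rightarrow> real^4 \<Rightarrow> real^4 \<Rightarrow> real" where
  "dD G z w = (let x = prX z; u = prX w in
     dg (gE G) x u * gH G x + gE G x * dg (gH G) x u - 2 * gF G x * dg (gF G) x u)"

text \<open>The derivative of the force term (1/2) (D_a g)(v, v) / n, where v and n depend on
  position and momentum as well.\<close>

definition dP :: "(real^2 \<Rightarrow> real^2^2) \<Rightarrow> real^2 \<Rightarrow> real^4 \<Rightarrow> real^4 \<Rightarrow> real" where
  "dP G a z w = (let x = prX z in
     (ddquad G x a (prX w) (V1 G z) (V2 G z)
      + 2 * (dg (gE G) x a * V1 G z * dV1 G z w + dg (gF G) x a * (dV1 G z w * V2 G z + V1 G z * dV2 G z w)
             + dg (gH G) x a * V2 G z * dV2 G z w)) / (2 * speed G z)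
      - dquad G x a (V1 G z) (V2 G z) * dspeed G z w / (2 * (speed G z)\<^sup>2))"

definition magnetic_field_deriv :: "(real^2 \<Rightarrow> real^2^2) \<Rightarrow> real \<Rightarrow> real^4 \<Rightarrow> real^4 \<Rightarrow> real^4" where
  "magnetic_field_deriv G \<mu> z w = pack
    (vector [dV1 G z w / speed G z - V1 G z * dspeed G z w / (speed G z)\<^sup>2,
             dV2 G z w / speed G z - V2 G z * dspeed G z w / (speed G z)\<^sup>2])
    (vector [dP G (axis 1 1) z w - \<mu> * (dD G z w / (2 * sqrt (gD G (prX z))) * V2 G z + sqrt (gD G (prX z)) * dV2 G z w),
             dP G (axis 2 1) z w + \<mu> * (dD G z w / (2 * sqrt (gD G (prX z))) * V1 G z + sqrt (gD G (prX z)) * dV1 G z w)])"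

section \<open>The field in one chart: derivative, divergence, conserved speed\<close>

locale metric_chart =
  fixes S :: "(real^2) set" and G :: "real^2 \<Rightarrow> real^2^2"
  assumes S: "open S" and smooth: "smooth_on S G"
    and sym: "\<And>x. x \<in> S \<Longrightarrow> transpose (G x) = G x"
    and pos: "\<And>x v. x \<in> S \<Longrightarrow> v \<noteq> 0 \<Longrightarrow> 0 < v \<bullet> (G x *v v)"
begin

definition Om :: "(real^4) set" where "Om = {z. prX z \<in> S \<and> prP z \<noteq> 0}"

lemma smooth_g: "smooth_on S (gE G)" "smooth_on S (gF G)" "smooth_on S (gH G)"
proof -
  have "smooth_on S (\<lambda>x. G x $ i $ j)" for i j
    by (rule smooth_on_bounded_linear[OF S _ smooth, of "\<lambda>A. A $ i $ j"])
       (auto intro: bounded_linear_compose[OF bounded_linear_vec_nth bounded_linear_vec_nth])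
  then show "smooth_on S (gE G)" "smooth_on S (gF G)" "smooth_on S (gH G)"
    unfolding gE_def gF_def gH_def by auto
qed

lemma dg_has_derivative:
  assumes "smooth_on S f" "x \<in> S" shows "(f has_derivative dg f x) (at x)"
  using smooth_on_has_derivative[OF assms] unfolding dg_def .

lemma dg_smooth: "smooth_on S f \<Longrightarrow> smooth_on S (\<lambda>x. dg f x v)"
  unfolding dg_def by (rule smooth_on_frechet)

lemma G_eq: "x \<in> S \<Longrightarrow> G x $ 2 $ 1 = gF G x"
  using arg_cong[OF sym[of x], of "\<lambda>A. A $ 1 $ 2"] by (simp add: transpose_def gF_def)

lemma Gv: "x \<in> S \<Longrightarrow> (G x *v v) $ 1 = gE G x * v$1 + gF G x * v$2"
  "x \<in> S \<Longrightarrow> (G x *v v) $ 2 = gF G x * v$1 + gH G x * v$2"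
  by (simp_all add: matrix_vector_mult_def sum_2 G_eq) (simp_all add: gE_def gF_def gH_def)

lemma GvV: "x \<in> S \<Longrightarrow> v \<bullet> (G x *v v) = quad (gE G x) (gF G x) (gH G x) (v$1) (v$2)"
  by (simp add: inner_vec_def sum_2 Gv quad_def power2_eq_square algebra_simps)

lemma g_pos: assumes x: "x \<in> S" shows "0 < gE G x" "0 < gD G x" "0 < gH G x"
proof -
  have p: "0 < quad (gE G x) (gF G x) (gH G x) a b" if "a \<noteq> 0 \<or> b \<noteq> 0" for a b
    using pos[OF x, of "vector [a, b]"] that by (simp add: GvV[OF x] vec_eq_iff forall_2)
  show e: "0 < gE G x" using p[of 1 0] by (simp add: quad_def)
  show "0 < gH G x" using p[of 0 1] by (simp add: quad_def)
  \<comment> \<open>Completing the square: at the vector (-F, E) the form takes the value E times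
    the determinant.\<close>
  have "quad (gE G x) (gF G x) (gH G x) (- gF G x) (gE G x) = gE G x * gD G x"
    by (simp add: quad_def gD_def power2_eq_square algebra_simps)
  then show "0 < gD G x" using p[of "- gF G x" "gE G x"] e by (auto simp: zero_less_mult_iff)
qed

lemma V_eq: assumes "prX z \<in> S"
  shows "gE G (prX z) * V1 G z + gF G (prX z) * V2 G z = z$3"
    "gF G (prX z) * V1 G z + gH G (prX z) * V2 G z = z$4"
proof -
  let ?x = "prX z"
  have D: "gD G ?x \<noteq> 0" using g_pos[OF assms] by auto
  have "gE G ?x * (gH G ?x * z$3 - gF G ?x * z$4) + gF G ?x * (gE G ?x * z$4 - gF G ?x * z$3) = gD G ?x * z$3"
    "gF G ?x * (gH G ?x * z$3 - gF G ?x * z$4) + gH G ?x * (gE G ?x * z$4 - gF G ?x * z$3) = gD G ?x * z$4"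
    by (simp_all add: gD_def power2_eq_square algebra_simps)
  then show "gE G ?x * V1 G z + gF G ?x * V2 G z = z$3" "gF G ?x * V1 G z + gH G ?x * V2 G z = z$4"
    using D by (simp_all add: V1_def V2_def add_divide_distrib[symmetric] nonzero_divide_eq_eq mult.commute)
qed

lemma speed_arg: "prX z \<in> S \<Longrightarrow> z$3 * V1 G z + z$4 * V2 G z = quad (gE G (prX z)) (gF G (prX z)) (gH G (prX z)) (V1 G z) (V2 G z)"
  using V_eq[of z] by (simp flip: V_eq add: quad_def power2_eq_square algebra_simps)

lemma speed_pos:
  assumes "z \<in> Om" shows "0 < speed G z" "(speed G z)\<^sup>2 = z$3 * V1 G z + z$4 * V2 G z"
proof -
  have x: "prX z \<in> S" using assms by (auto simp: Om_def)
  have "V1 G z \<noteq> 0 \<or> V2 G z \<noteq> 0"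
  proof (rule ccontr)
    assume "\<not> ?thesis"
    then have "z$3 = 0" "z$4 = 0" using V_eq[OF x] by auto
    then show False using assms by (auto simp: Om_def vec_eq_iff forall_2)
  qed
  then have "(vector [V1 G z, V2 G z] :: real^2) \<noteq> 0" by (auto simp: vec_eq_iff forall_2)
  from pos[OF x this] have "0 < z$3 * V1 G z + z$4 * V2 G z" unfolding speed_arg[OF x] GvV[OF x] by simp
  then show "0 < speed G z" "(speed G z)\<^sup>2 = z$3 * V1 G z + z$4 * V2 G z" by (simp_all add: speed_def)
qed

lemma Om_open: "open Om"
proof -
  have "continuous_on UNIV prX" "continuous_on UNIV prP"
    using bounded_linear_prX bounded_linear_prP by (auto intro: linear_continuous_on)
  then have "open (prX -` S \<inter> prP -` (- {0}))" using S by (intro open_Int open_vimage) auto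
  moreover have "prX -` S \<inter> prP -` (- {0}) = Om" by (auto simp: Om_def)
  ultimately show ?thesis by simp
qed

lemma prX_derivative:
  assumes "smooth_on S f" "prX z \<in> S"
  shows "((\<lambda>z. f (prX z)) has_derivative (\<lambda>w. dg f (prX z) (prX w))) (at z)"
  by (rule has_derivative_compose[OF bounded_linear_imp_has_derivative[OF bounded_linear_prX] dg_has_derivative[OF assms]])

lemma nth_derivative: "((\<lambda>z::real^4. z $ i) has_derivative (\<lambda>w. w $ i)) (at z)"
  by (rule bounded_linear_imp_has_derivative[OF bounded_linear_vec_nth])

lemma gD_derivative:
  assumes "prX z \<in> S"
  shows "((\<lambda>z. gD G (prX z)) has_derivative dD G z) (at z)"
  unfolding gD_def
  by (rule has_derivative_eq_rhs, (rule derivative_intros prX_derivative[OF smooth_g(1) assms] prX_derivative[OF smooth_g(2) assms]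
      prX_derivative[OF smooth_g(3) assms])+) (auto simp: dD_def Let_def fun_eq_iff algebra_simps)

lemma V_derivative:
  assumes x: "prX z \<in> S"
  shows "(V1 G has_derivative dV1 G z) (at z)" "(V2 G has_derivative dV2 G z) (at z)"
proof -
  let ?x = "prX z"
  have D: "gD G ?x \<noteq> 0" using g_pos[OF x] by auto
  note d = prX_derivative[OF smooth_g(1) x] prX_derivative[OF smooth_g(2) x] prX_derivative[OF smooth_g(3) x]
     gD_derivative[OF x] nth_derivative
  note e = V_eq[OF x]
  have E: "gD G ?x = gE G ?x * gH G ?x - (gF G ?x)\<^sup>2" by (simp add: gD_def)
  \<comment> \<open>Replacing \<open>z$3\<close> and \<open>z$4\<close> by g V turns the numerator
    of the quotient rule into Cramer's rule for the differentiated system, the form in which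
    \<open>dV1\<close> is defined.\<close>
  have key1: "((hh * z$3 + gH G ?x * w3) - (ff * z$4 + gF G ?x * w4)) - V1 G z * (ee * gH G ?x + gE G ?x * hh - 2 * gF G ?x * ff)
    = gH G ?x * (w3 - (ee * V1 G z + ff * V2 G z)) - gF G ?x * (w4 - (ff * V1 G z + hh * V2 G z))" for ee ff hh w3 w4
    unfolding e[symmetric] by (simp add: algebra_simps power2_eq_square)
  have key2: "((ee * z$4 + gE G ?x * w4) - (ff * z$3 + gF G ?x * w3)) - V2 G z * (ee * gH G ?x + gE G ?x * hh - 2 * gF G ?x * ff)
    = gE G ?x * (w4 - (ff * V1 G z + hh * V2 G z)) - gF G ?x * (w3 - (ee * V1 G z + ff * V2 G z))" for ee ff hh w3 w4
    unfolding e[symmetric] by (simp add: algebra_simps power2_eq_square)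
  have quot: "((\<lambda>z. N z / gD G (prX z)) has_derivative (\<lambda>w. (N' w - N z / gD G ?x * dD G z w) / gD G ?x)) (at z)"
    if "(N has_derivative N') (at z)" for N N'
    by (rule has_derivative_eq_rhs, rule has_derivative_divide[OF that d(4) D]) (use D in \<open>auto simp: fun_eq_iff field_simps\<close>)
  have "(V1 G has_derivative (\<lambda>w. (((dg (gH G) ?x (prX w) * z$3 + gH G ?x * w$3) - (dg (gF G) ?x (prX w) * z$4 + gF G ?x * w$4))
      - V1 G z * dD G z w) / gD G ?x)) (at z)"
    unfolding V1_def[abs_def]
    by (rule quot) (rule has_derivative_eq_rhs, (rule derivative_intros d)+, auto simp: fun_eq_iff)
  then show "(V1 G has_derivative dV1 G z) (at z)"
    by (rule has_derivative_eq_rhs) (simp add: fun_eq_iff dV1_def Let_def dD_def key1)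
  have "(V2 G has_derivative (\<lambda>w. (((dg (gE G) ?x (prX w) * z$4 + gE G ?x * w$4) - (dg (gF G) ?x (prX w) * z$3 + gF G ?x * w$3))
      - V2 G z * dD G z w) / gD G ?x)) (at z)"
    unfolding V2_def[abs_def]
    by (rule quot) (rule has_derivative_eq_rhs, (rule derivative_intros d)+, auto simp: fun_eq_iff)
  then show "(V2 G has_derivative dV2 G z) (at z)"
    by (rule has_derivative_eq_rhs) (simp add: fun_eq_iff dV2_def Let_def dD_def key2)
qed

lemma dV_eq:
  assumes x: "prX z \<in> S"
  shows "gE G (prX z) * dV1 G z w + gF G (prX z) * dV2 G z w
      = w$3 - (dg (gE G) (prX z) (prX w) * V1 G z + dg (gF G) (prX z) (prX w) * V2 G z)"
    "gF G (prX z) * dV1 G z w + gH G (prX z) * dV2 G z w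
      = w$4 - (dg (gF G) (prX z) (prX w) * V1 G z + dg (gH G) (prX z) (prX w) * V2 G z)"
proof -
  let ?x = "prX z"
  have D: "gD G ?x \<noteq> 0" using g_pos[OF x] by auto
  have "gE G ?x * (gH G ?x * a - gF G ?x * b) + gF G ?x * (gE G ?x * b - gF G ?x * a) = gD G ?x * a"
    "gF G ?x * (gH G ?x * a - gF G ?x * b) + gH G ?x * (gE G ?x * b - gF G ?x * a) = gD G ?x * b" for a b
    by (simp_all add: gD_def power2_eq_square algebra_simps)
  note * = this
  show "gE G (prX z) * dV1 G z w + gF G (prX z) * dV2 G z w
      = w$3 - (dg (gE G) (prX z) (prX w) * V1 G z + dg (gF G) (prX z) (prX w) * V2 G z)"
    "gF G (prX z) * dV1 G z w + gH G (prX z) * dV2 G z w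
      = w$4 - (dg (gF G) (prX z) (prX w) * V1 G z + dg (gH G) (prX z) (prX w) * V2 G z)"
    unfolding dV1_def dV2_def Let_def times_divide_eq_right add_divide_distrib[symmetric] * using D by simp_all
qed

lemma speed_derivative:
  assumes z: "z \<in> Om"
  shows "(speed G has_derivative dspeed G z) (at z)"
proof -
  have x: "prX z \<in> S" using z by (auto simp: Om_def)
  have p: "0 < z$3 * V1 G z + z$4 * V2 G z" using zero_less_power[OF speed_pos(1)[OF z], of 2] unfolding speed_pos(2)[OF z] .
  let ?d = "\<lambda>w. w$3 * V1 G z + z$3 * dV1 G z w + (w$4 * V2 G z + z$4 * dV2 G z w)"
  have "((\<lambda>z. z$3 * V1 G z + z$4 * V2 G z) has_derivative ?d) (at z)"
    by (rule has_derivative_eq_rhs, (rule derivative_intros V_derivative[OF x] nth_derivative)+) (auto simp: fun_eq_iff)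
  from has_derivative_real_sqrt[OF p this]
  have d: "(speed G has_derivative (\<lambda>w. ?d w * (inverse (speed G z) / 2))) (at z)"
    unfolding speed_def[abs_def] by (simp add: mult.commute)
  have "?d w * (inverse (speed G z) / 2) = dspeed G z w" for w
  proof -
    \<comment> \<open>As p = g v and g is symmetric, p . dV equals v . (g dV), and the
      differentiated system \<open>dV_eq\<close> evaluates g dV.\<close>
    have "z$3 * dV1 G z w + z$4 * dV2 G z w =
      V1 G z * (gE G (prX z) * dV1 G z w + gF G (prX z) * dV2 G z w) + V2 G z * (gF G (prX z) * dV1 G z w + gH G (prX z) * dV2 G z w)"
      unfolding V_eq[OF x, symmetric] by (simp add: algebra_simps)
    also have "\<dots> = w$3 * V1 G z + w$4 * V2 G z - dquad G (prX z) (prX w) (V1 G z) (V2 G z)"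
      unfolding dV_eq[OF x] by (simp add: dquad_def quad_def power2_eq_square algebra_simps)
    finally have eq: "?d w = 2 * (w$3 * V1 G z + w$4 * V2 G z) - dquad G (prX z) (prX w) (V1 G z) (V2 G z)" by simp
    have "a * (inverse n / 2) = a / (2 * n)" for a n :: real by (simp add: field_simps)
    then show ?thesis unfolding dspeed_def eq .
  qed
  then have "(\<lambda>w. ?d w * (inverse (speed G z) / 2)) = dspeed G z" by (rule ext)
  with d show ?thesis by simp
qed

lemma sqrt_gD_derivative:
  assumes x: "prX z \<in> S"
  shows "((\<lambda>z. sqrt (gD G (prX z))) has_derivative (\<lambda>w. dD G z w / (2 * sqrt (gD G (prX z))))) (at z)"
  by (rule has_derivative_eq_rhs, rule has_derivative_real_sqrt[OF g_pos(2)[OF x] gD_derivative[OF x]])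
    (simp add: fun_eq_iff field_simps)

lemma dquad_derivative:
  assumes z: "z \<in> Om"
  shows "((\<lambda>z. dquad G (prX z) a (V1 G z) (V2 G z) / (2 * speed G z)) has_derivative dP G a z) (at z)"
proof -
  have x: "prX z \<in> S" using z by (auto simp: Om_def)
  have n: "speed G z \<noteq> 0" using speed_pos(1)[OF z] by simp
  note d = prX_derivative[OF dg_smooth[OF smooth_g(1)] x] prX_derivative[OF dg_smooth[OF smooth_g(2)] x]
    prX_derivative[OF dg_smooth[OF smooth_g(3)] x] V_derivative[OF x]
  have q: "((\<lambda>z. dquad G (prX z) a (V1 G z) (V2 G z)) has_derivative
     (\<lambda>w. ddquad G (prX z) a (prX w) (V1 G z) (V2 G z)
      + 2 * (dg (gE G) (prX z) a * V1 G z * dV1 G z w + dg (gF G) (prX z) a * (dV1 G z w * V2 G z + V1 G z * dV2 G z w)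
             + dg (gH G) (prX z) a * V2 G z * dV2 G z w))) (at z)"
    unfolding dquad_def quad_def power2_eq_square
    by (rule has_derivative_eq_rhs, (rule derivative_intros d)+)
      (simp add: fun_eq_iff ddquad_def quad_def power2_eq_square algebra_simps)
  have m: "((\<lambda>z. 2 * speed G z) has_derivative (\<lambda>w. 2 * dspeed G z w)) (at z)"
    by (rule derivative_intros speed_derivative[OF z])+
  show ?thesis
    by (rule has_derivative_eq_rhs, rule has_derivative_divide[OF q m])
      (use n in \<open>simp_all add: fun_eq_iff dP_def Let_def field_simps power2_eq_square\<close>)
qed

lemma magnetic_field_derivative:
  assumes z: "z \<in> Om"
  shows "(magnetic_field G \<mu> has_derivative magnetic_field_deriv G \<mu> z) (at z)"
proof (rule has_derivative_cart)
  have x: "prX z \<in> S" using z by (auto simp: Om_def)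
  have n: "speed G z \<noteq> 0" using speed_pos(1)[OF z] by simp
  have quot: "((\<lambda>z. N z / speed G z) has_derivative (\<lambda>w. N' w / speed G z - N z * dspeed G z w / (speed G z)\<^sup>2)) (at z)"
    if "(N has_derivative N') (at z)" for N N'
    by (rule has_derivative_eq_rhs, rule has_derivative_divide[OF that speed_derivative[OF z] n])
      (use n in \<open>simp add: fun_eq_iff field_simps power2_eq_square\<close>)
  have mag: "((\<lambda>z. \<mu> * sqrt (gD G (prX z)) * N z) has_derivative
     (\<lambda>w. \<mu> * (dD G z w / (2 * sqrt (gD G (prX z))) * N z + sqrt (gD G (prX z)) * N' w))) (at z)"
    if "(N has_derivative N') (at z)" for N N'
    by (rule has_derivative_eq_rhs, (rule derivative_intros that sqrt_gD_derivative[OF x])+)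
      (simp add: fun_eq_iff algebra_simps)
  fix i :: 4
  consider "i = 1" | "i = 2" | "i = 3" | "i = 4" using exhaust_4 by blast
  then show "((\<lambda>z. magnetic_field G \<mu> z $ i) has_derivative (\<lambda>w. magnetic_field_deriv G \<mu> z w $ i)) (at z)"
  proof cases
    case 1 then show ?thesis using quot[OF V_derivative(1)[OF x]] by (simp add: magnetic_field_def magnetic_field_deriv_def)
  next
    case 2 then show ?thesis using quot[OF V_derivative(2)[OF x]] by (simp add: magnetic_field_def magnetic_field_deriv_def)
  next
    case 3 then show ?thesis
      using has_derivative_diff[OF dquad_derivative[OF z, of "axis 1 1"] mag[OF V_derivative(2)[OF x]]] by (simp add: magnetic_field_def magnetic_field_deriv_def)
  next
    case 4 then show ?thesis
      using has_derivative_add[OF dquad_derivative[OF z, of "axis 2 1"] mag[OF V_derivative(1)[OF x]]] by (simp add: magnetic_field_def magnetic_field_deriv_def)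
  qed
qed

lemma dg_cont:
  assumes "smooth_on S f" shows "continuous_on Om (\<lambda>z. dg f (prX z) v)" "continuous_on Om (\<lambda>z. f (prX z))"
proof -
  have c: "continuous_on Om prX" using linear_continuous_on[OF bounded_linear_prX] .
  have "prX ` Om \<subseteq> S" by (auto simp: Om_def)
  then show "continuous_on Om (\<lambda>z. dg f (prX z) v)" "continuous_on Om (\<lambda>z. f (prX z))"
    using continuous_on_compose2[OF smooth_on_continuous[OF dg_smooth[OF assms]] c]
      continuous_on_compose2[OF smooth_on_continuous[OF assms] c] by auto
qed

lemma V_cont: "continuous_on Om (V1 G)" "continuous_on Om (V2 G)" "continuous_on Om (speed G)"
proof -
  have "isCont (V1 G) z" "isCont (V2 G) z" "isCont (speed G) z" if "z \<in> Om" for z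
    using that V_derivative[of z] speed_derivative[OF that] has_derivative_continuous by (auto simp: Om_def)
  then show "continuous_on Om (V1 G)" "continuous_on Om (V2 G)" "continuous_on Om (speed G)"
    by (auto intro: continuous_at_imp_continuous_on)
qed

lemma magnetic_field_deriv_cont: "continuous_on Om (\<lambda>z. magnetic_field_deriv G \<mu> z w)"
proof -
  note c = dg_cont[OF smooth_g(1)] dg_cont[OF smooth_g(2)] dg_cont[OF smooth_g(3)] V_cont
    dg_cont(1)[OF dg_smooth[OF smooth_g(1)]] dg_cont(1)[OF dg_smooth[OF smooth_g(2)]] dg_cont(1)[OF dg_smooth[OF smooth_g(3)]]
  have n: "\<forall>z\<in>Om. speed G z \<noteq> 0" "\<forall>z\<in>Om. gD G (prX z) \<noteq> 0" "\<forall>z\<in>Om. sqrt (gD G (prX z)) \<noteq> 0"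
    using speed_pos(1) g_pos(2) by (fastforce simp: Om_def)+
  have D: "continuous_on Om (\<lambda>z. gD G (prX z))" "continuous_on Om (\<lambda>z. dD G z w)"
    unfolding gD_def dD_def Let_def by (intro continuous_intros c)+
  have V: "continuous_on Om (\<lambda>z. dV1 G z w)" "continuous_on Om (\<lambda>z. dV2 G z w)"
    unfolding dV1_def dV2_def Let_def by (intro continuous_intros c D n)+
  have nn: "continuous_on Om (\<lambda>z. dspeed G z w)"
    unfolding dspeed_def dquad_def quad_def by (intro continuous_intros c ballI) (use n in auto)
  have P: "continuous_on Om (\<lambda>z. dP G a z w)" for a
    unfolding dP_def Let_def dquad_def ddquad_def quad_def
    by (intro continuous_intros c V nn ballI) (use n in auto)
  have "continuous_on Om (\<lambda>z. magnetic_field_deriv G \<mu> z w $ i)" for i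
  proof -
    consider "i = 1" | "i = 2" | "i = 3" | "i = 4" using exhaust_4 by blast
    then show ?thesis
      by cases (simp_all add: magnetic_field_deriv_def, (intro continuous_intros c D V nn P ballI; use n in auto)+)
  qed
  then have "continuous_on Om (\<lambda>z. \<chi> i. magnetic_field_deriv G \<mu> z w $ i)" by (rule continuous_on_vec_lambda)
  then show ?thesis by simp
qed

lemma dg_linear: "smooth_on S f \<Longrightarrow> x \<in> S \<Longrightarrow> linear (dg f x)"
  using dg_has_derivative has_derivative_linear by blast

lemma dg_zero: "smooth_on S f \<Longrightarrow> x \<in> S \<Longrightarrow> dg f x 0 = 0"
  using dg_linear linear_0 by blast

text \<open>Without \<mu> the field is the Hamiltonian field of \<open>speed\<close>, so the mixed
  second derivatives in \<open>T1\<close>, \<open>T3\<close> and in \<open>T2\<close>,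
  \<open>T4\<close> cancel. The magnetic terms depend on p only through v = g^-1 p and contribute
  two opposite multiples of the off-diagonal entry of the symmetric matrix g^-1.\<close>

lemma magnetic_field_deriv_trace:
  assumes z: "z \<in> Om"
  shows "trace (matrix (magnetic_field_deriv G \<mu> z)) = 0"
proof -
  have x: "prX z \<in> S" using z by (auto simp: Om_def)
  define n D where nD: "n = speed G z" "D = gD G (prX z)"
  have n: "n \<noteq> 0" and D: "D \<noteq> 0" using speed_pos(1)[OF z] g_pos(2)[OF x] by (auto simp: nD)
  have pX: "prX (axis 1 1) = axis 1 1" "prX (axis 2 1) = axis 2 1" "prX (axis 3 1) = 0" "prX (axis 4 1) = 0"
    by (simp_all add: vec_eq_iff forall_2 axis_def)
  have ax: "(axis k 1 :: real^4) $ l = (if l = k then 1 else 0)" for k l by (simp add: axis_def)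
  note z0 = dg_zero[OF smooth_g(1) x] dg_zero[OF smooth_g(2) x] dg_zero[OF smooth_g(3) x]
    dg_zero[OF dg_smooth[OF smooth_g(1)] x] dg_zero[OF dg_smooth[OF smooth_g(2)] x] dg_zero[OF dg_smooth[OF smooth_g(3)] x]
  let ?Q = "\<lambda>k. dquad G (prX z) (axis k 1) (V1 G z) (V2 G z)"
  have dspeed: "dspeed G z (axis 1 1) = - ?Q 1 / (2 * n)" "dspeed G z (axis 2 1) = - ?Q 2 / (2 * n)"
    "dspeed G z (axis 3 1) = V1 G z / n" "dspeed G z (axis 4 1) = V2 G z / n"
    using n by (simp_all add: dspeed_def pX ax nD dquad_def z0 quad_def)
  have dD0: "dD G z (axis 3 1) = 0" "dD G z (axis 4 1) = 0" by (simp_all add: dD_def pX z0)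
  have dV34: "dV1 G z (axis 3 1) = gH G (prX z) / D" "dV2 G z (axis 3 1) = - gF G (prX z) / D"
    "dV1 G z (axis 4 1) = - gF G (prX z) / D" "dV2 G z (axis 4 1) = gE G (prX z) / D"
    by (simp_all add: dV1_def dV2_def Let_def pX z0 ax nD)
  have dd0: "ddquad G (prX z) a 0 u v = 0" for a u v by (simp add: ddquad_def z0 quad_def)
  have tr: "trace (matrix (magnetic_field_deriv G \<mu> z)) = magnetic_field_deriv G \<mu> z (axis 1 1) $ 1 + magnetic_field_deriv G \<mu> z (axis 2 1) $ 2
      + magnetic_field_deriv G \<mu> z (axis 3 1) $ 3 + magnetic_field_deriv G \<mu> z (axis 4 1) $ 4"
    by (simp add: trace_def matrix_def sum_4)
  have T1: "magnetic_field_deriv G \<mu> z (axis 1 1) $ 1 = - (gH G (prX z) * (dg (gE G) (prX z) (axis 1 1) * V1 G z + dg (gF G) (prX z) (axis 1 1) * V2 G z)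
     - gF G (prX z) * (dg (gF G) (prX z) (axis 1 1) * V1 G z + dg (gH G) (prX z) (axis 1 1) * V2 G z)) / (D * n) + V1 G z * ?Q 1 / (2 * n ^ 3)"
    using n D by (simp add: magnetic_field_deriv_def dV1_def Let_def pX ax dspeed nD[symmetric] field_simps power2_eq_square power3_eq_cube)
  have T2: "magnetic_field_deriv G \<mu> z (axis 2 1) $ 2 = - (gE G (prX z) * (dg (gF G) (prX z) (axis 2 1) * V1 G z + dg (gH G) (prX z) (axis 2 1) * V2 G z)
     - gF G (prX z) * (dg (gE G) (prX z) (axis 2 1) * V1 G z + dg (gF G) (prX z) (axis 2 1) * V2 G z)) / (D * n) + V2 G z * ?Q 2 / (2 * n ^ 3)"
    using n D by (simp add: magnetic_field_deriv_def dV2_def Let_def pX ax dspeed nD[symmetric] field_simps power2_eq_square power3_eq_cube)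
  have T3: "magnetic_field_deriv G \<mu> z (axis 3 1) $ 3 = (gH G (prX z) * (dg (gE G) (prX z) (axis 1 1) * V1 G z + dg (gF G) (prX z) (axis 1 1) * V2 G z)
     - gF G (prX z) * (dg (gF G) (prX z) (axis 1 1) * V1 G z + dg (gH G) (prX z) (axis 1 1) * V2 G z)) / (D * n) - V1 G z * ?Q 1 / (2 * n ^ 3)
     + \<mu> * sqrt D * gF G (prX z) / D"
    using n D by (simp add: magnetic_field_deriv_def dP_def Let_def pX dd0 dV34 dD0 dspeed nD[symmetric] field_simps power2_eq_square power3_eq_cube)
  have T4: "magnetic_field_deriv G \<mu> z (axis 4 1) $ 4 = (gE G (prX z) * (dg (gF G) (prX z) (axis 2 1) * V1 G z + dg (gH G) (prX z) (axis 2 1) * V2 G z)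
     - gF G (prX z) * (dg (gE G) (prX z) (axis 2 1) * V1 G z + dg (gF G) (prX z) (axis 2 1) * V2 G z)) / (D * n) - V2 G z * ?Q 2 / (2 * n ^ 3)
     - \<mu> * sqrt D * gF G (prX z) / D"
    using n D by (simp add: magnetic_field_deriv_def dP_def Let_def pX dd0 dV34 dD0 dspeed nD[symmetric] field_simps power2_eq_square power3_eq_cube)
  show ?thesis unfolding tr T1 T2 T3 T4 by (simp add: diff_divide_distrib)
qed

lemma dg_vector:
  assumes f: "smooth_on S f" "x \<in> S"
  shows "dg f x (vector [a, b]) = a * dg f x (axis 1 1) + b * dg f x (axis 2 1)"
proof -
  have "(vector [a, b] :: real^2) = a *\<^sub>R axis 1 1 + b *\<^sub>R axis 2 1"
    by (simp add: vec_eq_iff forall_2 axis_def)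
  then show ?thesis using dg_linear[OF f] by (simp add: linear_add linear_scale)
qed

text \<open>The magnetic force is proportional to (-v_2, v_1) and does no work; what remains is
  conservation of the Hamiltonian along its own flow.\<close>

lemma speed_conserved:
  assumes z: "z \<in> Om"
  shows "dspeed G z (magnetic_field G \<mu> z) = 0"
proof -
  have x: "prX z \<in> S" using z by (auto simp: Om_def)
  have n: "speed G z \<noteq> 0" using speed_pos(1)[OF z] by simp
  note v = dg_vector[OF smooth_g(1) x] dg_vector[OF smooth_g(2) x] dg_vector[OF smooth_g(3) x]
  let ?Q = "\<lambda>k. dquad G (prX z) (axis k 1) (V1 G z) (V2 G z)"
  have "2 * (magnetic_field G \<mu> z $ 3 * V1 G z + magnetic_field G \<mu> z $ 4 * V2 G z) = (?Q 1 * V1 G z + ?Q 2 * V2 G z) / speed G z"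
    using n by (simp add: magnetic_field_def field_simps)
  also have "\<dots> = dquad G (prX z) (prX (magnetic_field G \<mu> z)) (V1 G z) (V2 G z)"
    using n by (simp add: magnetic_field_def dquad_def quad_def v field_simps power2_eq_square)
  finally show ?thesis unfolding dspeed_def by simp
qed

section \<open>Equivalence with the covariant magnetic equation\<close>

definition christoffel_quad :: "real^2 \<Rightarrow> real^2 \<Rightarrow> real^2" where
  "christoffel_quad x v = (\<chi> k. \<Sum>i\<in>UNIV. \<Sum>j\<in>UNIV. christoffel G k i j x * v$i * v$j)"

lemma pd_G:
  assumes x: "x \<in> S"
  shows "pd i (\<lambda>y. G y $ 1 $ 1) x = dg (gE G) x (axis i 1)" "pd i (\<lambda>y. G y $ 1 $ 2) x = dg (gF G) x (axis i 1)"
    "pd i (\<lambda>y. G y $ 2 $ 1) x = dg (gF G) x (axis i 1)" "pd i (\<lambda>y. G y $ 2 $ 2) x = dg (gH G) x (axis i 1)"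
proof -
  have "frechet_derivative (\<lambda>y. G y $ 2 $ 1) (at x) = frechet_derivative (gF G) (at x)"
    by (rule frechet_derivative_cong_open[OF S x]) (rule G_eq)
  then show "pd i (\<lambda>y. G y $ 2 $ 1) x = dg (gF G) x (axis i 1)" by (simp add: pd_def dg_def)
qed (simp_all add: pd_def dg_def gE_def[abs_def] gF_def[abs_def] gH_def[abs_def])

lemma G_det: "x \<in> S \<Longrightarrow> det (G x) = gD G x"
  by (simp add: det_2 gD_def G_eq power2_eq_square) (simp add: gE_def gF_def gH_def)

lemma G_invertible: "x \<in> S \<Longrightarrow> invertible (G x)"
  using g_pos(2)[of x] by (simp add: invertible_det_nz G_det)

lemma dg_expand:
  assumes "smooth_on S f" "x \<in> S"
  shows "dg f x v = v$1 * dg f x (axis 1 1) + v$2 * dg f x (axis 2 1)"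
proof -
  have "v = vector [v$1, v$2]" by (simp add: vec_eq_iff forall_2)
  then show ?thesis using dg_vector[OF assms, of "v$1" "v$2"] by simp
qed

text \<open>Lowering the index cancels the inverse matrix in the Christoffel symbols. The two
  symmetric terms of the first kind combine to the derivative of g along \<open>v\<close>, the third
  one gives minus half of (d_k g)(v, v).\<close>

lemma G_christoffel_quad:
  assumes x: "x \<in> S"
  shows "(G x *v christoffel_quad x v) $ 1 = dg (gE G) x v * v$1 + dg (gF G) x v * v$2 - dquad G x (axis 1 1) (v$1) (v$2) / 2"
    "(G x *v christoffel_quad x v) $ 2 = dg (gF G) x v * v$1 + dg (gH G) x v * v$2 - dquad G x (axis 2 1) (v$1) (v$2) / 2"
proof -
  define b :: "real^2" where "b = (\<chi> l. \<Sum>i\<in>UNIV. \<Sum>j\<in>UNIV.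
     1/2 * (pd i (\<lambda>y. G y $ j $ l) x + pd j (\<lambda>y. G y $ i $ l) x - pd l (\<lambda>y. G y $ i $ j) x) * v$i * v$j)"
  have "christoffel_quad x v = matrix_inv (G x) *v b"
    by (simp add: vec_eq_iff christoffel_quad_def b_def christoffel_def matrix_vector_mult_def sum_2 algebra_simps)
  then have "G x *v christoffel_quad x v = (G x ** matrix_inv (G x)) *v b" by (simp add: matrix_vector_mul_assoc)
  also have "\<dots> = b"
    using someI_ex[OF G_invertible[OF x, unfolded invertible_def]] by (simp add: matrix_inv_def)
  finally have Gb: "G x *v christoffel_quad x v = b" .
  note e = dg_expand[OF smooth_g(1) x, of v] dg_expand[OF smooth_g(2) x, of v] dg_expand[OF smooth_g(3) x, of v]
  show "(G x *v christoffel_quad x v) $ 1 = dg (gE G) x v * v$1 + dg (gF G) x v * v$2 - dquad G x (axis 1 1) (v$1) (v$2) / 2"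
    "(G x *v christoffel_quad x v) $ 2 = dg (gF G) x v * v$1 + dg (gH G) x v * v$2 - dquad G x (axis 2 1) (v$1) (v$2) / 2"
    unfolding Gb b_def e dquad_def quad_def
    by (simp_all add: sum_2 pd_G[OF x] power2_eq_square field_simps)
qed

text \<open>With (p, q) = g v the definite description selects (-q, p) divided by the square root of
  det g. Lowering its index gives the Riemannian area form paired with \<open>v\<close>.\<close>

lemma rot90_eq:
  assumes x: "x \<in> S" and v: "v \<noteq> 0"
  shows "(G x *v rot90 (G x) v) $ 1 = - sqrt (gD G x) * v$2" "(G x *v rot90 (G x) v) $ 2 = sqrt (gD G x) * v$1"
proof -
  let ?e = "gE G x" and ?f = "gF G x" and ?h = "gH G x" and ?s = "sqrt (gD G x)"
  let ?p = "?e * v$1 + ?f * v$2" and ?q = "?f * v$1 + ?h * v$2"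
  have D: "0 < gD G x" using g_pos[OF x] by simp
  have s: "0 < ?s" "?s * ?s = gD G x" using D by simp_all
  have vv: "0 < quad ?e ?f ?h (v$1) (v$2)" using pos[OF x v] GvV[OF x] by simp
  have vpq: "quad ?e ?f ?h (v$1) (v$2) = v$1 * ?p + v$2 * ?q" by (simp add: quad_def power2_eq_square algebra_simps)
  define r :: "real^2" where "r = vector [- ?q / ?s, ?p / ?s]"
  have dot: "v \<bullet> (G x *v w) = ?p * w$1 + ?q * w$2" for w
    by (simp add: inner_vec_def sum_2 Gv[OF x] algebra_simps)
  have qD: "quad ?e ?f ?h (- ?q) ?p = gD G x * quad ?e ?f ?h (v$1) (v$2)"
    by (simp add: quad_def gD_def power2_eq_square algebra_simps)
  have quad_scale: "quad ?e ?f ?h (l * a) (l * b) = l\<^sup>2 * quad ?e ?f ?h a b" for l a b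
    by (simp add: quad_def power2_eq_square algebra_simps)
  have "rot90 (G x) v = r"
    unfolding rot90_def
  proof (rule the_equality)
    have "quad ?e ?f ?h (r$1) (r$2) = quad ?e ?f ?h ((1/?s) * (- ?q)) ((1/?s) * ?p)" by (simp add: r_def)
    also have "\<dots> = quad ?e ?f ?h (v$1) (v$2)"
      unfolding quad_scale qD using D by (simp add: power_divide)
    finally have 1: "r \<bullet> (G x *v r) = v \<bullet> (G x *v v)" unfolding GvV[OF x] .
    have "p * (- q / s) + q * (p / s) = 0" for p q s :: real by simp
    then have 2: "v \<bullet> (G x *v r) = 0" unfolding dot r_def vector_2 .
    have vs: "a * (p / s) - b * (- q / s) = (a * p + b * q) / s" for a p s b q :: real
      by (simp add: add_divide_distrib)
    have "v$1 * r$2 - v$2 * r$1 = quad ?e ?f ?h (v$1) (v$2) / ?s"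
      unfolding vpq r_def vector_2 using vs[of "v$1" ?p ?s "v$2" ?q] .
    then have "0 \<le> v$1 * r$2 - v$2 * r$1" using vv s by simp
    with 1 2 show "v \<bullet> (G x *v r) = 0 \<and> r \<bullet> (G x *v r) = v \<bullet> (G x *v v) \<and> 0 \<le> v$1 * r$2 - v$2 * r$1" by simp
  next
    fix w assume w: "v \<bullet> (G x *v w) = 0 \<and> w \<bullet> (G x *v w) = v \<bullet> (G x *v v) \<and> 0 \<le> v$1 * w$2 - v$2 * w$1"
    have w0: "?p * w$1 + ?q * w$2 = 0" using w dot by simp
    \<comment> \<open>Orthogonality to \<open>v\<close> forces \<open>w\<close> to be
      \<open>l\<close> times (-q, p), equal length gives l^2 det g = 1, and the orientation
      condition gives l \<ge> 0.\<close>
    define l where "l = (v$1 * w$2 - v$2 * w$1) / quad ?e ?f ?h (v$1) (v$2)"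
    have "quad ?e ?f ?h (v$1) (v$2) * w$1 = - ?q * (v$1 * w$2 - v$2 * w$1) + v$1 * (?p * w$1 + ?q * w$2)"
      "quad ?e ?f ?h (v$1) (v$2) * w$2 = ?p * (v$1 * w$2 - v$2 * w$1) + v$2 * (?p * w$1 + ?q * w$2)"
      unfolding vpq by (simp_all add: algebra_simps)
    then have wl: "w$1 = l * (- ?q)" "w$2 = l * ?p"
      unfolding w0 l_def using vv by (simp_all add: field_simps)
    have "quad ?e ?f ?h (w$1) (w$2) = quad ?e ?f ?h (v$1) (v$2)" using w unfolding GvV[OF x] by simp
    then have "l\<^sup>2 * gD G x = 1" unfolding wl quad_scale qD using vv by simp
    then have "(l * ?s)\<^sup>2 = 1" using D by (simp add: power_mult_distrib)
    then have "l * ?s = 1 \<or> l * ?s = -1" by (simp only: power2_eq_1_iff)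
    moreover have "0 \<le> l" unfolding l_def using w vv by simp
    then have "0 \<le> l * ?s" using s(1) by simp
    ultimately have "l * ?s = 1" by linarith
    then have "l = 1 / ?s" using s(1) by (simp add: field_simps)
    then show "w = r" using wl by (simp add: vec_eq_iff forall_2 r_def)
  qed
  then show "(G x *v rot90 (G x) v) $ 1 = - sqrt (gD G x) * v$2" "(G x *v rot90 (G x) v) $ 2 = sqrt (gD G x) * v$1"
    using s by (simp_all add: Gv[OF x] r_def field_simps) (simp_all add: gD_def power2_eq_square algebra_simps)
qed

text \<open>The time derivative of the momentum g v along a curve through \<open>x\<close> with
  velocity \<open>v\<close> and coordinate acceleration \<open>a\<close>.\<close>

definition momentum_rate :: "real^2 \<Rightarrow> real^2 \<Rightarrow> real^2 \<Rightarrow> real^2" where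
  "momentum_rate x v a = vector [dg (gE G) x v * v$1 + dg (gF G) x v * v$2 + (gE G x * a$1 + gF G x * a$2),
     dg (gF G) x v * v$1 + dg (gH G) x v * v$2 + (gF G x * a$1 + gH G x * a$2)]"

lemma V_pack: assumes x: "x \<in> S"
  shows "V1 G (pack x (G x *v v)) = v$1" "V2 G (pack x (G x *v v)) = v$2"
    "speed G (pack x (G x *v v)) = sqrt (v \<bullet> (G x *v v))"
proof -
  have D: "gD G x \<noteq> 0" using g_pos[OF x] by simp
  have "gH G x * (gE G x * v$1 + gF G x * v$2) - gF G x * (gF G x * v$1 + gH G x * v$2) = gD G x * v$1"
    "gE G x * (gF G x * v$1 + gH G x * v$2) - gF G x * (gE G x * v$1 + gF G x * v$2) = gD G x * v$2"
    by (simp_all add: gD_def power2_eq_square algebra_simps)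
  then show *: "V1 G (pack x (G x *v v)) = v$1" "V2 G (pack x (G x *v v)) = v$2"
    using D by (simp_all add: V1_def V2_def Gv[OF x])
  then show "speed G (pack x (G x *v v)) = sqrt (v \<bullet> (G x *v v))"
    by (simp add: speed_def inner_vec_def sum_2 mult.commute)
qed

text \<open>Applying the invertible g loses nothing. The derivative of g along \<open>v\<close> in
  the Christoffel term is exactly the part of the momentum rate due to the moving metric, so only
  half of (d_k g)(v, v) survives on the right. Unit speed makes the factors 1/n equal to 1.\<close>

lemma magnetic_iff_magnetic_field:
  assumes x: "x \<in> S" and v: "v \<bullet> (G x *v v) = 1"
  shows "a + christoffel_quad x v = \<mu> *\<^sub>R rot90 (G x) v \<longleftrightarrow> pack v (momentum_rate x v a) = magnetic_field G \<mu> (pack x (G x *v v))"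
proof -
  have v0: "v \<noteq> 0" using v by auto
  have F: "magnetic_field G \<mu> (pack x (G x *v v)) = pack v (vector [dquad G x (axis 1 1) (v$1) (v$2) / 2 - \<mu> * sqrt (gD G x) * v$2,
      dquad G x (axis 2 1) (v$1) (v$2) / 2 + \<mu> * sqrt (gD G x) * v$1])"
    by (simp add: magnetic_field_def V_pack[OF x] v vec_eq_iff forall_4)
  have acc: "momentum_rate x v a $ 1 = (G x *v (a + christoffel_quad x v)) $ 1 + dquad G x (axis 1 1) (v$1) (v$2) / 2"
    "momentum_rate x v a $ 2 = (G x *v (a + christoffel_quad x v)) $ 2 + dquad G x (axis 2 1) (v$1) (v$2) / 2"
    unfolding matrix_vector_right_distrib vector_add_component G_christoffel_quad[OF x] by (simp_all add: momentum_rate_def Gv[OF x])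
  have inj: "a + christoffel_quad x v = \<mu> *\<^sub>R rot90 (G x) v \<longleftrightarrow> G x *v (a + christoffel_quad x v) = G x *v (\<mu> *\<^sub>R rot90 (G x) v)"
    by (rule inj_eq[OF inj_matrix_vector_mult[OF G_invertible[OF x]], symmetric])
  have R: "(G x *v (\<mu> *\<^sub>R rot90 (G x) v)) $ 1 = - \<mu> * sqrt (gD G x) * v$2" "(G x *v (\<mu> *\<^sub>R rot90 (G x) v)) $ 2 = \<mu> * sqrt (gD G x) * v$1"
    by (simp_all add: matrix_vector_mult_scaleR rot90_eq[OF x v0])
  have "pack v (momentum_rate x v a) = magnetic_field G \<mu> (pack x (G x *v v)) \<longleftrightarrow>
     (G x *v (a + christoffel_quad x v)) $ 1 = - \<mu> * sqrt (gD G x) * v$2 \<and> (G x *v (a + christoffel_quad x v)) $ 2 = \<mu> * sqrt (gD G x) * v$1"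
    unfolding F vec_eq_iff forall_4 pack_nth acc by auto
  also have "\<dots> \<longleftrightarrow> G x *v (a + christoffel_quad x v) = G x *v (\<mu> *\<^sub>R rot90 (G x) v)"
    unfolding vec_eq_iff[of "G x *v (a + christoffel_quad x v)"] forall_2 R ..
  finally show ?thesis using inj by simp
qed

lemma momentum_derivative:
  assumes x: "x t \<in> S" "(x has_vector_derivative V t) (at t)" and V: "(V has_vector_derivative a) (at t)"
  shows "((\<lambda>s. pack (x s) (G (x s) *v V s)) has_vector_derivative pack (V t) (momentum_rate (x t) (V t) a)) (at t)"
proof -
  have cx: "isCont x t" using x(2) has_vector_derivative_continuous by blast
  have ev: "\<forall>\<^sub>F s in nhds t. x s \<in> S"
    using cx x(1) S unfolding isCont_def eventually_nhds_conv_at by (auto elim!: topological_tendstoD)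
  have comp: "((\<lambda>s. x s $ i) has_real_derivative V t $ i) (at t)" "((\<lambda>s. V s $ i) has_real_derivative a $ i) (at t)" for i
    using bounded_linear.has_vector_derivative[OF bounded_linear_vec_nth x(2)] bounded_linear.has_vector_derivative[OF bounded_linear_vec_nth V]
    by (simp_all add: has_real_derivative_iff_has_vector_derivative)
  have gx: "((\<lambda>s. f (x s)) has_real_derivative dg f (x t) (V t)) (at t)" if "smooth_on S f" for f
    using vector_derivative_diff_chain_within[of x "V t" t UNIV f, OF x(2) has_derivative_at_withinI[OF dg_has_derivative[OF that x(1)]]]
    by (simp add: has_real_derivative_iff_has_vector_derivative o_def)
  note gxs = gx[OF smooth_g(1)] gx[OF smooth_g(2)] gx[OF smooth_g(3)]
  let ?f = "\<lambda>s. pack (x s) (vector [gE G (x s) * V s $ 1 + gF G (x s) * V s $ 2, gF G (x s) * V s $ 1 + gH G (x s) * V s $ 2])"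
  have "(?f has_vector_derivative pack (V t) (momentum_rate (x t) (V t) a)) (at t)"
    unfolding has_vector_derivative_def
  proof (rule has_derivative_cart)
    have p: "((\<lambda>s. gE G (x s) * V s $ 1 + gF G (x s) * V s $ 2) has_real_derivative momentum_rate (x t) (V t) a $ 1) (at t)"
      "((\<lambda>s. gF G (x s) * V s $ 1 + gH G (x s) * V s $ 2) has_real_derivative momentum_rate (x t) (V t) a $ 2) (at t)"
      by (rule DERIV_cong, (rule derivative_intros gxs comp)+, simp add: momentum_rate_def algebra_simps)+
    fix i :: 4
    have "((\<lambda>s. ?f s $ i) has_real_derivative pack (V t) (momentum_rate (x t) (V t) a) $ i) (at t)"
      using exhaust_4[of i] p comp(1) by auto
    moreover have "(*) (pack (V t) (momentum_rate (x t) (V t) a) $ i) = (\<lambda>h. (h *\<^sub>R pack (V t) (momentum_rate (x t) (V t) a)) $ i)"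
      by (rule ext) simp
    ultimately show "((\<lambda>s. ?f s $ i) has_derivative (\<lambda>h. (h *\<^sub>R pack (V t) (momentum_rate (x t) (V t) a)) $ i)) (at t)"
      unfolding has_field_derivative_def by (simp only:)
  qed
  then show ?thesis
  proof (rule has_vector_derivative_eventually_cong)
    show "\<forall>\<^sub>F s in nhds t. ?f s = pack (x s) (G (x s) *v V s)"
      using ev by eventually_elim (simp add: vec_eq_iff forall_4 Gv)
  qed
qed

end

lemma cov_deriv_eq:
  assumes "metric_chart S G" and "vector_derivative x (at t) = V t"
  shows "cov_deriv G x V t = vector_derivative V (at t) + metric_chart.christoffel_quad G (x t) (V t)"
  by (simp add: cov_deriv_def metric_chart.christoffel_quad_def[OF assms(1)] assms(2) vec_eq_iff)

section \<open>Changes of coordinates\<close>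

locale chart_transition = c: metric_chart S G + d: metric_chart S2 G2
  for S G S2 G2 +
  fixes U :: "(real^2) set" and \<psi> :: "real^2 \<Rightarrow> real^2"
  assumes U: "open U" "U \<subseteq> S" "\<psi> ` U \<subseteq> S2" and smooth_\<psi>: "smooth_on U \<psi>"
    and det_pos: "\<And>x. x \<in> U \<Longrightarrow> 0 < det (jacobian \<psi> (at x))"
    and pull: "\<And>x. x \<in> U \<Longrightarrow> G x = transpose (jacobian \<psi> (at x)) ** G2 (\<psi> x) ** jacobian \<psi> (at x)"
begin

definition j :: "2 \<Rightarrow> 2 \<Rightarrow> real^2 \<Rightarrow> real" where "j a b x = dg (\<lambda>x. \<psi> x $ a) x (axis b 1)"
definition \<Delta> :: "real^2 \<Rightarrow> real" where "\<Delta> x = j 1 1 x * j 2 2 x - j 1 2 x * j 2 1 x"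
text \<open>\<open>q1\<close> and \<open>q2\<close> solve (D\<psi>)^T q = p by Cramer's rule, so
  \<open>colift\<close> is the cotangent lift of \<psi>. Below, \<open>r1\<close> and
  \<open>r2\<close> are the right-hand sides of this system after differentiation in the direction
  \<open>w\<close>.\<close>

definition q1 :: "real^4 \<Rightarrow> real" where "q1 z = (j 2 2 (prX z) * z$3 - j 2 1 (prX z) * z$4) / \<Delta> (prX z)"
definition q2 :: "real^4 \<Rightarrow> real" where "q2 z = (j 1 1 (prX z) * z$4 - j 1 2 (prX z) * z$3) / \<Delta> (prX z)"
definition colift :: "real^4 \<Rightarrow> real^4" where "colift z = pack (\<psi> (prX z)) (vector [q1 z, q2 z])"

definition r1 :: "real^4 \<Rightarrow> real^4 \<Rightarrow> real" where
  "r1 z w = w$3 - (dg (j 1 1) (prX z) (prX w) * q1 z + dg (j 2 1) (prX z) (prX w) * q2 z)"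
definition r2 :: "real^4 \<Rightarrow> real^4 \<Rightarrow> real" where
  "r2 z w = w$4 - (dg (j 1 2) (prX z) (prX w) * q1 z + dg (j 2 2) (prX z) (prX w) * q2 z)"
definition colift_deriv :: "real^4 \<Rightarrow> real^4 \<Rightarrow> real^4" where
  "colift_deriv z w = (let x = prX z; u = prX w in pack
     (vector [dg (\<lambda>x. \<psi> x $ 1) x u, dg (\<lambda>x. \<psi> x $ 2) x u])
     (vector [(j 2 2 x * r1 z w - j 2 1 x * r2 z w) / \<Delta> x, (j 1 1 x * r2 z w - j 1 2 x * r1 z w) / \<Delta> x]))"

lemma smooth_\<psi>_nth: "smooth_on U (\<lambda>x. \<psi> x $ a)"
  by (rule smooth_on_bounded_linear[OF U(1) bounded_linear_vec_nth smooth_\<psi>])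

lemma dgU: "smooth_on U f \<Longrightarrow> x \<in> U \<Longrightarrow> (f has_derivative dg f x) (at x)"
  using smooth_on_has_derivative unfolding dg_def .

lemma smooth_j: "smooth_on U (j a b)"
  unfolding j_def dg_def by (rule smooth_on_frechet[OF smooth_\<psi>_nth])

lemma j_symmetric: "x \<in> U \<Longrightarrow> dg (j a b) x (axis k 1) = dg (j a k) x (axis b 1)"
  unfolding j_def dg_def by (rule smooth_on_second_derivative_symmetric[OF U(1) _ smooth_\<psi>_nth])

lemma \<psi>_derivative: assumes x: "x \<in> U"
  shows "(\<psi> has_derivative (\<lambda>v. vector [dg (\<lambda>x. \<psi> x $ 1) x v, dg (\<lambda>x. \<psi> x $ 2) x v])) (at x)"
proof (rule has_derivative_cart)
  fix i :: 2
  show "((\<lambda>x. \<psi> x $ i) has_derivative (\<lambda>v. (vector [dg (\<lambda>x. \<psi> x $ 1) x v, dg (\<lambda>x. \<psi> x $ 2) x v] :: real^2) $ i)) (at x)"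
    using dgU[OF smooth_\<psi>_nth x, of 1] dgU[OF smooth_\<psi>_nth x, of 2] exhaust_2[of i] by auto
qed

lemma jacobian_nth: assumes x: "x \<in> U" shows "jacobian \<psi> (at x) $ a $ b = j a b x"
proof -
  have "frechet_derivative \<psi> (at x) = (\<lambda>v. vector [dg (\<lambda>x. \<psi> x $ 1) x v, dg (\<lambda>x. \<psi> x $ 2) x v])"
    using frechet_derivative_at[OF \<psi>_derivative[OF x]] by simp
  then show ?thesis using exhaust_2[of a] by (auto simp: jacobian_def matrix_def j_def)
qed

lemma \<Delta>_pos: "x \<in> U \<Longrightarrow> 0 < \<Delta> x"
  using det_pos[of x] by (simp add: det_2 jacobian_nth \<Delta>_def)

lemma g_pull: assumes x: "x \<in> U"
  shows "gE G x = gE G2 (\<psi> x) * (j 1 1 x)\<^sup>2 + 2 * gF G2 (\<psi> x) * j 1 1 x * j 2 1 x + gH G2 (\<psi> x) * (j 2 1 x)\<^sup>2"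
    "gF G x = gE G2 (\<psi> x) * j 1 1 x * j 1 2 x + gF G2 (\<psi> x) * (j 1 1 x * j 2 2 x + j 1 2 x * j 2 1 x) + gH G2 (\<psi> x) * j 2 1 x * j 2 2 x"
    "gH G x = gE G2 (\<psi> x) * (j 1 2 x)\<^sup>2 + 2 * gF G2 (\<psi> x) * j 1 2 x * j 2 2 x + gH G2 (\<psi> x) * (j 2 2 x)\<^sup>2"
proof -
  have \<psi>x: "\<psi> x \<in> S2" using x U by auto
  have *: "G x $ a $ b = (\<Sum>k\<in>UNIV. (\<Sum>l\<in>UNIV. j l a x * G2 (\<psi> x) $ l $ k) * j k b x)" for a b
    by (subst pull[OF x]) (simp add: matrix_matrix_mult_def transpose_def jacobian_nth[OF x])
  show "gE G x = gE G2 (\<psi> x) * (j 1 1 x)\<^sup>2 + 2 * gF G2 (\<psi> x) * j 1 1 x * j 2 1 x + gH G2 (\<psi> x) * (j 2 1 x)\<^sup>2"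
    "gF G x = gE G2 (\<psi> x) * j 1 1 x * j 1 2 x + gF G2 (\<psi> x) * (j 1 1 x * j 2 2 x + j 1 2 x * j 2 1 x) + gH G2 (\<psi> x) * j 2 1 x * j 2 2 x"
    "gH G x = gE G2 (\<psi> x) * (j 1 2 x)\<^sup>2 + 2 * gF G2 (\<psi> x) * j 1 2 x * j 2 2 x + gH G2 (\<psi> x) * (j 2 2 x)\<^sup>2"
    unfolding gE_def[of G] gF_def[of G] gH_def[of G] * sum_2 d.G_eq[OF \<psi>x]
    by (simp_all add: gE_def gF_def gH_def power2_eq_square algebra_simps)
qed

lemma gD_pull: "x \<in> U \<Longrightarrow> gD G x = (\<Delta> x)\<^sup>2 * gD G2 (\<psi> x)"
  unfolding gD_def by (simp add: g_pull \<Delta>_def power2_eq_square algebra_simps)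

text \<open>Here the orientation matters: with \<Delta> > 0 the area density transforms without an
  absolute value, so the magnetic term keeps its sign in every chart.\<close>

lemma sqrt_gD_pull: "x \<in> U \<Longrightarrow> sqrt (gD G x) = \<Delta> x * sqrt (gD G2 (\<psi> x))"
  using \<Delta>_pos[of x] by (simp add: gD_pull real_sqrt_mult)

lemma prX_colift [simp]: "prX (colift z) = \<psi> (prX z)" and colift_nth [simp]: "colift z $ 3 = q1 z" "colift z $ 4 = q2 z"
  by (simp_all add: colift_def)

lemma q_eq: assumes x: "prX z \<in> U"
  shows "j 1 1 (prX z) * q1 z + j 2 1 (prX z) * q2 z = z$3" "j 1 2 (prX z) * q1 z + j 2 2 (prX z) * q2 z = z$4"
proof -
  let ?x = "prX z"
  have "j 1 1 ?x * (j 2 2 ?x * z$3 - j 2 1 ?x * z$4) + j 2 1 ?x * (j 1 1 ?x * z$4 - j 1 2 ?x * z$3) = \<Delta> ?x * z$3"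
    "j 1 2 ?x * (j 2 2 ?x * z$3 - j 2 1 ?x * z$4) + j 2 2 ?x * (j 1 1 ?x * z$4 - j 1 2 ?x * z$3) = \<Delta> ?x * z$4"
    by (simp_all add: \<Delta>_def algebra_simps)
  note * = this
  show "j 1 1 ?x * q1 z + j 2 1 ?x * q2 z = z$3" "j 1 2 ?x * q1 z + j 2 2 ?x * q2 z = z$4"
    unfolding q1_def q2_def times_divide_eq_right add_divide_distrib[symmetric] * using \<Delta>_pos[OF x] by simp_all
qed

lemma cramer:
  fixes a b :: real
  assumes "x \<in> U" "j 1 1 x * a + j 2 1 x * b = r" "j 1 2 x * a + j 2 2 x * b = s"
  shows "(j 2 2 x * r - j 2 1 x * s) / \<Delta> x = a" "(j 1 1 x * s - j 1 2 x * r) / \<Delta> x = b"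
proof -
  have "j 2 2 x * r - j 2 1 x * s = \<Delta> x * a" "j 1 1 x * s - j 1 2 x * r = \<Delta> x * b"
    unfolding assms(2,3)[symmetric] by (simp_all add: \<Delta>_def algebra_simps)
  then show "(j 2 2 x * r - j 2 1 x * s) / \<Delta> x = a" "(j 1 1 x * s - j 1 2 x * r) / \<Delta> x = b"
    using \<Delta>_pos[OF assms(1)] by simp_all
qed

text \<open>Velocities transform by D\<psi>. Since g is the pullback of g2, the momentum g2 (D\<psi>
  v) satisfies the linear system that defines q, and that system has only one solution.\<close>

lemma V_colift: assumes x: "prX z \<in> U"
  shows "V1 G2 (colift z) = j 1 1 (prX z) * V1 G z + j 1 2 (prX z) * V2 G z"
    "V2 G2 (colift z) = j 2 1 (prX z) * V1 G z + j 2 2 (prX z) * V2 G z"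
    "q1 z = gE G2 (\<psi> (prX z)) * V1 G2 (colift z) + gF G2 (\<psi> (prX z)) * V2 G2 (colift z)"
    "q2 z = gF G2 (\<psi> (prX z)) * V1 G2 (colift z) + gH G2 (\<psi> (prX z)) * V2 G2 (colift z)"
proof -
  let ?x = "prX z" and ?e = "gE G2 (\<psi> (prX z))" and ?f = "gF G2 (\<psi> (prX z))" and ?h = "gH G2 (\<psi> (prX z))"
  let ?u1 = "j 1 1 ?x * V1 G z + j 1 2 ?x * V2 G z" and ?u2 = "j 2 1 ?x * V1 G z + j 2 2 ?x * V2 G z"
  have xS: "?x \<in> S" and \<psi>x: "\<psi> ?x \<in> S2" using x U by auto
  have "j 1 1 ?x * (?e * ?u1 + ?f * ?u2) + j 2 1 ?x * (?f * ?u1 + ?h * ?u2) = z$3"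
    "j 1 2 ?x * (?e * ?u1 + ?f * ?u2) + j 2 2 ?x * (?f * ?u1 + ?h * ?u2) = z$4"
    unfolding c.V_eq[OF xS, symmetric] g_pull[OF x] by (simp_all add: power2_eq_square algebra_simps)
  from cramer[OF x this] have q: "q1 z = ?e * ?u1 + ?f * ?u2" "q2 z = ?f * ?u1 + ?h * ?u2"
    by (simp_all add: q1_def q2_def)
  have D: "gD G2 (\<psi> ?x) \<noteq> 0" using d.g_pos[OF \<psi>x] by simp
  have "?h * q1 z - ?f * q2 z = gD G2 (\<psi> ?x) * ?u1" "?e * q2 z - ?f * q1 z = gD G2 (\<psi> ?x) * ?u2"
    unfolding q by (simp_all add: gD_def power2_eq_square algebra_simps)
  then show v: "V1 G2 (colift z) = ?u1" "V2 G2 (colift z) = ?u2" using D by (simp_all add: V1_def V2_def)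
  show "q1 z = ?e * V1 G2 (colift z) + ?f * V2 G2 (colift z)" "q2 z = ?f * V1 G2 (colift z) + ?h * V2 G2 (colift z)"
    unfolding v by (rule q)+
qed

lemma speed_colift: assumes x: "prX z \<in> U" shows "speed G2 (colift z) = speed G z"
proof -
  have "q1 z * V1 G2 (colift z) + q2 z * V2 G2 (colift z) = z$3 * V1 G z + z$4 * V2 G z"
    unfolding V_colift(1,2)[OF x] q_eq[OF x, symmetric] by (simp add: algebra_simps)
  then show ?thesis by (simp add: speed_def)
qed

lemma prX_derivativeU:
  assumes "smooth_on U f" "prX z \<in> U"
  shows "((\<lambda>z. f (prX z)) has_derivative (\<lambda>w. dg f (prX z) (prX w))) (at z)"
  by (rule has_derivative_compose[OF bounded_linear_imp_has_derivative[OF bounded_linear_prX] dgU[OF assms]])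

lemma colift_derivative:
  assumes x: "prX z \<in> U" shows "(colift has_derivative colift_deriv z) (at z)"
proof (rule has_derivative_cart)
  let ?x = "prX z"
  note d = prX_derivativeU[OF smooth_j x] c.nth_derivative
  have D: "\<Delta> ?x \<noteq> 0" using \<Delta>_pos[OF x] by simp
  let ?d\<Delta> = "\<lambda>w. dg (j 1 1) ?x (prX w) * j 2 2 ?x + j 1 1 ?x * dg (j 2 2) ?x (prX w)
     - (dg (j 1 2) ?x (prX w) * j 2 1 ?x + j 1 2 ?x * dg (j 2 1) ?x (prX w))"
  have d\<Delta>: "((\<lambda>z. \<Delta> (prX z)) has_derivative ?d\<Delta>) (at z)"
    unfolding \<Delta>_def by (rule has_derivative_eq_rhs, (rule derivative_intros d)+) (simp add: fun_eq_iff algebra_simps)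
  have quot: "((\<lambda>z. N z / \<Delta> (prX z)) has_derivative (\<lambda>w. (N' w - N z / \<Delta> ?x * ?d\<Delta> w) / \<Delta> ?x)) (at z)"
    if "(N has_derivative N') (at z)" for N N'
    by (rule has_derivative_eq_rhs, rule has_derivative_divide[OF that d\<Delta> D]) (use D in \<open>simp add: fun_eq_iff field_simps\<close>)
  have k1: "((j22 * z$3 + j 2 2 ?x * w3) - (j21 * z$4 + j 2 1 ?x * w4)) - q1 z * (j11 * j 2 2 ?x + j 1 1 ?x * j22 - (j12 * j 2 1 ?x + j 1 2 ?x * j21))
     = j 2 2 ?x * (w3 - (j11 * q1 z + j21 * q2 z)) - j 2 1 ?x * (w4 - (j12 * q1 z + j22 * q2 z))" for j11 j12 j21 j22 w3 w4
    unfolding q_eq[OF x, symmetric] by (simp add: algebra_simps)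
  have k2: "((j11 * z$4 + j 1 1 ?x * w4) - (j12 * z$3 + j 1 2 ?x * w3)) - q2 z * (j11 * j 2 2 ?x + j 1 1 ?x * j22 - (j12 * j 2 1 ?x + j 1 2 ?x * j21))
     = j 1 1 ?x * (w4 - (j12 * q1 z + j22 * q2 z)) - j 1 2 ?x * (w3 - (j11 * q1 z + j21 * q2 z))" for j11 j12 j21 j22 w3 w4
    unfolding q_eq[OF x, symmetric] by (simp add: algebra_simps)
  have "(q1 has_derivative (\<lambda>w. (((dg (j 2 2) ?x (prX w) * z$3 + j 2 2 ?x * w$3) - (dg (j 2 1) ?x (prX w) * z$4 + j 2 1 ?x * w$4))
      - q1 z * ?d\<Delta> w) / \<Delta> ?x)) (at z)"
    unfolding q1_def[abs_def]
    by (rule quot) (rule has_derivative_eq_rhs, (rule derivative_intros d)+, auto simp: fun_eq_iff)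
  then have d1: "(q1 has_derivative (\<lambda>w. (j 2 2 ?x * r1 z w - j 2 1 ?x * r2 z w) / \<Delta> ?x)) (at z)"
    by (rule has_derivative_eq_rhs) (simp add: fun_eq_iff r1_def r2_def k1)
  have "(q2 has_derivative (\<lambda>w. (((dg (j 1 1) ?x (prX w) * z$4 + j 1 1 ?x * w$4) - (dg (j 1 2) ?x (prX w) * z$3 + j 1 2 ?x * w$3))
      - q2 z * ?d\<Delta> w) / \<Delta> ?x)) (at z)"
    unfolding q2_def[abs_def]
    by (rule quot) (rule has_derivative_eq_rhs, (rule derivative_intros d)+, auto simp: fun_eq_iff)
  then have d2: "(q2 has_derivative (\<lambda>w. (j 1 1 ?x * r2 z w - j 1 2 ?x * r1 z w) / \<Delta> ?x)) (at z)"
    by (rule has_derivative_eq_rhs) (simp add: fun_eq_iff r1_def r2_def k2)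
  fix i :: 4
  consider "i = 1" | "i = 2" | "i = 3" | "i = 4" using exhaust_4 by blast
  then show "((\<lambda>z. colift z $ i) has_derivative (\<lambda>w. colift_deriv z w $ i)) (at z)"
    using prX_derivativeU[OF smooth_\<psi>_nth x] d1 d2 by cases (simp_all add: colift_def colift_deriv_def Let_def)
qed

lemma dgU_linear: "smooth_on U f \<Longrightarrow> x \<in> U \<Longrightarrow> linear (dg f x)"
  using dgU has_derivative_linear by blast

lemma dgU_vector:
  assumes f: "smooth_on U f" "x \<in> U"
  shows "dg f x (vector [a, b]) = a * dg f x (axis 1 1) + b * dg f x (axis 2 1)"
proof -
  have "(vector [a, b] :: real^2) = a *\<^sub>R axis 1 1 + b *\<^sub>R axis 2 1"
    by (simp add: vec_eq_iff forall_2 axis_def)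
  then show ?thesis using dgU_linear[OF f] by (simp add: linear_add linear_scale)
qed

text \<open>The diagonal blocks are D\<psi> and the inverse transpose of D\<psi>, whose determinants
  are reciprocal.\<close>

lemma colift_deriv_det: assumes x: "prX z \<in> U" shows "det (matrix (colift_deriv z)) = 1"
proof -
  let ?x = "prX z"
  have pX: "prX (axis 1 1) = axis 1 1" "prX (axis 2 1) = axis 2 1" "prX (axis 3 1) = 0" "prX (axis 4 1) = 0"
    by (simp_all add: vec_eq_iff forall_2 axis_def)
  have ax: "(axis k 1 :: real^4) $ l = (if l = k then 1 else 0)" for k l by (simp add: axis_def)
  have z0: "dg (j a b) ?x 0 = 0" "dg (\<lambda>x. \<psi> x $ a) ?x 0 = 0" for a b
    using dgU_linear[OF smooth_j x] dgU_linear[OF smooth_\<psi>_nth x] linear_0 by blast+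
  have m: "matrix (colift_deriv z) $ k $ l = colift_deriv z (axis l 1) $ k" for k l by (simp add: matrix_def)
  have D: "\<Delta> ?x \<noteq> 0" using \<Delta>_pos[OF x] by simp
  have "det (matrix (colift_deriv z)) = (j 1 1 ?x * j 2 2 ?x - j 1 2 ?x * j 2 1 ?x)
      * (j 2 2 ?x / \<Delta> ?x * (j 1 1 ?x / \<Delta> ?x) - (- j 2 1 ?x / \<Delta> ?x) * (- j 1 2 ?x / \<Delta> ?x))"
    by (subst det_4_block) (simp_all add: m colift_deriv_def Let_def pX z0 r1_def r2_def ax j_def)
  also have "\<dots> = \<Delta> ?x * ((j 2 2 ?x * j 1 1 ?x - j 2 1 ?x * j 1 2 ?x) / (\<Delta> ?x * \<Delta> ?x))"
    by (simp add: \<Delta>_def diff_divide_distrib)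
  also have "j 2 2 ?x * j 1 1 ?x - j 2 1 ?x * j 1 2 ?x = \<Delta> ?x" by (simp add: \<Delta>_def)
  finally show ?thesis using D by simp
qed

text \<open>The pullback identity g(w, w) = g2(D\<psi> w, D\<psi> w) with constant w = (a, b) is
  differentiated in the base point. Derivatives are unique, so both sides may be compared; the last
  two lines are the terms with second derivatives of \<psi>.\<close>

lemma dquad_pull:
  assumes x: "x \<in> U"
  shows "dquad G x (axis k 1) a b = j 1 k x * dquad G2 (\<psi> x) (axis 1 1) (j 1 1 x * a + j 1 2 x * b) (j 2 1 x * a + j 2 2 x * b)
     + j 2 k x * dquad G2 (\<psi> x) (axis 2 1) (j 1 1 x * a + j 1 2 x * b) (j 2 1 x * a + j 2 2 x * b)
     + 2 * (gE G2 (\<psi> x) * (j 1 1 x * a + j 1 2 x * b) + gF G2 (\<psi> x) * (j 2 1 x * a + j 2 2 x * b)) * (dg (j 1 1) x (axis k 1) * a + dg (j 1 2) x (axis k 1) * b)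
     + 2 * (gF G2 (\<psi> x) * (j 1 1 x * a + j 1 2 x * b) + gH G2 (\<psi> x) * (j 2 1 x * a + j 2 2 x * b)) * (dg (j 2 1) x (axis k 1) * a + dg (j 2 2) x (axis k 1) * b)"
proof -
  have xS: "x \<in> S" and \<psi>x: "\<psi> x \<in> S2" using x U by auto
  let ?u1 = "\<lambda>x. j 1 1 x * a + j 1 2 x * b" and ?u2 = "\<lambda>x. j 2 1 x * a + j 2 2 x * b"
  have l: "((\<lambda>y. quad (gE G y) (gF G y) (gH G y) a b) has_derivative (\<lambda>v. dquad G x v a b)) (at x)"
    unfolding quad_def dquad_def
    by (rule has_derivative_eq_rhs, (rule derivative_intros c.dg_has_derivative[OF c.smooth_g(1) xS]
       c.dg_has_derivative[OF c.smooth_g(2) xS] c.dg_has_derivative[OF c.smooth_g(3) xS])+) (simp add: fun_eq_iff)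
  have comp: "((\<lambda>y. f (\<psi> y)) has_derivative (\<lambda>v. dg f (\<psi> x) (vector [dg (\<lambda>x. \<psi> x $ 1) x v, dg (\<lambda>x. \<psi> x $ 2) x v]))) (at x)"
    if "smooth_on S2 f" for f
    by (rule has_derivative_compose[OF \<psi>_derivative[OF x] d.dg_has_derivative[OF that \<psi>x]])
  let ?w = "\<lambda>v. vector [dg (\<lambda>x. \<psi> x $ 1) x v, dg (\<lambda>x. \<psi> x $ 2) x v]"
  have r: "((\<lambda>y. quad (gE G2 (\<psi> y)) (gF G2 (\<psi> y)) (gH G2 (\<psi> y)) (?u1 y) (?u2 y)) has_derivative
     (\<lambda>v. dquad G2 (\<psi> x) (?w v) (?u1 x) (?u2 x)
       + 2 * (gE G2 (\<psi> x) * ?u1 x + gF G2 (\<psi> x) * ?u2 x) * (dg (j 1 1) x v * a + dg (j 1 2) x v * b)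
       + 2 * (gF G2 (\<psi> x) * ?u1 x + gH G2 (\<psi> x) * ?u2 x) * (dg (j 2 1) x v * a + dg (j 2 2) x v * b))) (at x)"
    unfolding quad_def dquad_def power2_eq_square
    by (rule has_derivative_eq_rhs, (rule derivative_intros comp[OF d.smooth_g(1)] comp[OF d.smooth_g(2)] comp[OF d.smooth_g(3)]
        dgU[OF smooth_j x])+) (simp add: fun_eq_iff algebra_simps)
  have eq: "quad (gE G y) (gF G y) (gH G y) a b = quad (gE G2 (\<psi> y)) (gF G2 (\<psi> y)) (gH G2 (\<psi> y)) (?u1 y) (?u2 y)" if "y \<in> U" for y
    unfolding g_pull[OF that] quad_def by (simp add: power2_eq_square algebra_simps)
  have "(\<lambda>v. dquad G x v a b) = (\<lambda>v. dquad G2 (\<psi> x) (?w v) (?u1 x) (?u2 x)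
       + 2 * (gE G2 (\<psi> x) * ?u1 x + gF G2 (\<psi> x) * ?u2 x) * (dg (j 1 1) x v * a + dg (j 1 2) x v * b)
       + 2 * (gF G2 (\<psi> x) * ?u1 x + gH G2 (\<psi> x) * ?u2 x) * (dg (j 2 1) x v * a + dg (j 2 2) x v * b))"
    by (rule has_derivative_unique[OF l has_derivative_transform_within_open[OF r U(1) x]]) (simp add: eq)
  from fun_cong[OF this, of "axis k 1"]
  have main: "dquad G x (axis k 1) a b = dquad G2 (\<psi> x) (vector [j 1 k x, j 2 k x]) (?u1 x) (?u2 x)
       + 2 * (gE G2 (\<psi> x) * ?u1 x + gF G2 (\<psi> x) * ?u2 x) * (dg (j 1 1) x (axis k 1) * a + dg (j 1 2) x (axis k 1) * b)
       + 2 * (gF G2 (\<psi> x) * ?u1 x + gH G2 (\<psi> x) * ?u2 x) * (dg (j 2 1) x (axis k 1) * a + dg (j 2 2) x (axis k 1) * b)"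
    unfolding j_def[symmetric] .
  have "dquad G2 (\<psi> x) (vector [s, t]) u v = s * dquad G2 (\<psi> x) (axis 1 1) u v + t * dquad G2 (\<psi> x) (axis 2 1) u v" for s t u v
    unfolding dquad_def quad_def d.dg_vector[OF d.smooth_g(1) \<psi>x] d.dg_vector[OF d.smooth_g(2) \<psi>x] d.dg_vector[OF d.smooth_g(3) \<psi>x]
    by (simp add: algebra_simps)
  then show ?thesis using main by simp
qed

text \<open>Second derivatives of \<psi> enter twice, through the pulled back force and through the
  changing matrix D\<psi> in \<open>r1\<close> and \<open>r2\<close>. They cancel because mixed
  partial derivatives commute; the rest is the linear system for the momentum part, solved by
  \<open>cramer\<close>.\<close>

lemma colift_deriv_magnetic_field:
  assumes z: "z \<in> c.Om" and x: "prX z \<in> U"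
  shows "colift_deriv z (magnetic_field G \<mu> z) = magnetic_field G2 \<mu> (colift z)"
proof -
  let ?x = "prX z" and ?n = "speed G z"
  have n: "?n \<noteq> 0" using c.speed_pos(1)[OF z] by simp
  note V = V_colift[OF x]
  let ?X1 = "magnetic_field G2 \<mu> (colift z) $ 3" and ?X2 = "magnetic_field G2 \<mu> (colift z) $ 4"
  let ?Q = "\<lambda>k. dquad G2 (\<psi> ?x) (axis k 1) (V1 G2 (colift z)) (V2 G2 (colift z))"
  have pF: "prX (magnetic_field G \<mu> z) = vector [V1 G z / ?n, V2 G z / ?n]" by (simp add: magnetic_field_def)
  have X: "?X1 = ?Q 1 / (2 * ?n) - \<mu> * sqrt (gD G2 (\<psi> ?x)) * V2 G2 (colift z)"
    "?X2 = ?Q 2 / (2 * ?n) + \<mu> * sqrt (gD G2 (\<psi> ?x)) * V1 G2 (colift z)"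
    by (simp_all add: magnetic_field_def speed_colift[OF x])
  have Qk: "dquad G ?x (axis k 1) (V1 G z) (V2 G z) = j 1 k ?x * ?Q 1 + j 2 k ?x * ?Q 2
      + 2 * q1 z * (dg (j 1 1) ?x (axis k 1) * V1 G z + dg (j 1 2) ?x (axis k 1) * V2 G z)
      + 2 * q2 z * (dg (j 2 1) ?x (axis k 1) * V1 G z + dg (j 2 2) ?x (axis k 1) * V2 G z)" for k
    unfolding dquad_pull[OF x] V(3,4) V(1,2) ..
  have dj: "dg (j a b) ?x (prX (magnetic_field G \<mu> z)) = (dg (j a b) ?x (axis 1 1) * V1 G z + dg (j a b) ?x (axis 2 1) * V2 G z) / ?n" for a b
    unfolding pF dgU_vector[OF smooth_j x] by (simp add: add_divide_distrib mult.commute)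
  have sy: "dg (j a 2) ?x (axis 1 1) = dg (j a 1) ?x (axis 2 1)" for a
    by (rule j_symmetric[OF x])
  \<comment> \<open>This is the cancellation of the second derivatives: \<open>c\<close> and
    \<open>d\<close> stand for the second derivatives of \<psi> applied to the velocity,
    \<open>s\<close> and \<open>t\<close> for the new momenta.\<close>
  have half: "(A + B + 2 * s * c + 2 * t * d) / (2 * ?n) - (c / ?n * s + d / ?n * t) = (A + B) / (2 * ?n)" for A B c d s t
    using n by (simp add: field_simps)
  have R1: "r1 z (magnetic_field G \<mu> z) = (j 1 1 ?x * ?Q 1 + j 2 1 ?x * ?Q 2) / (2 * ?n) - \<mu> * sqrt (gD G ?x) * V2 G z"
  proof -
    have "r1 z (magnetic_field G \<mu> z) = dquad G ?x (axis 1 1) (V1 G z) (V2 G z) / (2 * ?n) - \<mu> * sqrt (gD G ?x) * V2 G z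
      - (dg (j 1 1) ?x (prX (magnetic_field G \<mu> z)) * q1 z + dg (j 2 1) ?x (prX (magnetic_field G \<mu> z)) * q2 z)"
      unfolding r1_def by (simp add: magnetic_field_def)
    then show ?thesis unfolding Qk dj sy
      using half[of "j 1 1 ?x * ?Q 1" "j 2 1 ?x * ?Q 2" "q1 z" "dg (j 1 1) ?x (axis 1 1) * V1 G z + dg (j 1 1) ?x (axis 2 1) * V2 G z" "q2 z" "dg (j 2 1) ?x (axis 1 1) * V1 G z + dg (j 2 1) ?x (axis 2 1) * V2 G z"] by linarith
  qed
  have R2: "r2 z (magnetic_field G \<mu> z) = (j 1 2 ?x * ?Q 1 + j 2 2 ?x * ?Q 2) / (2 * ?n) + \<mu> * sqrt (gD G ?x) * V1 G z"
  proof -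
    have "r2 z (magnetic_field G \<mu> z) = dquad G ?x (axis 2 1) (V1 G z) (V2 G z) / (2 * ?n) + \<mu> * sqrt (gD G ?x) * V1 G z
      - (dg (j 1 2) ?x (prX (magnetic_field G \<mu> z)) * q1 z + dg (j 2 2) ?x (prX (magnetic_field G \<mu> z)) * q2 z)"
      unfolding r2_def by (simp add: magnetic_field_def)
    then show ?thesis unfolding Qk dj sy
      using half[of "j 1 2 ?x * ?Q 1" "j 2 2 ?x * ?Q 2" "q1 z" "dg (j 1 1) ?x (axis 2 1) * V1 G z + dg (j 1 2) ?x (axis 2 1) * V2 G z" "q2 z" "dg (j 2 1) ?x (axis 2 1) * V1 G z + dg (j 2 2) ?x (axis 2 1) * V2 G z"] by linarith
  qed
  have "j 1 1 ?x * ?X1 + j 2 1 ?x * ?X2 = r1 z (magnetic_field G \<mu> z)" "j 1 2 ?x * ?X1 + j 2 2 ?x * ?X2 = r2 z (magnetic_field G \<mu> z)"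
    unfolding R1 R2 X V(1,2) sqrt_gD_pull[OF x] using n by (simp_all add: \<Delta>_def field_simps)
  note X' = cramer[OF x this]
  have v: "dg (\<lambda>x. \<psi> x $ a) ?x (prX (magnetic_field G \<mu> z)) = (j a 1 ?x * V1 G z + j a 2 ?x * V2 G z) / ?n" for a
    unfolding pF dgU_vector[OF smooth_\<psi>_nth x] j_def by (simp add: add_divide_distrib mult.commute)
  have "colift_deriv z (magnetic_field G \<mu> z) $ i = magnetic_field G2 \<mu> (colift z) $ i" for i
    using exhaust_4[of i] X' by (auto simp: colift_deriv_def Let_def v) (simp_all add: magnetic_field_def speed_colift[OF x] V(1,2))
  then show ?thesis by (simp add: vec_eq_iff)
qed

end

section \<open>The magnetic flow of a surface\<close>

locale rsurface =
  fixes M :: "'a topology" and A :: "'a chart set" and g :: "'a chart \<Rightarrow> real^2 \<Rightarrow> real^2^2" and \<mu> :: real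
  assumes orm: "oriented_riemannian_surface M A g" and comp: "compact_space M"
begin

definition img :: "'a chart \<Rightarrow> (real^2) set" where "img c = snd c ` fst c"
definition overlap :: "'a chart \<Rightarrow> 'a chart \<Rightarrow> (real^2) set" where "overlap c d = snd c ` (fst c \<inter> fst d)"
definition J :: "'a chart \<Rightarrow> 'a chart \<Rightarrow> real^2 \<Rightarrow> real^2^2" where "J c d x = jacobian (transition c d) (at x)"

section \<open>Charts, transition maps and their Jacobians\<close>

lemma Haus_M: "Hausdorff_space M" and atlas: "oriented_smooth_atlas M A" and metric: "riemannian_metric A g"
  using orm by (auto simp: oriented_riemannian_surface_def)

lemma A_cover: "(\<Union>c\<in>A. fst c) = topspace M"
  using atlas by (simp add: oriented_smooth_atlas_def)

lemma chart_exists: "p \<in> topspace M \<Longrightarrow> \<exists>c\<in>A. p \<in> fst c"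
  using A_cover by blast

lemma chartD:
  assumes "c \<in> A"
  shows "openin M (fst c)" "open (img c)"
    "homeomorphic_map (subtopology M (fst c)) (top_of_set (img c)) (snd c)"
  using atlas assms by (auto simp: oriented_smooth_atlas_def is_chart_def img_def)

lemma topspace_sub_chart: "c \<in> A \<Longrightarrow> topspace (subtopology M (fst c)) = fst c"
  using openin_subset[OF chartD(1)] by (simp add: Int_absorb1)

lemma chart_inj: "c \<in> A \<Longrightarrow> inj_on (snd c) (fst c)"
  using homeomorphic_imp_injective_map[OF chartD(3)] topspace_sub_chart by metis

lemma chart_inv: "c \<in> A \<Longrightarrow> p \<in> fst c \<Longrightarrow> inv_into (fst c) (snd c) (snd c p) = p"
  by (simp add: chart_inj inv_into_f_f)

lemma chart_image_open:
  assumes c: "c \<in> A" and V: "openin M V" shows "open (snd c ` (V \<inter> fst c))"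
proof -
  have "openin (subtopology M (fst c)) (V \<inter> fst c)" using V by (auto simp: openin_subtopology)
  then have "openin (top_of_set (img c)) (snd c ` (V \<inter> fst c))"
    using homeomorphic_imp_open_map[OF chartD(3)[OF c]] by (simp add: open_map_def)
  then show ?thesis using openin_open_eq[OF chartD(2)[OF c]] by blast
qed

lemma chart_vimage_open:
  assumes c: "c \<in> A" and O': "open O'" shows "openin M {p \<in> fst c. snd c p \<in> O'}"
proof -
  have "continuous_map (subtopology M (fst c)) euclidean (snd c)"
    using homeomorphic_imp_continuous_map[OF chartD(3)[OF c]] by (simp add: continuous_map_in_subtopology)
  from openin_continuous_map_preimage[OF this, of O']
  have "openin (subtopology M (fst c)) {p \<in> topspace (subtopology M (fst c)). snd c p \<in> O'}"
    using O' by (simp only: open_openin)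
  then have "openin (subtopology M (fst c)) {p \<in> fst c. snd c p \<in> O'}" by (simp only: topspace_sub_chart[OF c])
  then show ?thesis using openin_open_subtopology[OF chartD(1)[OF c]] by blast
qed

lemma overlap_open: "c \<in> A \<Longrightarrow> d \<in> A \<Longrightarrow> open (overlap c d)"
  using chart_image_open[of c "fst d"] chartD(1)[of d] by (simp add: overlap_def Int_commute)

lemma transition_eq: "c \<in> A \<Longrightarrow> p \<in> fst c \<Longrightarrow> transition c d (snd c p) = snd d p"
  by (simp add: transition_def chart_inv)

lemma metric_chart: "c \<in> A \<Longrightarrow> metric_chart (img c) (g c)"
  using metric chartD(2) by unfold_locales (auto simp: riemannian_metric_def img_def)

lemma chart_transition:
  assumes c: "c \<in> A" and d: "d \<in> A"
  shows "chart_transition (img c) (g c) (img d) (g d) (overlap c d) (transition c d)"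
proof (intro chart_transition.intro metric_chart c d chart_transition_axioms.intro)
  show "open (overlap c d)" by (rule overlap_open[OF c d])
  show "overlap c d \<subseteq> img c" by (auto simp: overlap_def img_def)
  show "transition c d ` overlap c d \<subseteq> img d" using transition_eq[OF c, of _ d] by (auto simp: overlap_def img_def)
  show "smooth_on (overlap c d) (transition c d)" using atlas c d by (simp add: oriented_smooth_atlas_def overlap_def)
  fix x assume x: "x \<in> overlap c d"
  show "0 < det (jacobian (transition c d) (at x))" using atlas c d x unfolding oriented_smooth_atlas_def overlap_def by blast
  show "g c x = transpose (jacobian (transition c d) (at x)) ** g d (transition c d x) ** jacobian (transition c d) (at x)"
    using metric c d x unfolding riemannian_metric_def overlap_def by blast
qed

lemma transition_derivative:
  assumes c: "c \<in> A" and d: "d \<in> A" and x: "x \<in> overlap c d"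
  shows "(transition c d has_derivative (*v) (J c d x)) (at x)"
proof -
  interpret chart_transition "img c" "g c" "img d" "g d" "overlap c d" "transition c d" by (rule chart_transition[OF c d])
  have "(transition c d has_derivative frechet_derivative (transition c d) (at x)) (at x)"
    by (rule smooth_on_has_derivative[OF smooth_\<psi> x])
  then show ?thesis unfolding J_def jacobian_def
    by (simp add: matrix_works has_derivative_linear)
qed

lemma J_eqI:
  assumes "(transition c d has_derivative (*v) B) (at x)" shows "J c d x = B"
  using frechet_derivative_at[OF assms] matrix_of_matrix_vector_mul[of B] by (simp add: J_def jacobian_def)

lemma J_self: assumes c: "c \<in> A" and p: "p \<in> fst c" shows "J c c (snd c p) = mat 1"
proof (rule J_eqI)
  have "((\<lambda>x. x) has_derivative (*v) (mat 1)) (at (snd c p))" by (simp add: matrix_vector_mul_lid[abs_def])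
  then show "(transition c c has_derivative (*v) (mat 1)) (at (snd c p))"
    by (rule has_derivative_transform_within_open[OF _ chartD(2)[OF c]])
      (use p transition_eq[OF c, of _ c] in \<open>auto simp: img_def\<close>)
qed

text \<open>The chain rule on the open set where all three charts are defined; uniqueness of the
  derivative identifies the Jacobians.\<close>

lemma J_cocycle:
  assumes c: "c \<in> A" and d: "d \<in> A" and e: "e \<in> A" and p: "p \<in> fst c" "p \<in> fst d" "p \<in> fst e"
  shows "J c e (snd c p) = J d e (snd d p) ** J c d (snd c p)"
proof (rule J_eqI)
  have 1: "(transition c d has_derivative (*v) (J c d (snd c p))) (at (snd c p))"
    by (rule transition_derivative[OF c d]) (use p in \<open>auto simp: overlap_def\<close>)
  have 2: "(transition d e has_derivative (*v) (J d e (snd d p))) (at (transition c d (snd c p)))"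
    unfolding transition_eq[OF c p(1)] by (rule transition_derivative[OF d e]) (use p in \<open>auto simp: overlap_def\<close>)
  have "((\<lambda>x. transition d e (transition c d x)) has_derivative (\<lambda>v. J d e (snd d p) *v (J c d (snd c p) *v v))) (at (snd c p))"
    by (rule has_derivative_compose[OF 1 2])
  then have 3: "((\<lambda>x. transition d e (transition c d x)) has_derivative (*v) (J d e (snd d p) ** J c d (snd c p))) (at (snd c p))"
    by (simp add: matrix_vector_mul_assoc)
  let ?W = "snd c ` ((fst d \<inter> fst e) \<inter> fst c)"
  have "open ?W" by (intro chart_image_open c openin_Int chartD(1) d e)
  then show "(transition c e has_derivative (*v) (J d e (snd d p) ** J c d (snd c p))) (at (snd c p))"
    by (rule has_derivative_transform_within_open[OF 3])
      (use p transition_eq[OF c, of _ d] transition_eq[OF c, of _ e] transition_eq[OF d, of _ e] in auto)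
qed

section \<open>The bundle of nonzero tangent vectors as a manifold\<close>

text \<open>Being nonzero in one chart is the same as in every chart around the base point, because
  the coordinate vectors determine each other linearly.\<close>

definition TM0 :: "'a tangent set" where
  "TM0 = {w \<in> tangent_bundle M A. \<exists>c\<in>A. fst w \<in> fst c \<and> snd w c \<noteq> 0}"
definition X :: "'a tangent topology" where "X = subtopology (tangent_topology M A) TM0"
definition dom :: "'a chart \<Rightarrow> 'a tangent set" where "dom c = {w \<in> TM0. fst w \<in> fst c}"
definition \<kappa> :: "'a chart \<Rightarrow> 'a tangent \<Rightarrow> real^4" where
  "\<kappa> c w = pack (snd c (fst w)) (g c (snd c (fst w)) *v snd w c)"
definition Om :: "'a chart \<Rightarrow> (real^4) set" where "Om c = metric_chart.Om (img c)"
definition vel :: "'a chart \<Rightarrow> real^4 \<Rightarrow> real^2" where "vel c z = vector [V1 (g c) z, V2 (g c) z]"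
text \<open>A tangent vector is a whole family of coordinate vectors, so one of them is propagated
  by the Jacobians to all other charts, with the value 0 that \<open>tangent_bundle\<close>
  prescribes elsewhere. From it \<open>\<iota>\<close> is built as the inverse of the chart
  \<open>\<kappa>\<close>.\<close>

definition lift :: "'a chart \<Rightarrow> 'a \<Rightarrow> real^2 \<Rightarrow> 'a tangent" where
  "lift c p v = (p, \<lambda>d. if d \<in> A \<and> p \<in> fst d then J c d (snd c p) *v v else 0)"
definition \<iota> :: "'a chart \<Rightarrow> real^4 \<Rightarrow> 'a tangent" where
  "\<iota> c z = lift c (inv_into (fst c) (snd c) (prX z)) (vel c z)"
definition TB :: "'a chart \<Rightarrow> ((real^2) \<times> (real^2)) set \<Rightarrow> 'a tangent set" where
  "TB c W = {(p, \<xi>) \<in> tangent_bundle M A. p \<in> fst c \<and> (snd c p, \<xi> c) \<in> W}"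

lemma Om_eq: "c \<in> A \<Longrightarrow> Om c = {z. prX z \<in> img c \<and> prP z \<noteq> 0}"
  unfolding Om_def using metric_chart.Om_def[OF metric_chart] .

lemma tb: "w \<in> tangent_bundle M A \<longleftrightarrow> fst w \<in> topspace M \<and> (\<forall>c. \<not> (c \<in> A \<and> fst w \<in> fst c) \<longrightarrow> snd w c = 0) \<and>
    (\<forall>c\<in>A. \<forall>d\<in>A. fst w \<in> fst c \<inter> fst d \<longrightarrow> snd w d = J c d (snd c (fst w)) *v snd w c)"
  by (cases w) (simp add: tangent_bundle_def J_def)

lemma tb_zero: "w \<in> tangent_bundle M A \<Longrightarrow> \<not> (c \<in> A \<and> fst w \<in> fst c) \<Longrightarrow> snd w c = 0"
  unfolding tb by blast

lemma tb_change:
  "w \<in> tangent_bundle M A \<Longrightarrow> c \<in> A \<Longrightarrow> d \<in> A \<Longrightarrow> fst w \<in> fst c \<Longrightarrow> fst w \<in> fst d \<Longrightarrow>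
    snd w d = J c d (snd c (fst w)) *v snd w c"
  unfolding tb by blast

lemma tangent_topology_eq: "tangent_topology M A = topology_generated_by {TB c W | c W. c \<in> A \<and> open W}"
  unfolding tangent_topology_def TB_def by simp

lemma TB_open: "c \<in> A \<Longrightarrow> open W \<Longrightarrow> openin (tangent_topology M A) (TB c W)"
  unfolding tangent_topology_eq by (rule topology_generated_by_Basis) blast

lemma topspace_tangent: "topspace (tangent_topology M A) = tangent_bundle M A"
proof -
  have "\<Union>{TB c W | c W. c \<in> A \<and> open W} = tangent_bundle M A"
  proof
    show "\<Union>{TB c W | c W. c \<in> A \<and> open W} \<subseteq> tangent_bundle M A" by (auto simp: TB_def)
    show "tangent_bundle M A \<subseteq> \<Union>{TB c W | c W. c \<in> A \<and> open W}"
    proof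
      fix w assume w: "w \<in> tangent_bundle M A"
      then have "fst w \<in> topspace M" by (simp add: tb)
      then obtain c where c: "c \<in> A" "fst w \<in> fst c" using chart_exists by blast
      then have "w \<in> TB c UNIV" using w by (cases w) (simp add: TB_def)
      then show "w \<in> \<Union>{TB c W | c W. c \<in> A \<and> open W}" using c by blast
    qed
  qed
  then show ?thesis unfolding tangent_topology_eq by simp
qed

lemma TM0_sub: "TM0 \<subseteq> tangent_bundle M A" by (auto simp: TM0_def)

lemma topspace_X: "topspace X = TM0"
  using TM0_sub by (simp add: X_def topspace_tangent Int_absorb1)

lemma lift_tb:
  assumes c: "c \<in> A" "p \<in> fst c" shows "lift c p v \<in> tangent_bundle M A"
  unfolding tb
proof (intro conjI ballI impI allI)
  show "fst (lift c p v) \<in> topspace M" using openin_subset[OF chartD(1)[OF c(1)]] c(2) by (auto simp: lift_def)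
next
  fix d assume "\<not> (d \<in> A \<and> fst (lift c p v) \<in> fst d)" then show "snd (lift c p v) d = 0" by (auto simp: lift_def)
next
  fix d e assume de: "d \<in> A" "e \<in> A" "fst (lift c p v) \<in> fst d \<inter> fst e"
  then show "snd (lift c p v) e = J d e (snd d (fst (lift c p v))) *v snd (lift c p v) d"
    using J_cocycle[OF c(1) de(1,2) c(2)] by (simp add: lift_def matrix_vector_mul_assoc)
qed

lemma lift_self: "c \<in> A \<Longrightarrow> p \<in> fst c \<Longrightarrow> snd (lift c p v) c = v"
  by (simp add: lift_def J_self)

lemma lift_eq: assumes "w \<in> tangent_bundle M A" "c \<in> A" "fst w \<in> fst c" shows "lift c (fst w) (snd w c) = w"
proof -
  have "snd (lift c (fst w) (snd w c)) d = snd w d" for d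
  proof (cases "d \<in> A \<and> fst w \<in> fst d")
    case True
    then show ?thesis using tb_change[OF assms(1,2) _ assms(3)] by (simp add: lift_def)
  next
    case False
    then show ?thesis using tb_zero[OF assms(1) False] by (auto simp: lift_def)
  qed
  then show ?thesis by (simp add: prod_eq_iff fun_eq_iff) (simp add: lift_def)
qed

lemma vel_pack: assumes c: "c \<in> A" and x: "x \<in> img c" shows "vel c (pack x (g c x *v v)) = v"
proof -
  interpret m: metric_chart "img c" "g c" by (rule metric_chart[OF c])
  have D: "gD (g c) x \<noteq> 0" using m.g_pos[OF x] by simp
  have "gH (g c) x * (gE (g c) x * v$1 + gF (g c) x * v$2) - gF (g c) x * (gF (g c) x * v$1 + gH (g c) x * v$2) = gD (g c) x * v$1"
    "gE (g c) x * (gF (g c) x * v$1 + gH (g c) x * v$2) - gF (g c) x * (gE (g c) x * v$1 + gF (g c) x * v$2) = gD (g c) x * v$2"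
    by (simp_all add: gD_def power2_eq_square algebra_simps)
  then show ?thesis using D by (simp add: vel_def V1_def V2_def vec_eq_iff forall_2 m.Gv[OF x])
qed

lemma g_vel: assumes c: "c \<in> A" and x: "prX z \<in> img c" shows "g c (prX z) *v vel c z = prP z"
proof -
  interpret m: metric_chart "img c" "g c" by (rule metric_chart[OF c])
  show ?thesis using m.V_eq[OF x] by (simp add: vec_eq_iff forall_2 m.Gv[OF x] vel_def)
qed

lemma \<kappa>_Om: assumes c: "c \<in> A" and w: "w \<in> dom c" shows "\<kappa> c w \<in> Om c" "vel c (\<kappa> c w) = snd w c" "prX (\<kappa> c w) = snd c (fst w)"
proof -
  interpret m: metric_chart "img c" "g c" by (rule metric_chart[OF c])
  have x: "snd c (fst w) \<in> img c" using w by (auto simp: dom_def img_def)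
  show v: "vel c (\<kappa> c w) = snd w c" unfolding \<kappa>_def by (rule vel_pack[OF c x])
  show pX: "prX (\<kappa> c w) = snd c (fst w)" by (simp add: \<kappa>_def)
  obtain d where d: "d \<in> A" "fst w \<in> fst d" "snd w d \<noteq> 0" using w by (auto simp: dom_def TM0_def)
  have "snd w d = J c d (snd c (fst w)) *v snd w c" by (rule tb_change) (use w c d in \<open>auto simp: dom_def TM0_def\<close>)
  then have "snd w c \<noteq> 0" using d(3) by auto
  then have "g c (snd c (fst w)) *v snd w c \<noteq> 0" using m.pos[OF x, of "snd w c"] by auto
  then show "\<kappa> c w \<in> Om c" using x by (simp add: Om_eq[OF c] \<kappa>_def)
qed

lemma \<iota>_\<kappa>: assumes c: "c \<in> A" and w: "w \<in> dom c" shows "\<iota> c (\<kappa> c w) = w"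
  using w unfolding \<iota>_def \<kappa>_Om[OF assms] by (auto simp: dom_def TM0_def chart_inv[OF c] lift_eq[OF _ c])

lemma \<iota>_dom: assumes c: "c \<in> A" and z: "z \<in> Om c" shows "\<iota> c z \<in> dom c" "\<kappa> c (\<iota> c z) = z"
proof -
  let ?p = "inv_into (fst c) (snd c) (prX z)"
  have x: "prX z \<in> img c" and P: "prP z \<noteq> 0" using z by (auto simp: Om_eq[OF c])
  have p: "?p \<in> fst c" "snd c ?p = prX z" using x by (auto simp: img_def inv_into_into f_inv_into_f)
  have f: "fst (\<iota> c z) = ?p" by (simp add: \<iota>_def lift_def)
  have s: "snd (\<iota> c z) c = vel c z" unfolding \<iota>_def by (rule lift_self[OF c p(1)])
  have "vel c z \<noteq> 0" using g_vel[OF c x] P by auto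
  then show "\<iota> c z \<in> dom c" using lift_tb[OF c p(1), of "vel c z"] c p s f by (auto simp: dom_def TM0_def \<iota>_def)
  show "\<kappa> c (\<iota> c z) = z" unfolding \<kappa>_def f s p g_vel[OF c x] by simp
qed

lemma \<kappa>_image: assumes c: "c \<in> A" shows "\<kappa> c ` dom c = Om c"
proof
    show "\<kappa> c ` dom c \<subseteq> Om c" using \<kappa>_Om(1)[OF c] by blast
    show "Om c \<subseteq> \<kappa> c ` dom c" using \<iota>_dom[OF c] by (metis image_eqI subsetI)
qed

lemma \<kappa>_inv: assumes c: "c \<in> A" and z: "z \<in> Om c" shows "inv_into (dom c) (\<kappa> c) z = \<iota> c z"
proof -
  have "inj_on (\<kappa> c) (dom c)" by (rule inj_on_inverseI[where g="\<iota> c"]) (rule \<iota>_\<kappa>[OF c])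
  from inv_into_f_eq[OF this] \<iota>_dom[OF c z] show ?thesis by blast
qed

lemma Om_open: "c \<in> A \<Longrightarrow> open (Om c)"
  unfolding Om_def by (rule metric_chart.Om_open[OF metric_chart])

lemma dom_open: assumes c: "c \<in> A" shows "openin X (dom c)"
proof -
  have "dom c = TB c UNIV \<inter> TM0" using TM0_sub by (auto simp: dom_def TB_def)
  then show ?thesis using TB_open[OF c open_UNIV] by (auto simp: X_def openin_subtopology)
qed

lemma continuous_on_4I:
  fixes f :: "'b::topological_space \<Rightarrow> real^4"
  assumes "continuous_on S (\<lambda>x. f x $ 1)" "continuous_on S (\<lambda>x. f x $ 2)" "continuous_on S (\<lambda>x. f x $ 3)" "continuous_on S (\<lambda>x. f x $ 4)"
  shows "continuous_on S f"
proof -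
  have "continuous_on S (\<lambda>x. f x $ i)" for i using assms exhaust_4[of i] by auto
  then have "continuous_on S (\<lambda>x. \<chi> i. f x $ i)" by (rule continuous_on_vec_lambda)
  then show ?thesis by simp
qed

lemma continuous_on_2I:
  fixes f :: "'b::topological_space \<Rightarrow> real^2"
  assumes "continuous_on S (\<lambda>x. f x $ 1)" "continuous_on S (\<lambda>x. f x $ 2)"
  shows "continuous_on S f"
proof -
  have "continuous_on S (\<lambda>x. f x $ i)" for i using assms exhaust_2[of i] by auto
  then have "continuous_on S (\<lambda>x. \<chi> i. f x $ i)" by (rule continuous_on_vec_lambda)
  then show ?thesis by simp
qed

lemma pack_g_continuous:
  assumes c: "c \<in> A" shows "continuous_on (img c \<times> UNIV) (\<lambda>q. pack (fst q) (g c (fst q) *v snd q))"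
proof -
  interpret m: metric_chart "img c" "g c" by (rule metric_chart[OF c])
  have gc: "continuous_on (img c \<times> (UNIV :: (real^2) set)) (\<lambda>q. f (fst q))" if "smooth_on (img c) f" for f :: "real^2 \<Rightarrow> real"
    by (rule continuous_on_compose2[OF smooth_on_continuous[OF that]]) (auto intro: continuous_intros)
  note gcs = gc[OF m.smooth_g(1)] gc[OF m.smooth_g(2)] gc[OF m.smooth_g(3)]
  have 3: "continuous_on (img c \<times> (UNIV :: (real^2) set)) (\<lambda>q. gE (g c) (fst q) * snd q $ 1 + gF (g c) (fst q) * snd q $ 2)"
    and 4: "continuous_on (img c \<times> (UNIV :: (real^2) set)) (\<lambda>q. gF (g c) (fst q) * snd q $ 1 + gH (g c) (fst q) * snd q $ 2)"
    by (intro continuous_intros gcs)+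
  show ?thesis
  proof (rule continuous_on_4I)
    show "continuous_on (img c \<times> UNIV) (\<lambda>q. pack (fst q) (g c (fst q) *v snd q) $ 1)"
      "continuous_on (img c \<times> UNIV) (\<lambda>q. pack (fst q) (g c (fst q) *v snd q) $ 2)"
      by (simp_all, (intro continuous_intros)+)
    show "continuous_on (img c \<times> UNIV) (\<lambda>q. pack (fst q) (g c (fst q) *v snd q) $ 3)"
      by (rule continuous_on_eq[OF 3]) (auto simp: m.Gv)
    show "continuous_on (img c \<times> UNIV) (\<lambda>q. pack (fst q) (g c (fst q) *v snd q) $ 4)"
      by (rule continuous_on_eq[OF 4]) (auto simp: m.Gv)
  qed
qed

lemma \<kappa>_vimage_open:
  assumes c: "c \<in> A" and O': "open O'" shows "openin X {w \<in> dom c. \<kappa> c w \<in> O'}"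
proof -
  let ?W = "(img c \<times> UNIV) \<inter> (\<lambda>q. pack (fst q) (g c (fst q) *v snd q)) -` O'"
  have "open ?W"
    by (intro continuous_open_preimage pack_g_continuous c O' open_Times chartD(2) open_UNIV)
  moreover have "{w \<in> dom c. \<kappa> c w \<in> O'} = TB c ?W \<inter> TM0"
    using TM0_sub by (auto simp: dom_def TB_def \<kappa>_def img_def)
  ultimately show ?thesis using TB_open[OF c] by (auto simp: X_def openin_subtopology)
qed

lemma vel_continuous: "c \<in> A \<Longrightarrow> continuous_on (Om c) (vel c)"
  unfolding Om_def
  by (rule continuous_on_2I) (simp_all add: vel_def metric_chart.V_cont[OF metric_chart])

text \<open>It suffices to look at the generating sets \<open>TB d W\<close>. Over the overlap with
  the chart \<open>d\<close>, the vector \<open>\<iota> c z\<close> reads (transition, Jacobian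
  times velocity), which depends continuously on \<open>z\<close>.\<close>

lemma \<iota>_continuous: assumes c: "c \<in> A" shows "continuous_map (top_of_set (Om c)) X (\<iota> c)"
  unfolding X_def continuous_map_in_subtopology
proof
  show "\<iota> c \<in> topspace (top_of_set (Om c)) \<rightarrow> TM0" using \<iota>_dom(1)[OF c] by (auto simp: dom_def)
  show "continuous_map (top_of_set (Om c)) (tangent_topology M A) (\<iota> c)"
    unfolding tangent_topology_eq continuous_on_generated_topo_iff
  proof (intro conjI allI impI)
    have "\<iota> c ` topspace (top_of_set (Om c)) \<subseteq> tangent_bundle M A" using \<iota>_dom(1)[OF c] TM0_sub by (auto simp: dom_def)
    also have "\<dots> = \<Union>{TB c W |c W. c \<in> A \<and> open W}"
      using topspace_tangent unfolding tangent_topology_eq by simp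
    finally show "\<iota> c ` topspace (top_of_set (Om c)) \<subseteq> \<Union>{TB c W |c W. c \<in> A \<and> open W}" .
    fix B assume "B \<in> {TB c W |c W. c \<in> A \<and> open W}"
    then obtain d W where d: "d \<in> A" "open W" "B = TB d W" by blast
    interpret ct: chart_transition "img c" "g c" "img d" "g d" "overlap c d" "transition c d"
      by (rule chart_transition[OF c d(1)])
    let ?\<Omega> = "Om c \<inter> prX -` overlap c d"
    let ?h = "\<lambda>z. (transition c d (prX z), J c d (prX z) *v vel c z)"
    have prX: "continuous_on S prX" for S using linear_continuous_on[OF bounded_linear_prX] .
    have o: "open ?\<Omega>" by (intro open_Int Om_open c open_vimage overlap_open d prX)
    have cj: "continuous_on ?\<Omega> (\<lambda>z. ct.j a b (prX z))" for a b
      by (rule continuous_on_compose2[OF smooth_on_continuous[OF ct.smooth_j] prX]) auto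
    have ct: "continuous_on ?\<Omega> (\<lambda>z. transition c d (prX z))"
      by (rule continuous_on_compose2[OF smooth_on_continuous[OF ct.smooth_\<psi>] prX]) auto
    have cv: "continuous_on ?\<Omega> (vel c)" using vel_continuous[OF c] by (rule continuous_on_subset) auto
    have "continuous_on ?\<Omega> (\<lambda>z. J c d (prX z) *v vel c z)"
    proof (rule continuous_on_2I)
      have e: "(J c d (prX z) *v vel c z) $ a = ct.j a 1 (prX z) * vel c z $ 1 + ct.j a 2 (prX z) * vel c z $ 2" if "z \<in> ?\<Omega>" for z a
        using that ct.jacobian_nth[of "prX z"] by (simp add: J_def matrix_vector_mult_def sum_2)
      have cc: "continuous_on ?\<Omega> (\<lambda>z. ct.j a 1 (prX z) * vel c z $ 1 + ct.j a 2 (prX z) * vel c z $ 2)" for a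
        by (intro continuous_intros cj cv)
      have "continuous_on ?\<Omega> (\<lambda>z. (J c d (prX z) *v vel c z) $ a)" for a
        by (rule continuous_on_eq[OF cc[of a]]) (rule e[symmetric])
      then show "continuous_on ?\<Omega> (\<lambda>z. (J c d (prX z) *v vel c z) $ 1)" "continuous_on ?\<Omega> (\<lambda>z. (J c d (prX z) *v vel c z) $ 2)"
        by blast+
    qed
    then have "continuous_on ?\<Omega> ?h" by (intro continuous_on_Pair ct)
    then have "open (?\<Omega> \<inter> ?h -` W)" by (rule continuous_open_preimage[OF _ o d(2)])
    moreover have "\<iota> c -` B \<inter> Om c = ?\<Omega> \<inter> ?h -` W"
    proof (intro set_eqI)
      fix z
      show "z \<in> \<iota> c -` B \<inter> Om c \<longleftrightarrow> z \<in> ?\<Omega> \<inter> ?h -` W"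
      proof (cases "z \<in> Om c")
        case True
        let ?p = "inv_into (fst c) (snd c) (prX z)"
        have x: "prX z \<in> img c" using True by (auto simp: Om_eq[OF c])
        have p: "?p \<in> fst c" "snd c ?p = prX z" using x by (auto simp: img_def inv_into_into f_inv_into_f)
        have tb: "\<iota> c z \<in> tangent_bundle M A" using \<iota>_dom(1)[OF c True] TM0_sub by (auto simp: dom_def)
        have f: "fst (\<iota> c z) = ?p" by (simp add: \<iota>_def lift_def)
        have eq1: "prX z \<in> overlap c d \<longleftrightarrow> ?p \<in> fst d"
        proof
          assume "prX z \<in> overlap c d"
          then obtain q where "q \<in> fst c" "q \<in> fst d" "prX z = snd c q" by (auto simp: overlap_def)
          then show "?p \<in> fst d" using chart_inv[OF c] by simp
        next
          assume "?p \<in> fst d"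
          then show "prX z \<in> overlap c d" using p unfolding overlap_def by (metis IntI imageI)
        qed
        have "snd (\<iota> c z) d = J c d (prX z) *v vel c z" "snd d ?p = transition c d (prX z)" if "?p \<in> fst d"
          using that d(1) p transition_eq[OF c p(1), of d] by (simp_all add: \<iota>_def lift_def)
        then show ?thesis using True tb f eq1 unfolding d(3) TB_def by (cases "\<iota> c z") auto
      qed auto
    qed
    ultimately have "open (\<iota> c -` B \<inter> Om c)" by simp
    then show "openin (top_of_set (Om c)) (\<iota> c -` B \<inter> topspace (top_of_set (Om c)))"
      by (auto simp: openin_open_eq[OF Om_open[OF c]])
  qed
qed

lemma \<kappa>_homeo: assumes c: "c \<in> A"
  shows "homeomorphic_map (subtopology X (dom c)) (top_of_set (\<kappa> c ` dom c)) (\<kappa> c)"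
proof -
  have td: "topspace (subtopology X (dom c)) = dom c" by (auto simp: topspace_X dom_def)
  have "homeomorphic_maps (subtopology X (dom c)) (top_of_set (Om c)) (\<kappa> c) (\<iota> c)"
    unfolding homeomorphic_maps_def
  proof (intro conjI ballI)
    have "continuous_map (subtopology X (dom c)) euclidean (\<kappa> c)"
      unfolding continuous_map_def td
    proof (intro conjI allI impI)
      fix O' :: "(real^4) set" assume "openin euclidean O'"
      then have "open O'" by (simp only: open_openin)
      then have "openin X {w \<in> dom c. \<kappa> c w \<in> O'}" by (rule \<kappa>_vimage_open[OF c])
      then show "openin (subtopology X (dom c)) {w \<in> dom c. \<kappa> c w \<in> O'}"
        using openin_open_subtopology[OF dom_open[OF c]] by blast
    qed simp
    then show "continuous_map (subtopology X (dom c)) (top_of_set (Om c)) (\<kappa> c)"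
      unfolding continuous_map_in_subtopology td using \<kappa>_Om(1)[OF c] by blast
    show "continuous_map (top_of_set (Om c)) (subtopology X (dom c)) (\<iota> c)"
      unfolding continuous_map_in_subtopology using \<iota>_continuous[OF c] \<iota>_dom(1)[OF c] by auto
  qed (use \<iota>_\<kappa>[OF c] \<iota>_dom(2)[OF c] td in auto)
  then show ?thesis unfolding \<kappa>_image[OF c] using homeomorphic_maps_map by blast
qed

lemma fst_vimage_open: assumes V: "openin M V" shows "openin X {w \<in> TM0. fst w \<in> V}"
proof -
  have "{w \<in> TM0. fst w \<in> V} = (\<Union>c\<in>A. TB c (snd c ` (V \<inter> fst c) \<times> UNIV)) \<inter> TM0"
  proof (intro set_eqI iffI)
    fix w assume w: "w \<in> {w \<in> TM0. fst w \<in> V}"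
    then obtain c where "c \<in> A" "fst w \<in> fst c" by (auto simp: TM0_def)
    then show "w \<in> (\<Union>c\<in>A. TB c (snd c ` (V \<inter> fst c) \<times> UNIV)) \<inter> TM0"
      using w TM0_sub by (cases w) (auto simp: TB_def)
  next
    fix w assume w: "w \<in> (\<Union>c\<in>A. TB c (snd c ` (V \<inter> fst c) \<times> UNIV)) \<inter> TM0"
    then obtain c where c: "c \<in> A" "w \<in> TB c (snd c ` (V \<inter> fst c) \<times> UNIV)" by blast
    then obtain q where "q \<in> V" "q \<in> fst c" "snd c (fst w) = snd c q" "fst w \<in> fst c" by (auto simp: TB_def)
    then have "fst w = q" using chart_inj[OF c(1)] by (simp add: inj_on_def)
    then show "w \<in> {w \<in> TM0. fst w \<in> V}" using w \<open>q \<in> V\<close> by auto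
  qed
  moreover have "openin (tangent_topology M A) (\<Union>c\<in>A. TB c (snd c ` (V \<inter> fst c) \<times> UNIV))"
    by (intro openin_Union ballI) (auto intro!: TB_open open_Times chart_image_open V)
  ultimately show ?thesis by (auto simp: X_def openin_subtopology)
qed

text \<open>Vectors over different points are separated by pulling back open sets of the surface,
  vectors over the same point inside a common chart.\<close>

lemma Haus_X: "Hausdorff_space X"
  unfolding Hausdorff_space_def topspace_X
proof (intro allI impI)
  fix w w' assume w: "w \<in> TM0 \<and> w' \<in> TM0 \<and> w \<noteq> w'"
  show "\<exists>U V. openin X U \<and> openin X V \<and> w \<in> U \<and> w' \<in> V \<and> disjnt U V"
  proof (cases "fst w = fst w'")
    case False
    have "fst w \<in> topspace M" "fst w' \<in> topspace M" using w by (auto simp: TM0_def tb)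
    then obtain U V where UV: "openin M U" "openin M V" "fst w \<in> U" "fst w' \<in> V" "disjnt U V"
      using Haus_M False unfolding Hausdorff_space_def by blast
    then show ?thesis using fst_vimage_open[OF UV(1)] fst_vimage_open[OF UV(2)] w
      by (intro exI[of _ "{w \<in> TM0. fst w \<in> U}"] exI[of _ "{w \<in> TM0. fst w \<in> V}"]) (auto simp: disjnt_iff)
  next
    case True
    obtain c where c: "c \<in> A" "fst w \<in> fst c" using w by (auto simp: TM0_def)
    have d: "w \<in> dom c" "w' \<in> dom c" using w c True by (auto simp: dom_def)
    have ne: "\<kappa> c w \<noteq> \<kappa> c w'" using \<iota>_\<kappa>[OF c(1) d(1)] \<iota>_\<kappa>[OF c(1) d(2)] w by metis
    obtain U V where UV: "open U" "open V" "\<kappa> c w \<in> U" "\<kappa> c w' \<in> V" "U \<inter> V = {}"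
      using hausdorff[OF ne] by blast
    note o = \<kappa>_vimage_open[OF c(1) UV(1)] \<kappa>_vimage_open[OF c(1) UV(2)]
    have "disjnt {w \<in> dom c. \<kappa> c w \<in> U} {w \<in> dom c. \<kappa> c w \<in> V}" using UV(5) by (auto simp: disjnt_iff)
    then show ?thesis using d UV(3,4) o by blast
  qed
qed

lemma \<iota>_fst: assumes c: "c \<in> A" and z: "z \<in> Om c"
  shows "fst (\<iota> c z) \<in> fst c" "snd c (fst (\<iota> c z)) = prX z" "snd (\<iota> c z) c = vel c z"
  using \<iota>_dom[OF c z] \<kappa>_Om(2,3)[OF c \<iota>_dom(1)[OF c z]] by (auto simp: dom_def)

text \<open>The change between two momentum charts of the bundle is the cotangent lift of the
  transition map; this makes the results on \<open>colift\<close> available.\<close>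

lemma \<kappa>_\<iota>:
  assumes c: "c \<in> A" and d: "d \<in> A" and z: "z \<in> Om c" "prX z \<in> overlap c d"
  shows "fst (\<iota> c z) \<in> fst d" "\<kappa> d (\<iota> c z) = chart_transition.colift (transition c d) z"
proof -
  interpret ct: chart_transition "img c" "g c" "img d" "g d" "overlap c d" "transition c d"
    by (rule chart_transition[OF c d])
  note f = \<iota>_fst[OF c z(1)]
  obtain q where q: "q \<in> fst c" "q \<in> fst d" "prX z = snd c q" using z(2) by (auto simp: overlap_def)
  have "fst (\<iota> c z) = q" using f q chart_inj[OF c] by (simp add: inj_on_def)
  then show fd: "fst (\<iota> c z) \<in> fst d" using q by simp
  have tb: "\<iota> c z \<in> tangent_bundle M A" using \<iota>_dom(1)[OF c z(1)] TM0_sub by (auto simp: dom_def)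
  have s: "snd (\<iota> c z) d = J c d (prX z) *v vel c z" using tb_change[OF tb c d f(1) fd] f by simp
  have y: "snd d (fst (\<iota> c z)) = transition c d (prX z)" using transition_eq[OF c f(1), of d] f by simp
  have yS: "transition c d (prX z) \<in> img d" using ct.U(3) z(2) by auto
  note V = ct.V_colift[OF z(2)]
  have Jv: "(J c d (prX z) *v vel c z) $ 1 = V1 (g d) (ct.colift z)" "(J c d (prX z) *v vel c z) $ 2 = V2 (g d) (ct.colift z)"
    using V(1,2) ct.jacobian_nth[OF z(2)] by (simp_all add: J_def matrix_vector_mult_def sum_2 vel_def)
  show "\<kappa> d (\<iota> c z) = ct.colift z"
    unfolding \<kappa>_def y s ct.colift_def by (simp add: vec_eq_iff forall_4 ct.d.Gv[OF yS] Jv V(3,4)[symmetric])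
qed

lemma prX_continuous: "continuous_on S prX"
  using linear_continuous_on[OF bounded_linear_prX] .

lemma overlap_prX: assumes c: "c \<in> A" and w: "w \<in> dom c" "w \<in> dom d" shows "prX (\<kappa> c w) \<in> overlap c d"
  using \<kappa>_Om(3)[OF c w(1)] w by (auto simp: dom_def overlap_def)

lemma trans:
  assumes c: "c \<in> A" and d: "d \<in> A" and w: "w \<in> dom c" "w \<in> dom d"
  shows "\<exists>D. ((\<kappa> d \<circ> inv_into (dom c) (\<kappa> c)) has_derivative D) (at (\<kappa> c w)) \<and>
     \<bar>det (matrix D)\<bar> = 1 \<and> D (magnetic_field (g c) \<mu> (\<kappa> c w)) = magnetic_field (g d) \<mu> (\<kappa> d w)"
proof -
  interpret ct: chart_transition "img c" "g c" "img d" "g d" "overlap c d" "transition c d"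
    by (rule chart_transition[OF c d])
  have z: "\<kappa> c w \<in> Om c" "prX (\<kappa> c w) \<in> overlap c d" using \<kappa>_Om(1)[OF c w(1)] overlap_prX[OF c w] by auto
  let ?\<Omega> = "Om c \<inter> prX -` overlap c d"
  have o: "open ?\<Omega>" by (intro open_Int Om_open c open_vimage overlap_open d prX_continuous)
  have "(ct.colift has_derivative ct.colift_deriv (\<kappa> c w)) (at (\<kappa> c w))" by (rule ct.colift_derivative[OF z(2)])
  then have "((\<kappa> d \<circ> inv_into (dom c) (\<kappa> c)) has_derivative ct.colift_deriv (\<kappa> c w)) (at (\<kappa> c w))"
    by (rule has_derivative_transform_within_open[OF _ o]) (use z \<kappa>_inv[OF c] \<kappa>_\<iota>(2)[OF c d] in auto)
  moreover have "ct.colift (\<kappa> c w) = \<kappa> d w" using \<kappa>_\<iota>(2)[OF c d z] \<iota>_\<kappa>[OF c w(1)] by simp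
  moreover have "\<kappa> c w \<in> ct.c.Om" using z(1) by (simp add: Om_def)
  ultimately show ?thesis using ct.colift_deriv_det[OF z(2)] ct.colift_deriv_magnetic_field[of "\<kappa> c w" \<mu>] z(2) by auto
qed

section \<open>The length function and compactness of the shell\<close>

text \<open>The Riemannian length as one function on the bundle. A chart has to be picked for the
  definition; \<open>N_eq\<close> shows that the choice is immaterial.\<close>

definition N :: "'a tangent \<Rightarrow> real" where
  "N w = (let c = SOME c. c \<in> A \<and> fst w \<in> fst c in speed (g c) (\<kappa> c w))"

lemma N_eq: assumes c: "c \<in> A" and w: "w \<in> dom c" shows "N w = speed (g c) (\<kappa> c w)"
proof -
  define d where "d = (SOME c. c \<in> A \<and> fst w \<in> fst c)"
  have "c \<in> A \<and> fst w \<in> fst c" using c w by (auto simp: dom_def)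
  then have d: "d \<in> A" "fst w \<in> fst d" using someI[of "\<lambda>c. c \<in> A \<and> fst w \<in> fst c" c] unfolding d_def by blast+
  interpret ct: chart_transition "img c" "g c" "img d" "g d" "overlap c d" "transition c d"
    by (rule chart_transition[OF c d(1)])
  have wd: "w \<in> dom d" using w d by (auto simp: dom_def)
  have z: "\<kappa> c w \<in> Om c" "prX (\<kappa> c w) \<in> overlap c d" using \<kappa>_Om(1)[OF c w] overlap_prX[OF c w wd] by auto
  have "ct.colift (\<kappa> c w) = \<kappa> d w" using \<kappa>_\<iota>(2)[OF c d(1) z] \<iota>_\<kappa>[OF c w] by simp
  then show ?thesis using ct.speed_colift[OF z(2)] by (simp add: N_def d_def)
qed

lemma N_deriv:
  assumes c: "c \<in> A" and w: "w \<in> dom c"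
  shows "\<exists>D. ((N \<circ> inv_into (dom c) (\<kappa> c)) has_derivative D) (at (\<kappa> c w)) \<and> D (magnetic_field (g c) \<mu> (\<kappa> c w)) = 0"
proof -
  interpret m: metric_chart "img c" "g c" by (rule metric_chart[OF c])
  have z: "\<kappa> c w \<in> Om c" using \<kappa>_Om(1)[OF c w] .
  have z': "\<kappa> c w \<in> m.Om" using z by (simp add: Om_def)
  have "((N \<circ> inv_into (dom c) (\<kappa> c)) has_derivative dspeed (g c) (\<kappa> c w)) (at (\<kappa> c w))"
    by (rule has_derivative_transform_within_open[OF m.speed_derivative[OF z'] Om_open[OF c] z])
      (use \<kappa>_inv[OF c] \<iota>_dom[OF c] N_eq[OF c] in auto)
  then show ?thesis using m.speed_conserved[OF z'] by blast
qed

lemma speed_pack: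
  assumes c: "c \<in> A" and x: "x \<in> img c"
  shows "speed (g c) (pack x (g c x *v v)) = sqrt (v \<bullet> (g c x *v v))"
proof -
  have v: "vel c (pack x (g c x *v v)) = v" by (rule vel_pack[OF c x])
  have "V1 (g c) (pack x (g c x *v v)) = v$1" "V2 (g c) (pack x (g c x *v v)) = v$2"
    using arg_cong[OF v, of "\<lambda>v. v$1"] arg_cong[OF v, of "\<lambda>v. v$2"] by (simp_all add: vel_def)
  then show ?thesis by (simp add: speed_def inner_vec_def sum_2 mult.commute)
qed

text \<open>In position and velocity coordinates the set is closed in a product of two closed balls,
  and its image under the continuous passage from velocity to momentum is the set in
  question.\<close>

lemma annulus_compact:
  assumes c: "c \<in> A" and r: "cball x r \<subseteq> img c" "0 \<le> r"
  shows "compact {z \<in> Om c. prX z \<in> cball x r \<and> 1 \<le> speed (g c) z \<and> speed (g c) z \<le> 2}"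
proof -
  interpret m: metric_chart "img c" "g c" by (rule metric_chart[OF c])
  let ?P = "\<lambda>q. pack (fst q) (g c (fst q) *v snd q)"
  let ?Q = "\<lambda>q. snd q \<bullet> (g c (fst q) *v snd q)"
  have P: "continuous_on (cball x r \<times> S) ?P" for S
    by (rule continuous_on_subset[OF pack_g_continuous[OF c]]) (use r in auto)
  have Q: "continuous_on (cball x r \<times> S) ?Q" for S
  proof -
    have "continuous_on (cball x r \<times> S) (\<lambda>q. snd q \<bullet> prP (?P q))"
      by (intro continuous_on_inner continuous_on_compose2[OF linear_continuous_on[OF bounded_linear_prP, of UNIV] P] continuous_intros) auto
    then show ?thesis by simp
  qed
  have ne: "cball x r \<times> sphere (0::real^2) 1 \<noteq> {}"
  proof -
    have "axis 1 1 \<in> sphere (0::real^2) 1" by simp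
    moreover have "x \<in> cball x r" using r by simp
    ultimately show ?thesis by blast
  qed
  obtain q0 where q0: "q0 \<in> cball x r \<times> sphere 0 1" "\<And>q. q \<in> cball x r \<times> sphere 0 1 \<Longrightarrow> ?Q q0 \<le> ?Q q"
    using continuous_attains_inf[OF compact_Times[OF compact_cball compact_sphere] ne Q] by blast
  \<comment> \<open>The least value of the quadratic form on Euclidean unit vectors over the closed
    ball; it bounds the metric from below uniformly.\<close>
  define \<delta> where "\<delta> = ?Q q0"
  have "\<delta> > 0" unfolding \<delta>_def using q0(1) r by (intro m.pos) auto
  have low: "\<delta> * (norm v)\<^sup>2 \<le> ?Q (y, v)" if "y \<in> cball x r" for y v
  proof (cases "v = 0")
    case False
    let ?u = "(1 / norm v) *\<^sub>R v"
    have "\<delta> \<le> ?Q (y, ?u)" unfolding \<delta>_def using q0(2)[of "(y, ?u)"] that False by auto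
    also have "?Q (y, ?u) = ?Q (y, v) / (norm v)\<^sup>2"
      by (simp add: matrix_vector_mult_scaleR power2_eq_square)
    finally show ?thesis using False by (simp add: field_simps)
  qed simp
  \<comment> \<open>From \<delta> |v|^2 \<le> g(v, v) \<le> 4, where 4 is the square of the largest
    admissible speed 2; likewise 1..2 for the speed becomes 1..4 for the form.\<close>
  define R where "R = sqrt (4 / \<delta>)"
  let ?C = "(cball x r \<times> cball 0 R) \<inter> ?Q -` {1..4}"
  have "closed ?C" by (rule continuous_closed_preimage[OF Q]) (auto intro: closed_Times)
  then have "compact ((cball x r \<times> cball 0 R) \<inter> ?C)" by (intro compact_Int_closed compact_Times compact_cball)
  then have cC: "compact ?C" by (simp add: Int_absorb1)
  have "compact (?P ` ?C)"
    by (rule compact_continuous_image[OF continuous_on_subset[OF P] cC]) blast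
  moreover have "?P ` ?C = {z \<in> Om c. prX z \<in> cball x r \<and> 1 \<le> speed (g c) z \<and> speed (g c) z \<le> 2}"
  proof (intro set_eqI iffI)
    fix z assume "z \<in> ?P ` ?C"
    then obtain y v where yv: "y \<in> cball x r" "1 \<le> ?Q (y, v)" "?Q (y, v) \<le> 4" "z = ?P (y, v)" by auto
    have y: "y \<in> img c" using yv r by auto
    have "g c y *v v \<noteq> 0" using yv(2) by auto
    then have "z \<in> Om c" using y yv(4) by (simp add: Om_eq[OF c])
    moreover have "speed (g c) z = sqrt (?Q (y, v))" unfolding yv(4) using speed_pack[OF c y] by simp
    moreover have "sqrt (?Q (y, v)) \<le> sqrt 4" using yv(3) by (rule real_sqrt_le_mono)
    ultimately show "z \<in> {z \<in> Om c. prX z \<in> cball x r \<and> 1 \<le> speed (g c) z \<and> speed (g c) z \<le> 2}"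
      using yv by simp
  next
    fix z assume z: "z \<in> {z \<in> Om c. prX z \<in> cball x r \<and> 1 \<le> speed (g c) z \<and> speed (g c) z \<le> 2}"
    let ?y = "prX z" and ?v = "vel c z"
    have y: "?y \<in> img c" using z r by auto
    have zP: "z = ?P (?y, ?v)" using g_vel[OF c y] by simp
    have n: "speed (g c) z = sqrt (?Q (?y, ?v))" using speed_pack[OF c y, of ?v] zP by simp
    have "0 \<le> ?Q (?y, ?v)" using m.pos[OF y, of ?v] by (cases "?v = 0") auto
    then have "(speed (g c) z)\<^sup>2 = ?Q (?y, ?v)" unfolding n by simp
    moreover have "1 \<le> (speed (g c) z)\<^sup>2" "(speed (g c) z)\<^sup>2 \<le> 4"
      using z power_mono[of 1 "speed (g c) z" 2] power_mono[of "speed (g c) z" 2 2] by auto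
    ultimately have Q14: "1 \<le> ?Q (?y, ?v)" "?Q (?y, ?v) \<le> 4" by auto
    have "\<delta> * (norm ?v)\<^sup>2 \<le> 4" using low[of ?y ?v] z Q14 by auto
    then have "(norm ?v)\<^sup>2 \<le> 4 / \<delta>" using \<open>\<delta> > 0\<close> by (simp add: field_simps)
    then have "norm ?v \<le> R" unfolding R_def by (rule real_le_rsqrt)
    then have "(?y, ?v) \<in> ?C" using z Q14 by simp
    then show "z \<in> ?P ` ?C" using zP by blast
  qed
  ultimately show ?thesis by simp
qed

text \<open>Finitely many chart balls cover the compact surface, and over each of the corresponding
  closed balls the shell is the continuous image of a compact annulus.\<close>

lemma Y_compact: "compactin X {w \<in> topspace X. 1 \<le> N w \<and> N w \<le> 2}"
proof -
  have "\<forall>p\<in>topspace M. \<exists>c r. c \<in> A \<and> p \<in> fst c \<and> 0 < r \<and> cball (snd c p) r \<subseteq> img c"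
  proof
    fix p assume "p \<in> topspace M"
    then obtain c where c: "c \<in> A" "p \<in> fst c" using chart_exists by blast
    then have "snd c p \<in> img c" by (auto simp: img_def)
    then obtain r where "r > 0" "cball (snd c p) r \<subseteq> img c"
      using chartD(2)[OF c(1)] open_contains_cball by blast
    then show "\<exists>c r. c \<in> A \<and> p \<in> fst c \<and> 0 < r \<and> cball (snd c p) r \<subseteq> img c" using c by blast
  qed
  then obtain c r where cr: "\<And>p. p \<in> topspace M \<Longrightarrow> c p \<in> A \<and> p \<in> fst (c p) \<and> 0 < r p \<and> cball (snd (c p) p) (r p) \<subseteq> img (c p)"
    by metis
  let ?B = "\<lambda>p. {q \<in> fst (c p). snd (c p) q \<in> ball (snd (c p) p) (r p)}"
  have "compactin M (topspace M)" using comp by (simp add: compact_space_def)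
  moreover have "openin M (?B p)" if "p \<in> topspace M" for p using cr[OF that] by (intro chart_vimage_open) auto
  moreover have "topspace M \<subseteq> (\<Union>p\<in>topspace M. ?B p)" using cr by fastforce
  ultimately obtain \<F> where F: "finite \<F>" "\<F> \<subseteq> ?B ` topspace M" "topspace M \<subseteq> \<Union>\<F>"
    unfolding compactin_def by (metis (no_types, lifting) imageE)
  then obtain P where P: "finite P" "P \<subseteq> topspace M" "\<F> = ?B ` P" by (meson finite_subset_image)
  let ?K = "\<lambda>p. {z \<in> Om (c p). prX z \<in> cball (snd (c p) p) (r p) \<and> 1 \<le> speed (g (c p)) z \<and> speed (g (c p)) z \<le> 2}"
  have "compactin X (\<iota> (c p) ` ?K p)" if "p \<in> P" for p
  proof -
    have p: "c p \<in> A" "0 < r p" "cball (snd (c p) p) (r p) \<subseteq> img (c p)" using cr that P(2) by auto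
    have "compact (?K p)" by (rule annulus_compact[OF p(1,3)]) (use p in simp)
    then have "compactin (top_of_set (Om (c p))) (?K p)" by (auto simp: compactin_subtopology)
    then show ?thesis by (rule image_compactin) (rule \<iota>_continuous[OF p(1)])
  qed
  then have "compactin X (\<Union>p\<in>P. \<iota> (c p) ` ?K p)" using P(1) by (intro compactin_Union) auto
  moreover have "(\<Union>p\<in>P. \<iota> (c p) ` ?K p) = {w \<in> topspace X. 1 \<le> N w \<and> N w \<le> 2}"
  proof (intro set_eqI iffI)
    fix w assume "w \<in> (\<Union>p\<in>P. \<iota> (c p) ` ?K p)"
    then obtain p z where p: "p \<in> P" "z \<in> ?K p" "w = \<iota> (c p) z" by blast
    have cp: "c p \<in> A" using cr p(1) P(2) by auto
    have "w \<in> dom (c p)" "\<kappa> (c p) w = z" using \<iota>_dom[OF cp, of z] p by auto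
    then show "w \<in> {w \<in> topspace X. 1 \<le> N w \<and> N w \<le> 2}"
      using N_eq[OF cp] p by (auto simp: topspace_X dom_def)
  next
    fix w assume w: "w \<in> {w \<in> topspace X. 1 \<le> N w \<and> N w \<le> 2}"
    then have "fst w \<in> topspace M" by (auto simp: topspace_X TM0_def tb)
    then obtain p where p: "p \<in> P" "fst w \<in> ?B p" using F(3) P(3) by blast
    have cp: "c p \<in> A" using cr p(1) P(2) by auto
    have d: "w \<in> dom (c p)" using w p by (auto simp: topspace_X dom_def)
    have "\<kappa> (c p) w \<in> ?K p" using \<kappa>_Om[OF cp d] N_eq[OF cp d] w p(2) by auto
    then have "w \<in> \<iota> (c p) ` ?K p" using \<iota>_\<kappa>[OF cp d] by (metis (no_types, lifting) imageI)
    then show "w \<in> (\<Union>p\<in>P. \<iota> (c p) ` ?K p)" using p(1) by blast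
  qed
  ultimately show ?thesis by simp
qed

sublocale vf: volume_flow X A dom \<kappa> "\<lambda>c. magnetic_field (g c) \<mu>" "\<lambda>c. magnetic_field_deriv (g c) \<mu>" N
proof
  show "Hausdorff_space X" by (rule Haus_X)
  show "topspace X \<subseteq> (\<Union>c\<in>A. dom c)" by (auto simp: topspace_X dom_def TM0_def)
  show "compactin X {x \<in> topspace X. 1 \<le> N x \<and> N x \<le> 2}" by (rule Y_compact)
next
  fix c assume c: "c \<in> A"
  show "openin X (dom c)" by (rule dom_open[OF c])
  show "open (\<kappa> c ` dom c)" unfolding \<kappa>_image[OF c] by (rule Om_open[OF c])
  show "homeomorphic_map (subtopology X (dom c)) (top_of_set (\<kappa> c ` dom c)) (\<kappa> c)" by (rule \<kappa>_homeo[OF c])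
  show "continuous_on (\<kappa> c ` dom c) (\<lambda>z. magnetic_field_deriv (g c) \<mu> z v)" for v
    unfolding \<kappa>_image[OF c] Om_def by (rule metric_chart.magnetic_field_deriv_cont[OF metric_chart[OF c]])
next
  fix c z assume c: "c \<in> A" and z: "z \<in> \<kappa> c ` dom c"
  then have z': "z \<in> metric_chart.Om (img c)" unfolding \<kappa>_image[OF c] Om_def by simp
  show "(magnetic_field (g c) \<mu> has_derivative magnetic_field_deriv (g c) \<mu> z) (at z)" by (rule metric_chart.magnetic_field_derivative[OF metric_chart[OF c] z'])
  show "trace (matrix (magnetic_field_deriv (g c) \<mu> z)) = 0" by (rule metric_chart.magnetic_field_deriv_trace[OF metric_chart[OF c] z'])
next
  fix c d w assume "c \<in> A" "d \<in> A" "w \<in> dom c" "w \<in> dom d"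
  then show "\<exists>D. ((\<kappa> d \<circ> inv_into (dom c) (\<kappa> c)) has_derivative D) (at (\<kappa> c w)) \<and>
     \<bar>det (matrix D)\<bar> = 1 \<and> D (magnetic_field (g c) \<mu> (\<kappa> c w)) = magnetic_field (g d) \<mu> (\<kappa> d w)" by (rule trans)
next
  fix c w assume "c \<in> A" "w \<in> dom c"
  then show "\<exists>D. ((N \<circ> inv_into (dom c) (\<kappa> c)) has_derivative D) (at (\<kappa> c w)) \<and> D (magnetic_field (g c) \<mu> (\<kappa> c w)) = 0"
    by (rule N_deriv)
qed

section \<open>Magnetic geodesics as integral curves\<close>

lemma mg_continuous: "magnetic_geodesic M A g \<mu> \<gamma> \<Longrightarrow> continuous_map euclideanreal M \<gamma>"
  by (simp add: magnetic_geodesic_def)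

lemma mg_chart:
  assumes mg: "magnetic_geodesic M A g \<mu> \<gamma>" and c: "c \<in> A" "\<gamma> t \<in> fst c"
  defines "V \<equiv> \<lambda>s. vector_derivative (snd c \<circ> \<gamma>) (at s)"
  shows "((snd c \<circ> \<gamma>) has_vector_derivative V t) (at t)"
    "(V has_vector_derivative vector_derivative V (at t)) (at t)"
    "V t \<bullet> (g c (snd c (\<gamma> t)) *v V t) = 1"
    "vector_derivative V (at t) + metric_chart.christoffel_quad (g c) (snd c (\<gamma> t)) (V t) = \<mu> *\<^sub>R rot90 (g c (snd c (\<gamma> t))) (V t)"
proof -
  have *: "(snd c \<circ> \<gamma>) differentiable (at t) \<and> V differentiable (at t) \<and>
     V t \<bullet> (g c ((snd c \<circ> \<gamma>) t) *v V t) = 1 \<and>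
     cov_deriv (g c) (snd c \<circ> \<gamma>) V t = \<mu> *\<^sub>R rot90 (g c ((snd c \<circ> \<gamma>) t)) (V t)"
    using mg c unfolding magnetic_geodesic_def Let_def V_def by blast
  then show "((snd c \<circ> \<gamma>) has_vector_derivative V t) (at t)" "(V has_vector_derivative vector_derivative V (at t)) (at t)"
    "V t \<bullet> (g c (snd c (\<gamma> t)) *v V t) = 1"
    by (simp_all add: V_def vector_derivative_works[symmetric])
  show "vector_derivative V (at t) + metric_chart.christoffel_quad (g c) (snd c (\<gamma> t)) (V t) = \<mu> *\<^sub>R rot90 (g c (snd c (\<gamma> t))) (V t)"
    using * cov_deriv_eq[OF metric_chart[OF c(1)], of "snd c \<circ> \<gamma>" t V] by (simp add: V_def)
qed

lemma continuous_eventually: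
  assumes "continuous_map euclideanreal M \<gamma>" "openin M U" "\<gamma> t \<in> U"
  shows "\<forall>\<^sub>F s in nhds t. \<gamma> s \<in> U"
proof -
  have "open {s. \<gamma> s \<in> U}"
    using openin_continuous_map_preimage[OF assms(1,2)] by (simp only: open_openin topspace_euclidean UNIV_I simp_thms)
  then show ?thesis using eventually_nhds_in_open[of "{s. \<gamma> s \<in> U}" t] assms(3) by simp
qed

lemma velocity_tangent:
  assumes mg: "magnetic_geodesic M A g \<mu> \<gamma>"
  shows "velocity A \<gamma> t \<in> tangent_bundle M A"
  unfolding tb
proof (intro conjI allI impI ballI)
  have "\<gamma> t \<in> topspace M" using mg_continuous[OF mg] by (auto simp: continuous_map_def)
  then show "fst (velocity A \<gamma> t) \<in> topspace M" by (simp add: velocity_def)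
next
  fix c assume "\<not> (c \<in> A \<and> fst (velocity A \<gamma> t) \<in> fst c)"
  then show "snd (velocity A \<gamma> t) c = 0" by (auto simp: velocity_def)
next
  fix c d assume c: "c \<in> A" and d: "d \<in> A" and "fst (velocity A \<gamma> t) \<in> fst c \<inter> fst d"
  then have g: "\<gamma> t \<in> fst c" "\<gamma> t \<in> fst d" by (auto simp: velocity_def)
  have x: "snd c (\<gamma> t) \<in> overlap c d" using g by (auto simp: overlap_def)
  let ?v = "vector_derivative (snd c \<circ> \<gamma>) (at t)"
  have "((transition c d \<circ> (snd c \<circ> \<gamma>)) has_vector_derivative J c d (snd c (\<gamma> t)) *v ?v) (at t)"
    using vector_derivative_diff_chain_within[of "snd c \<circ> \<gamma>" ?v t UNIV "transition c d"]
      mg_chart(1)[OF mg c g(1)] has_derivative_at_withinI[OF transition_derivative[OF c d x]] by simp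
  moreover have "\<forall>\<^sub>F s in nhds t. (transition c d \<circ> (snd c \<circ> \<gamma>)) s = (snd d \<circ> \<gamma>) s"
    using continuous_eventually[OF mg_continuous[OF mg] chartD(1)[OF c] g(1)]
    by eventually_elim (use transition_eq[OF c, of _ d] in simp)
  ultimately have "((snd d \<circ> \<gamma>) has_vector_derivative J c d (snd c (\<gamma> t)) *v ?v) (at t)"
    by (rule has_vector_derivative_eventually_cong)
  then have "vector_derivative (snd d \<circ> \<gamma>) (at t) = J c d (snd c (\<gamma> t)) *v ?v" by (rule vector_derivative_at)
  then show "snd (velocity A \<gamma> t) d = J c d (snd c (fst (velocity A \<gamma> t))) *v snd (velocity A \<gamma> t) c"
    using c d g by (simp add: velocity_def)
qed

lemma velocity_nth: "c \<in> A \<Longrightarrow> \<gamma> t \<in> fst c \<Longrightarrow> snd (velocity A \<gamma> t) c = vector_derivative (snd c \<circ> \<gamma>) (at t)"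
  and fst_velocity: "fst (velocity A \<gamma> t) = \<gamma> t"
  by (simp_all add: velocity_def)

lemma N_eq_sqrt:
  assumes c: "c \<in> A" and w: "w \<in> dom c"
  shows "N w = sqrt (snd w c \<bullet> (g c (snd c (fst w)) *v snd w c))"
proof -
  have "snd c (fst w) \<in> img c" using w by (auto simp: dom_def img_def)
  then show ?thesis unfolding N_eq[OF c w] \<kappa>_def by (rule speed_pack[OF c])
qed

text \<open>In a chart the curve (x, g x') has derivative (x', \<open>momentum_rate\<close>), and
  \<open>magnetic_iff_magnetic_field\<close> recognises this as the field.\<close>

lemma mg_integral_curve:
  assumes mg: "magnetic_geodesic M A g \<mu> \<gamma>"
  shows "vf.integral_curve (velocity A \<gamma>) t"
proof -
  have "\<gamma> t \<in> topspace M" using mg_continuous[OF mg] by (auto simp: continuous_map_def)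
  then obtain c where c: "c \<in> A" "\<gamma> t \<in> fst c" using chart_exists by blast
  interpret m: metric_chart "img c" "g c" by (rule metric_chart[OF c(1)])
  let ?V = "\<lambda>s. vector_derivative (snd c \<circ> \<gamma>) (at s)" and ?x = "snd c \<circ> \<gamma>"
  have ev: "\<forall>\<^sub>F s in nhds t. \<gamma> s \<in> fst c" by (rule continuous_eventually[OF mg_continuous[OF mg] chartD(1)[OF c(1)] c(2)])
  have dom: "velocity A \<gamma> s \<in> dom c" if s: "\<gamma> s \<in> fst c" for s
  proof -
    have "?V s \<noteq> 0" using mg_chart(3)[OF mg c(1) s] by auto
    then show ?thesis using velocity_tangent[OF mg, of s] c(1) s velocity_nth[of c \<gamma> s]
      unfolding dom_def TM0_def by (auto simp: fst_velocity)
  qed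
  have \<kappa>v: "\<kappa> c (velocity A \<gamma> s) = pack (?x s) (g c (?x s) *v ?V s)" if "\<gamma> s \<in> fst c" for s
    unfolding \<kappa>_def fst_velocity velocity_nth[of c \<gamma> s, OF c(1) that] by simp
  have x: "?x t \<in> img c" using c(2) by (auto simp: img_def)
  note mc = mg_chart[OF mg c]
  have "((\<lambda>s. pack (?x s) (g c (?x s) *v ?V s)) has_vector_derivative pack (?V t) (m.momentum_rate (?x t) (?V t) (vector_derivative ?V (at t)))) (at t)"
    by (rule m.momentum_derivative[OF x mc(1,2)])
  moreover have "pack (?V t) (m.momentum_rate (?x t) (?V t) (vector_derivative ?V (at t))) = magnetic_field (g c) \<mu> (\<kappa> c (velocity A \<gamma> t))"
    unfolding \<kappa>v[OF c(2)] by (rule m.magnetic_iff_magnetic_field[THEN iffD1, OF x]) (use mc(3,4) in simp_all)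
  ultimately have "((\<lambda>s. pack (?x s) (g c (?x s) *v ?V s)) has_vector_derivative magnetic_field (g c) \<mu> (\<kappa> c (velocity A \<gamma> t))) (at t)" by simp
  then have "((\<lambda>s. \<kappa> c (velocity A \<gamma> s)) has_vector_derivative magnetic_field (g c) \<mu> (\<kappa> c (velocity A \<gamma> t))) (at t)"
    by (rule has_vector_derivative_eventually_cong) (use ev \<kappa>v in \<open>auto elim!: eventually_mono\<close>)
  moreover have "\<forall>\<^sub>F s in nhds t. velocity A \<gamma> s \<in> dom c" using ev by eventually_elim (rule dom)
  ultimately show ?thesis unfolding vf.integral_curve_def using c(1) by blast
qed

text \<open>The position part of the field is velocity over speed, so on the level
  \<open>N = 1\<close> the base curve has velocity \<open>u\<close> itself. The derivative of the
  momentum is then known both from the product rule and from the field, and equating the two gives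
  the magnetic equation.\<close>

lemma integral_curve_mg:
  assumes integral_curve: "\<And>t. vf.integral_curve u t" and N: "\<And>t. N (u t) = 1"
  shows "magnetic_geodesic M A g \<mu> (fst \<circ> u)" "velocity A (fst \<circ> u) t = u t"
proof -
  have uT: "u t \<in> TM0" for t using vf.integral_curve_topspace[OF integral_curve] by (simp add: topspace_X)
  have dom_iff: "u t \<in> dom c \<longleftrightarrow> fst (u t) \<in> fst c" for t c using uT by (simp add: dom_def)
  have x': "((snd c \<circ> (fst \<circ> u)) has_vector_derivative snd (u t) c) (at t)" if c: "c \<in> A" "fst (u t) \<in> fst c" for c t
  proof -
    have d: "u t \<in> dom c" using c dom_iff by simp
    have k: "((\<lambda>s. prX (\<kappa> c (u s))) has_vector_derivative prX (magnetic_field (g c) \<mu> (\<kappa> c (u t)))) (at t)"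
      by (rule bounded_linear.has_vector_derivative[OF bounded_linear_prX vf.integral_curve_chart(2)[OF integral_curve c(1) d]])
    have e: "prX (magnetic_field (g c) \<mu> (\<kappa> c (u t))) = snd (u t) c"
      using N[of t] N_eq[OF c(1) d] \<kappa>_Om(2)[OF c(1) d] by (simp add: magnetic_field_def vel_def)
    have "\<forall>\<^sub>F s in nhds t. prX (\<kappa> c (u s)) = (snd c \<circ> (fst \<circ> u)) s"
      using vf.integral_curve_chart(1)[OF integral_curve c(1) d] by eventually_elim (simp add: \<kappa>_Om(3)[OF c(1)])
    from has_vector_derivative_eventually_cong[OF k this] show ?thesis unfolding e .
  qed
  then have vd: "vector_derivative (snd c \<circ> (fst \<circ> u)) (at t) = snd (u t) c" if "c \<in> A" "fst (u t) \<in> fst c" for c t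
    using that vector_derivative_at by blast
  show "velocity A (fst \<circ> u) t = u t"
  proof -
    have "(if c \<in> A \<and> fst (u t) \<in> fst c then vector_derivative (snd c \<circ> (fst \<circ> u)) (at t) else 0) = snd (u t) c" for c
      using vd[of c t] tb_zero[of "u t" c] uT[of t] TM0_sub by auto
    then show ?thesis by (simp add: velocity_def prod_eq_iff fun_eq_iff)
  qed
  show "magnetic_geodesic M A g \<mu> (fst \<circ> u)"
    unfolding magnetic_geodesic_def Let_def
  proof (intro conjI ballI allI impI)
    show "continuous_map euclideanreal M (fst \<circ> u)"
      unfolding continuous_map_def
    proof (intro conjI allI impI)
      show "fst \<circ> u \<in> topspace euclideanreal \<rightarrow> topspace M" using uT by (auto simp: TM0_def tb)
      fix U assume U: "openin M U"
      have "open {t. fst (u t) \<in> U}"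
      proof (subst open_subopen, intro ballI)
        fix t assume t: "t \<in> {t. fst (u t) \<in> U}"
        have "\<forall>\<^sub>F s in nhds t. u s \<in> {w \<in> TM0. fst w \<in> U}"
          by (rule vf.integral_curve_eventually[OF integral_curve fst_vimage_open[OF U]]) (use t uT in simp)
        then have "\<forall>\<^sub>F s in nhds t. s \<in> {t. fst (u t) \<in> U}" by eventually_elim simp
        then show "\<exists>T. open T \<and> t \<in> T \<and> T \<subseteq> {t. fst (u t) \<in> U}" unfolding eventually_nhds by blast
      qed
      then show "openin euclideanreal {x \<in> topspace euclideanreal. (fst \<circ> u) x \<in> U}"
        by (simp only: open_openin topspace_euclidean UNIV_I simp_thms o_def)
    qed
  next
    fix c t assume c: "c \<in> A" "(fst \<circ> u) t \<in> fst c"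
    interpret m: metric_chart "img c" "g c" by (rule metric_chart[OF c(1)])
    let ?V = "\<lambda>s. vector_derivative (snd c \<circ> (fst \<circ> u)) (at s)" and ?x = "snd c \<circ> (fst \<circ> u)"
    have ft: "fst (u t) \<in> fst c" using c by simp
    have d: "u t \<in> dom c" using ft dom_iff by simp
    have ev: "\<forall>\<^sub>F s in nhds t. u s \<in> dom c" by (rule vf.integral_curve_chart(1)[OF integral_curve c(1) d])
    have x: "?x t \<in> img c" using ft by (auto simp: img_def)
    have z: "\<kappa> c (u t) \<in> m.Om" using \<kappa>_Om(1)[OF c(1) d] by (simp add: Om_def)
    have zS: "prX (\<kappa> c (u t)) \<in> img c" using x \<kappa>_Om(3)[OF c(1) d] by simp
    have dx: "(?x has_vector_derivative ?V t) (at t)" using x'[OF c(1) ft] vd[OF c(1) ft] by simp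
    then show "?x differentiable (at t)" by (rule differentiableI_vector)
    note k = vf.integral_curve_chart(2)[OF integral_curve c(1) d]
    have comp: "((\<lambda>s. f (\<kappa> c (u s))) has_vector_derivative f' (magnetic_field (g c) \<mu> (\<kappa> c (u t)))) (at t)"
      if "(f has_derivative f') (at (\<kappa> c (u t)))" for f :: "real^4 \<Rightarrow> real" and f'
      using vector_derivative_diff_chain_within[of "\<lambda>s. \<kappa> c (u s)" _ t UNIV f, OF k has_derivative_at_withinI[OF that]] by (simp add: o_def)
    \<comment> \<open>The acceleration: the derivative of the velocity functions along the field. It
      also shows that the base curve is twice differentiable.\<close>
    let ?a = "vector [dV1 (g c) (\<kappa> c (u t)) (magnetic_field (g c) \<mu> (\<kappa> c (u t))), dV2 (g c) (\<kappa> c (u t)) (magnetic_field (g c) \<mu> (\<kappa> c (u t)))] :: real^2"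
    have "((\<lambda>s. vel c (\<kappa> c (u s))) has_vector_derivative ?a) (at t)"
      unfolding has_vector_derivative_def
    proof (rule has_derivative_cart)
      fix i :: 2
      show "((\<lambda>s. vel c (\<kappa> c (u s)) $ i) has_derivative (\<lambda>h. (h *\<^sub>R ?a) $ i)) (at t)"
        using comp[OF m.V_derivative(1)[OF zS]] comp[OF m.V_derivative(2)[OF zS]] exhaust_2[of i]
        by (auto simp: vel_def has_vector_derivative_def)
    qed
    moreover have "\<forall>\<^sub>F s in nhds t. vel c (\<kappa> c (u s)) = ?V s"
      using ev by eventually_elim (use \<kappa>_Om(2)[OF c(1)] vd[OF c(1)] dom_iff in simp)
    ultimately have dV: "(?V has_vector_derivative ?a) (at t)" by (rule has_vector_derivative_eventually_cong)
    then show "?V differentiable (at t)" by (rule differentiableI_vector)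
    have "snd (u t) c \<bullet> (g c (snd c (fst (u t))) *v snd (u t) c) = 1"
      using N_eq_sqrt[OF c(1) d] N[of t] by simp
    then show unit: "?V t \<bullet> (g c (?x t) *v ?V t) = 1" by (simp add: vd[OF c(1) ft])
    have dP: "((\<lambda>s. pack (?x s) (g c (?x s) *v ?V s)) has_vector_derivative pack (?V t) (m.momentum_rate (?x t) (?V t) ?a)) (at t)"
      by (rule m.momentum_derivative[OF x dx dV])
    have ke: "\<kappa> c (u s) = pack (?x s) (g c (?x s) *v ?V s)" if "u s \<in> dom c" for s
      using that vd[OF c(1), of s] dom_iff unfolding \<kappa>_def by simp
    have "((\<lambda>s. pack (?x s) (g c (?x s) *v ?V s)) has_vector_derivative magnetic_field (g c) \<mu> (\<kappa> c (u t))) (at t)"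
      by (rule has_vector_derivative_eventually_cong[OF k]) (use ev ke in \<open>auto elim!: eventually_mono\<close>)
    from vector_derivative_unique_at[OF dP this]
    have "pack (?V t) (m.momentum_rate (?x t) (?V t) ?a) = magnetic_field (g c) \<mu> (pack (?x t) (g c (?x t) *v ?V t))" unfolding ke[OF d] .
    then have "?a + m.christoffel_quad (?x t) (?V t) = \<mu> *\<^sub>R rot90 (g c (?x t)) (?V t)"
      by (rule m.magnetic_iff_magnetic_field[THEN iffD2, OF x unit])
    then show "cov_deriv (g c) ?x ?V t = \<mu> *\<^sub>R rot90 (g c (?x t)) (?V t)"
      unfolding cov_deriv_eq[OF metric_chart[OF c(1)], of ?x t ?V, OF refl] vector_derivative_at[OF dV] .
  qed
qed

lemma unit_iff: "w \<in> unit_tangent_bundle M A g \<longleftrightarrow> w \<in> TM0 \<and> N w = 1"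
proof -
  have u: "w \<in> unit_tangent_bundle M A g \<longleftrightarrow> w \<in> tangent_bundle M A \<and>
     (\<forall>c\<in>A. fst w \<in> fst c \<longrightarrow> snd w c \<bullet> (g c (snd c (fst w)) *v snd w c) = 1)"
    by (cases w) (simp add: unit_tangent_bundle_def)
  show ?thesis
  proof
    assume w: "w \<in> unit_tangent_bundle M A g"
    then have "fst w \<in> topspace M" unfolding u tb by blast
    then obtain c where c: "c \<in> A" "fst w \<in> fst c" using chart_exists by blast
    have one: "snd w c \<bullet> (g c (snd c (fst w)) *v snd w c) = 1" using w c unfolding u by blast
    then have "snd w c \<noteq> 0" by auto
    then have T: "w \<in> TM0" using w c unfolding u TM0_def by blast
    then have "w \<in> dom c" using c by (simp add: dom_def)
    then show "w \<in> TM0 \<and> N w = 1" using T N_eq_sqrt[OF c(1)] one by simp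
  next
    assume w: "w \<in> TM0 \<and> N w = 1"
    show "w \<in> unit_tangent_bundle M A g"
      unfolding u
    proof (intro conjI ballI impI)
      show "w \<in> tangent_bundle M A" using w TM0_sub by blast
      fix c assume c: "c \<in> A" "fst w \<in> fst c"
      then have "w \<in> dom c" using w by (simp add: dom_def)
      from N_eq_sqrt[OF c(1) this] w show "snd w c \<bullet> (g c (snd c (fst w)) *v snd w c) = 1" by simp
    qed
  qed
qed

lemma Y_iff: "w \<in> vf.Y \<longleftrightarrow> w \<in> TM0 \<and> 1 \<le> N w \<and> N w \<le> 2"
  by (simp add: vf.Y_def topspace_X)

lemma N_flow: "w \<in> vf.Y \<Longrightarrow> N (vf.flow t w) = N w"
  using vf.integral_curve_N_const[of UNIV "\<lambda>t. vf.flow t w" t 0] vf.flow[of w] by simp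

text \<open>The definite description needs both directions: \<open>integral_curve_mg\<close>
  supplies a magnetic geodesic, and any other one has a velocity that is an integral curve with the
  same start, hence the same curve.\<close>

lemma magnetic_flow_eq:
  assumes v: "v \<in> unit_tangent_bundle M A g"
  shows "magnetic_flow M A g \<mu> t v = vf.flow t v"
proof -
  have vY: "v \<in> vf.Y" and N1: "N v = 1" using v unfolding unit_iff Y_iff by auto
  let ?u = "\<lambda>t. vf.flow t v"
  note m = integral_curve_mg[of ?u, OF vf.flow(2)[OF vY]]
  have N: "N (?u t) = 1" for t using N_flow[OF vY] N1 by simp
  have "magnetic_geodesic_from M A g \<mu> v = fst \<circ> ?u"
    unfolding magnetic_geodesic_from_def
  proof (rule the_equality)
    show "magnetic_geodesic M A g \<mu> (fst \<circ> ?u) \<and> velocity A (fst \<circ> ?u) 0 = v"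
      using m[OF N] vf.flow(1)[OF vY] by simp
    fix \<gamma> assume g: "magnetic_geodesic M A g \<mu> \<gamma> \<and> velocity A \<gamma> 0 = v"
    have "velocity A \<gamma> t = ?u t" for t
      by (rule vf.flow_eqI[OF vY]) (use g mg_integral_curve in blast)+
    note * = this
    show "\<gamma> = fst \<circ> ?u"
    proof (rule ext)
      fix t show "\<gamma> t = (fst \<circ> ?u) t" using arg_cong[OF *[of t], of fst] by (simp add: fst_velocity)
    qed
  qed
  then show ?thesis unfolding magnetic_flow_def using m(2)[OF N] by simp
qed

section \<open>Homogeneity and the thickened open set\<close>

definition rescale :: "real \<Rightarrow> 'a tangent \<Rightarrow> 'a tangent" where
  "rescale r w = (fst w, \<lambda>c. r *\<^sub>R snd w c)"
definition rescale_momentum :: "real \<Rightarrow> real^4 \<Rightarrow> real^4" where "rescale_momentum r z = pack (prX z) (r *\<^sub>R prP z)"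

lemma rescale_inverse: "r \<noteq> 0 \<Longrightarrow> rescale (1 / r) (rescale r w) = w"
  by (simp add: rescale_def)

lemma rescale_TM0: assumes r: "r \<noteq> 0" and w: "w \<in> TM0" shows "rescale r w \<in> TM0"
proof -
  have wt: "w \<in> tangent_bundle M A" using w TM0_sub by blast
  have "rescale r w \<in> tangent_bundle M A"
    unfolding tb
  proof (intro conjI allI impI ballI)
    show "fst (rescale r w) \<in> topspace M" using wt by (simp add: rescale_def tb)
  next
    fix c assume "\<not> (c \<in> A \<and> fst (rescale r w) \<in> fst c)"
    then show "snd (rescale r w) c = 0" using tb_zero[OF wt, of c] by (simp add: rescale_def)
  next
    fix c d assume "c \<in> A" "d \<in> A" "fst (rescale r w) \<in> fst c \<inter> fst d"
    then show "snd (rescale r w) d = J c d (snd c (fst (rescale r w))) *v snd (rescale r w) c"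
      using tb_change[OF wt, of c d] by (simp add: rescale_def matrix_vector_mult_scaleR)
  qed
  then show ?thesis using w r by (auto simp: TM0_def rescale_def)
qed

lemma rescale_dom: "r \<noteq> 0 \<Longrightarrow> w \<in> dom c \<Longrightarrow> rescale r w \<in> dom c"
  using rescale_TM0[of r w] by (simp add: dom_def) (simp add: rescale_def)

lemma \<kappa>_rescale: "\<kappa> c (rescale r w) = rescale_momentum r (\<kappa> c w)"
  by (simp add: \<kappa>_def rescale_def rescale_momentum_def matrix_vector_mult_scaleR)

lemma bounded_linear_rescale_momentum: "bounded_linear (rescale_momentum r)"
  unfolding linear_conv_bounded_linear[symmetric]
  by (rule linearI) (simp_all add: rescale_momentum_def vec_eq_iff forall_4 algebra_simps)

lemma V_rescale_momentum: "V1 G (rescale_momentum r z) = r * V1 G z" "V2 G (rescale_momentum r z) = r * V2 G z"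
  by (simp_all add: V1_def V2_def rescale_momentum_def diff_divide_distrib algebra_simps)

lemma speed_rescale_momentum: assumes "0 < r" shows "speed G (rescale_momentum r z) = r * speed G z"
proof -
  have "rescale_momentum r z $ 3 * V1 G (rescale_momentum r z) + rescale_momentum r z $ 4 * V2 G (rescale_momentum r z) = r\<^sup>2 * (z$3 * V1 G z + z$4 * V2 G z)"
    unfolding V_rescale_momentum by (simp add: rescale_momentum_def power2_eq_square algebra_simps)
  then show ?thesis using assms unfolding speed_def by (simp add: real_sqrt_mult)
qed

text \<open>The velocity of the position is homogeneous of degree 0 in the momentum and the force of
  degree 1, just as the two components behave under \<open>rescale_momentum\<close>.\<close>

lemma magnetic_field_rescale_momentum: assumes "0 < r" shows "magnetic_field G \<mu> (rescale_momentum r z) = rescale_momentum r (magnetic_field G \<mu> z)"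
proof -
  have p: "prX (rescale_momentum r z) = prX z" by (simp add: rescale_momentum_def)
  have q: "dquad G x v (r * a) (r * b) / (2 * (r * n)) = r * (dquad G x v a b / (2 * n))" for x v a b n
  proof -
    have "dquad G x v (r * a) (r * b) = r * (r * dquad G x v a b)"
      by (simp add: dquad_def quad_def power2_eq_square algebra_simps)
    \<comment> \<open>For \<open>n = 0\<close> both sides vanish by the convention
      \<open>x / 0 = 0\<close>, so the identity holds at every \<open>z\<close>.\<close>
    then show ?thesis using assms by (cases "n = 0") (simp_all add: field_simps)
  qed
  have "r * a / (r * n) = a / n" for a n :: real using assms by simp
  then have "magnetic_field G \<mu> (rescale_momentum r z) = pack (vector [V1 G z / speed G z, V2 G z / speed G z])
    (vector [r * (dquad G (prX z) (axis 1 1) (V1 G z) (V2 G z) / (2 * speed G z)) - \<mu> * sqrt (gD G (prX z)) * (r * V2 G z),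
             r * (dquad G (prX z) (axis 2 1) (V1 G z) (V2 G z) / (2 * speed G z)) + \<mu> * sqrt (gD G (prX z)) * (r * V1 G z)])"
    unfolding magnetic_field_def p V_rescale_momentum speed_rescale_momentum[OF assms] q by simp
  also have "\<dots> = rescale_momentum r (magnetic_field G \<mu> z)"
    by (simp add: rescale_momentum_def magnetic_field_def vec_eq_iff forall_4 algebra_simps)
  finally show ?thesis .
qed

lemma N_rescale: assumes "0 < r" "w \<in> TM0" shows "N (rescale r w) = r * N w"
proof -
  obtain c where c: "c \<in> A" "fst w \<in> fst c" using assms(2) by (auto simp: TM0_def)
  have d: "w \<in> dom c" using c assms(2) by (simp add: dom_def)
  have "rescale r w \<in> dom c" by (rule rescale_dom[OF _ d]) (use assms in simp)
  then show ?thesis using N_eq[OF c(1)] d speed_rescale_momentum[OF assms(1)] by (simp add: \<kappa>_rescale)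
qed

lemma integral_curve_rescale: assumes r: "0 < r" and integral_curve: "vf.integral_curve u t" shows "vf.integral_curve (\<lambda>s. rescale r (u s)) t"
proof -
  obtain c where c: "c \<in> A" and ev: "\<forall>\<^sub>F s in nhds t. u s \<in> dom c"
    and d: "((\<lambda>s. \<kappa> c (u s)) has_vector_derivative magnetic_field (g c) \<mu> (\<kappa> c (u t))) (at t)"
    using integral_curve unfolding vf.integral_curve_def by blast
  have "\<forall>\<^sub>F s in nhds t. rescale r (u s) \<in> dom c" using ev by eventually_elim (rule rescale_dom, use r in auto)
  moreover have "((\<lambda>s. \<kappa> c (rescale r (u s))) has_vector_derivative magnetic_field (g c) \<mu> (\<kappa> c (rescale r (u t)))) (at t)"
    unfolding \<kappa>_rescale magnetic_field_rescale_momentum[OF r] by (rule bounded_linear.has_vector_derivative[OF bounded_linear_rescale_momentum d])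
  ultimately show ?thesis unfolding vf.integral_curve_def using c by blast
qed

lemma flow_rescale: assumes r: "0 < r" and w: "w \<in> vf.Y" "rescale r w \<in> vf.Y" shows "rescale r (vf.flow t w) = vf.flow t (rescale r w)"
  by (rule vf.flow_eqI[OF w(2), of "\<lambda>t. rescale r (vf.flow t w)"]) (use vf.flow[OF w(1)] integral_curve_rescale[OF r] in auto)

text \<open>The set is the cone over \<open>O'\<close> cut to lengths between 1 and 2. In a chart,
  membership says that the speed lies strictly between 1 and 2 and that the normalised coordinates
  represent a vector in \<open>O'\<close>; both conditions are continuous in the
  coordinates.\<close>

lemma shell_open:
  assumes O': "openin (tangent_topology M A) O'"
  shows "openin X {w \<in> TM0. 1 < N w \<and> N w < 2 \<and> rescale (1 / N w) w \<in> O'}"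
proof (subst openin_subopen, intro ballI)
  let ?U = "{w \<in> TM0. 1 < N w \<and> N w < 2 \<and> rescale (1 / N w) w \<in> O'}"
  fix w assume w: "w \<in> ?U"
  then obtain c where c: "c \<in> A" "fst w \<in> fst c" by (auto simp: TM0_def)
  interpret m: metric_chart "img c" "g c" by (rule metric_chart[OF c(1)])
  have wd: "w \<in> dom c" using w c by (simp add: dom_def)
  have OX: "openin X (O' \<inter> TM0)" using O' by (auto simp: X_def openin_subtopology)
  let ?\<Omega>0 = "Om c \<inter> \<iota> c -` (O' \<inter> TM0)"
  have "openin (top_of_set (Om c)) {z \<in> topspace (top_of_set (Om c)). \<iota> c z \<in> O' \<inter> TM0}"
    by (rule openin_continuous_map_preimage[OF \<iota>_continuous[OF c(1)] OX])
  moreover have "{z \<in> topspace (top_of_set (Om c)). \<iota> c z \<in> O' \<inter> TM0} = ?\<Omega>0" by auto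
  ultimately have o0: "open ?\<Omega>0" using openin_open_eq[OF Om_open[OF c(1)]] by simp
  have nc: "continuous_on (Om c) (speed (g c))" unfolding Om_def by (rule m.V_cont(3))
  let ?\<Omega>1 = "Om c \<inter> speed (g c) -` {1<..<2}"
  have o1: "open ?\<Omega>1" by (rule continuous_open_preimage[OF nc Om_open[OF c(1)]]) simp
  let ?\<phi> = "\<lambda>z. rescale_momentum (1 / speed (g c) z) z"
  have "continuous_on ?\<Omega>1 ?\<phi>"
  proof (rule continuous_on_4I)
    have n: "continuous_on ?\<Omega>1 (speed (g c))" by (rule continuous_on_subset[OF nc]) blast
    have n0: "\<forall>z\<in>?\<Omega>1. speed (g c) z \<noteq> 0" by auto
    show "continuous_on ?\<Omega>1 (\<lambda>z. ?\<phi> z $ 1)" "continuous_on ?\<Omega>1 (\<lambda>z. ?\<phi> z $ 2)"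
      by (simp_all add: rescale_momentum_def, (intro continuous_intros)+)
    show "continuous_on ?\<Omega>1 (\<lambda>z. ?\<phi> z $ 3)" "continuous_on ?\<Omega>1 (\<lambda>z. ?\<phi> z $ 4)"
      unfolding rescale_momentum_def pack_nth vector_scaleR_component prP_nth real_scaleR_def
      by (intro continuous_intros n n0)+
  qed
  then have o2: "open (?\<Omega>1 \<inter> ?\<phi> -` ?\<Omega>0)" by (rule continuous_open_preimage[OF _ o1 o0])
  have iff: "v \<in> ?U \<longleftrightarrow> \<kappa> c v \<in> ?\<Omega>1 \<inter> ?\<phi> -` ?\<Omega>0" if v: "v \<in> dom c" for v
  proof -
    have vT: "v \<in> TM0" using v by (simp add: dom_def)
    have n: "N v = speed (g c) (\<kappa> c v)" by (rule N_eq[OF c(1) v])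
    have "0 < N v" unfolding n using m.speed_pos(1) \<kappa>_Om(1)[OF c(1) v] by (simp add: Om_def)
    then have r: "1 / N v \<noteq> 0" by simp
    have s: "rescale (1 / N v) v \<in> dom c" by (rule rescale_dom[OF r v])
    have "?\<phi> (\<kappa> c v) = \<kappa> c (rescale (1 / N v) v)" unfolding n \<kappa>_rescale ..
    then have "\<iota> c (?\<phi> (\<kappa> c v)) = rescale (1 / N v) v" "?\<phi> (\<kappa> c v) \<in> Om c"
      using \<iota>_\<kappa>[OF c(1) s] \<kappa>_Om(1)[OF c(1) s] by simp_all
    then show ?thesis using vT \<kappa>_Om(1)[OF c(1) v] n rescale_TM0[OF r vT] by auto
  qed
  have "openin X {v \<in> dom c. \<kappa> c v \<in> ?\<Omega>1 \<inter> ?\<phi> -` ?\<Omega>0}" by (rule \<kappa>_vimage_open[OF c(1) o2])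
  moreover have "w \<in> {v \<in> dom c. \<kappa> c v \<in> ?\<Omega>1 \<inter> ?\<phi> -` ?\<Omega>0}" using iff[OF wd] w wd by blast
  moreover have "{v \<in> dom c. \<kappa> c v \<in> ?\<Omega>1 \<inter> ?\<phi> -` ?\<Omega>0} \<subseteq> ?U" using iff by blast
  ultimately show "\<exists>T. openin X T \<and> w \<in> T \<and> T \<subseteq> ?U" by blast
qed

section \<open>Nonwandering points of the magnetic flow\<close>

lemma topspace_unit: "topspace (unit_tangent_topology M A g) = unit_tangent_bundle M A g"
proof -
  have "unit_tangent_bundle M A g \<subseteq> tangent_bundle M A" using unit_iff TM0_sub by blast
  then show ?thesis by (auto simp: unit_tangent_topology_def topspace_tangent)
qed

theorem nonwandering:
  "nonwandering_set (unit_tangent_topology M A g) (magnetic_flow M A g \<mu>) = unit_tangent_bundle M A g"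
proof
  show "nonwandering_set (unit_tangent_topology M A g) (magnetic_flow M A g \<mu>) \<subseteq> unit_tangent_bundle M A g"
    unfolding nonwandering_set_def topspace_unit by blast
  show "unit_tangent_bundle M A g \<subseteq> nonwandering_set (unit_tangent_topology M A g) (magnetic_flow M A g \<mu>)"
    unfolding nonwandering_set_def topspace_unit
  proof (intro subsetI CollectI conjI allI impI)
    fix v U and T0 :: real
    assume v: "v \<in> unit_tangent_bundle M A g"
      and U: "openin (unit_tangent_topology M A g) U \<and> v \<in> U" and T0: "0 < T0"
    then obtain O' where O': "openin (tangent_topology M A) O'" "U = O' \<inter> unit_tangent_bundle M A g"
      by (auto simp: unit_tangent_topology_def openin_subtopology)
    let ?U = "{w \<in> TM0. 1 < N w \<and> N w < 2 \<and> rescale (1 / N w) w \<in> O'}"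
    have vT: "v \<in> TM0" "N v = 1" using v unit_iff by auto
    \<comment> \<open>Any factor strictly between 1 and 2 would do; it moves \<open>v\<close> into
      the open shell and shows that the thickened set is not empty.\<close>
    have sT: "rescale (3/2) v \<in> TM0" and sN: "N (rescale (3/2) v) = 3/2"
      using rescale_TM0[OF _ vT(1), of "3/2"] N_rescale[OF _ vT(1), of "3/2"] vT(2) by auto
    have inv: "rescale (1 / N (rescale (3/2) v)) (rescale (3/2) v) = v" unfolding sN by (rule rescale_inverse) simp
    have "rescale (3/2) v \<in> ?U"
    proof (intro CollectI conjI sT)
      show "1 < N (rescale (3/2) v)" "N (rescale (3/2) v) < 2" unfolding sN by simp_all
      show "rescale (1 / N (rescale (3/2) v)) (rescale (3/2) v) \<in> O'" unfolding inv using U O' by blast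
    qed
    then have ne: "?U \<noteq> {}" by blast
    have UY: "?U \<subseteq> vf.Y" using Y_iff by auto
    obtain t w where t: "t > T0" "w \<in> ?U" "vf.flow t w \<in> ?U"
      using vf.recurrence[OF shell_open[OF O'(1)] UY ne T0] by blast
    have wY: "w \<in> vf.Y" using t(2) UY by blast
    \<comment> \<open>The length is preserved, so the point and its return are normalised by the
      same factor, and the return takes place between unit vectors of \<open>U\<close>.\<close>
    have Nf: "N (vf.flow t w) = N w" by (rule N_flow[OF wY])
    have r: "0 < 1 / N w" using t(2) by simp
    let ?w = "rescale (1 / N w) w"
    have "?w \<in> TM0" "N ?w = 1" using t(2) rescale_TM0[of "1 / N w" w] N_rescale[OF r, of w] by auto
    then have wu: "?w \<in> unit_tangent_bundle M A g" and wY': "?w \<in> vf.Y" using unit_iff Y_iff by auto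
    have f: "vf.flow t ?w = rescale (1 / N w) (vf.flow t w)" using flow_rescale[OF r wY wY'] by simp
    have "vf.flow t ?w \<in> vf.Y" "N (vf.flow t ?w) = 1" using vf.flow(3)[OF wY'] N_flow[OF wY'] \<open>N ?w = 1\<close> by auto
    then have "vf.flow t ?w \<in> unit_tangent_bundle M A g" using unit_iff Y_iff by auto
    moreover have "vf.flow t ?w \<in> O'" using t(3) f Nf by simp
    ultimately have "magnetic_flow M A g \<mu> t ?w \<in> U" using O'(2) magnetic_flow_eq[OF wu] by simp
    moreover have "?w \<in> U" using t(2) wu O'(2) by simp
    ultimately have "magnetic_flow M A g \<mu> t ` U \<inter> U \<noteq> {}" by blast
    then show "\<exists>t>T0. magnetic_flow M A g \<mu> t ` U \<inter> U \<noteq> {}" using t(1) by blast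
  qed
qed

end

theorem corollary3p65:
  fixes M :: "'a topology" and A :: "'a chart set"
    and g :: "'a chart \<Rightarrow> real^2 \<Rightarrow> real^2^2" and \<mu> :: real
  assumes "oriented_riemannian_surface M A g"
    and "connected_space M" and "compact_space M"
    and "\<forall>p\<in>topspace M. gauss_curvature A g p < 0"
    and "\<forall>p\<in>topspace M. gauss_curvature A g p + \<mu>^2 \<le> 0"
    and "\<exists>p\<in>topspace M. gauss_curvature A g p + \<mu>^2 < 0"
  shows "nonwandering_set (unit_tangent_topology M A g) (magnetic_flow M A g \<mu>)
       = unit_tangent_bundle M A g"
proof -
  interpret rsurface M A g \<mu> by unfold_locales (rule assms(1) assms(3))+
  show ?thesis by (rule nonwandering)
qed

end
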